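(* Let $X$ follow the model below and let $\gamma(t)=\gamma_0 r(t)$. There exists a universal choice of $\gamma_0>0$ and universal constants $C_0,C_1>0$ such that the following holds for every penalty function $\lambda:[p]\to\mathbb{R}$, every $\alpha\in(1,2]$ and every $K\ge2$. Let $\widehat J$ and $\widehat\eta_1<\dots<\widehat\eta_{\widehat J}$ be the number and (sorted) locations of the changepoints output by ESAC run on input $\widetilde X=X/\sigma$ with seeded intervals $\mathcal{M}(\alpha,K)$ and penalty functions $\gamma,\lambda$. If $\phi_j^2\Delta_j/\sigma^2\ge C_0\, r(k_j)$ for all $j\in[J]$, then $$\mathbb{P}\Big\{\widehat J=J\ \text{ and }\ |\widehat\eta_j-\eta_j|\le C_1\frac{\sigma^2}{\phi_j^2}r(k_j)\ \ \forall j\in[J]\Big\}>1-\frac1n .$$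
   Context: Model: integers $n\ge2$, $p\ge1$, $\sigma>0$. We observe $X=\mu+W\in\mathbb{R}^{p\times n}$ where the entries $W_{i,v}$ are i.i.d. $N(0,\sigma^2)$ and $\mu\in\mathbb{R}^{p\times n}$ is deterministic with columns $\mu_v$. There are $J\ge0$ changepoints $0<\eta_1<\dots<\eta_J<n$ such that $\mu_v\ne\mu_{v+1}$ iff $v=\eta_j$ for some $j$. Let $\theta_j=\mu_{\eta_j+1}-\mu_{\eta_j}$, $\phi_j=\|\theta_j\|_2$, $k_j=\|\theta_j\|_0$, $\Delta_j=\min(\eta_j-\eta_{j-1},\eta_{j+1}-\eta_j)$ with $\eta_0=0,\eta_{J+1}=n$. Logarithms are natural. CUSUM: for $y\in\mathbb{R}^n$, $0\le s<v<e\le n$, $T^v_{(s,e]}(y)=\sqrt{\tfrac{e-v}{(e-s)(v-s)}}\sum_{t=s+1}^v y_t-\sqrt{\tfrac{v-s}{(e-s)(e-v)}}\sum_{t=v+1}^e y_t$; for input matrix $Y$, $C^v_{(s,e]}(i)=T^v_{(s,e]}(Y_{i,\cdot})$. $a^2(t)=4\log(\tfrac{ep\log n}{t^2})\mathbb{1}\{t\le(p\log n)^{1/2}\}$, $\nu_a=\mathbb{E}(Z^2\mid|Z|\ge a)$ for $Z\sim N(0,1)$. $r(t)=(p\log n)^{1/2}$ if $t\ge(p\log n)^{1/2}$, else $r(t)=\max\{t\log(\tfrac{ep\log n}{t^2}),\log n\}$. $\mathcal{T}=\{2^m:m\ge0,2^m\le\lfloor(p\log n)^{1/2}\rfloor\}\cup\{p\}$.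 For a penalty $g$, $S^v_{g,(s,e]}(t)=\sum_{i=1}^p\{C^v_{(s,e]}(i)^2-\nu_{a(t)}\}\mathbb{1}\{|C^v_{(s,e]}(i)|\ge a(t)\}-g(t)$ and $S^v_{g,(s,e]}=\max_{t\in\mathcal{T}}S^v_{g,(s,e]}(t)$. Seeded intervals $\mathcal{M}(\alpha,K)$: let $l_1=1$, $l_{j+1}=\max\{l_j+1,\lfloor\alpha l_j\rfloor\}$, $H=\max\{j:l_j\le n/2\}$, $s_l=\max\{1,\lfloor l/K\rfloor\}$, $\mathcal{I}_l=\{(n-2l,n]\}\cup\{(is_l,is_l+2l]: i=0,1,\dots,\lfloor (n-2l)/s_l\rfloor\}$, and $\mathcal{M}=\bigcup_{j=1}^H\mathcal{I}_{l_j}$ (half-open integer intervals). ESAC: a recursive procedure $\mathrm{ESAC}((s,e])$ that adds points to a set $\mathcal{B}$ (initially empty), started at $(s,e]=(0,n]$. If $e-s\le1$, stop. Let $\mathcal{O}$ be the set of intervals $(s_m,e_m]\in\mathcal{M}$ with $(s_m,e_m]\subseteq(s,e]$ and $\max_{s_m<v<e_m}S^v_{\gamma,(s_m,e_m]}>0$. If $\mathcal{O}=\emptyset$, stop. Otherwise let $l^*$ be the minimal length $e_m-s_m$ over $\mathcal{O}$, let $\mathcal{O}_{l^*}$ be the intervals of $\mathcal{O}$ of length $l^*$, let $(s_{m^*},e_{m^*}]$ be a maximiser over $\mathcal{O}_{l^*}$ of $\max_{s_m<v<e_m}S^v_{\lambda,(s_m,e_m]}$, and $v^*$ a maximiser over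 $s_{m^*}<v<e_{m^*}$ of $S^v_{\lambda,(s_{m^*},e_{m^*}]}$. Add $v^*$ to $\mathcal{B}$, then run $\mathrm{ESAC}((s,s_{m^*}+1])$ and $\mathrm{ESAC}((e_{m^*}-1,e])$. The output is $\mathcal{B}$, with $\widehat J=|\mathcal{B}|$. *)

theory Defs
  imports "HOL-Probability.Probability"
begin

text \<open>Rows are indexed by i < p (i.e. 0..p-1), columns (time points) by t in {1..n}.
  A mean matrix is mu :: nat => nat => real with mu i t the (i,t) entry.\<close>

definition cps :: "nat \<Rightarrow> nat \<Rightarrow> (nat \<Rightarrow> nat \<Rightarrow> real) \<Rightarrow> nat set" where
  "cps n p mu = {v. 1 \<le> v \<and> v < n \<and> (\<exists>i<p. mu i v \<noteq> mu i (Suc v))}"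

definition cpJ :: "nat \<Rightarrow> nat \<Rightarrow> (nat \<Rightarrow> nat \<Rightarrow> real) \<Rightarrow> nat" where
  "cpJ n p mu = card (cps n p mu)"

definition cpeta :: "nat \<Rightarrow> nat \<Rightarrow> (nat \<Rightarrow> nat \<Rightarrow> real) \<Rightarrow> nat \<Rightarrow> nat" where
  "cpeta n p mu j =
     (if j = 0 then 0
      else if j \<le> cpJ n p mu then sorted_list_of_set (cps n p mu) ! (j - 1)
      else n)"

definition theta :: "nat \<Rightarrow> nat \<Rightarrow> (nat \<Rightarrow> nat \<Rightarrow> real) \<Rightarrow> nat \<Rightarrow> nat \<Rightarrow> real" where
  "theta n p mu j i = mu i (cpeta n p mu j + 1) - mu i (cpeta n p mu j)"

definition phi :: "nat \<Rightarrow> nat \<Rightarrow> (nat \<Rightarrow> nat \<Rightarrow> real) \<Rightarrow> nat \<Rightarrow> real" where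
  "phi n p mu j = sqrt (\<Sum>i<p. (theta n p mu j i)\<^sup>2)"

definition kspar :: "nat \<Rightarrow> nat \<Rightarrow> (nat \<Rightarrow> nat \<Rightarrow> real) \<Rightarrow> nat \<Rightarrow> nat" where
  "kspar n p mu j = card {i. i < p \<and> theta n p mu j i \<noteq> 0}"

definition Delta :: "nat \<Rightarrow> nat \<Rightarrow> (nat \<Rightarrow> nat \<Rightarrow> real) \<Rightarrow> nat \<Rightarrow> nat" where
  "Delta n p mu j = min (cpeta n p mu j - cpeta n p mu (j - 1)) (cpeta n p mu (j + 1) - cpeta n p mu j)"

definition gauss_noise :: "nat \<Rightarrow> nat \<Rightarrow> real \<Rightarrow> (nat \<times> nat \<Rightarrow> real) measure" where
  "gauss_noise p n \<sigma> = PiM ({..<p} \<times> {1..n}) (\<lambda>_. density lborel (normal_density 0 \<sigma>))"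

definition cusum :: "(nat \<Rightarrow> real) \<Rightarrow> nat \<Rightarrow> nat \<Rightarrow> nat \<Rightarrow> real" where
  "cusum y s e v =
     sqrt ((real e - real v) / ((real e - real s) * (real v - real s))) * (\<Sum>t\<in>{s<..v}. y t)
   - sqrt ((real v - real s) / ((real e - real s) * (real e - real v))) * (\<Sum>t\<in>{v<..e}. y t)"

definition asq :: "nat \<Rightarrow> nat \<Rightarrow> nat \<Rightarrow> real" where
  "asq n p t = (if real t \<le> sqrt (real p * ln (real n))
                then 4 * ln (exp 1 * real p * ln (real n) / (real t)\<^sup>2) else 0)"

definition athr :: "nat \<Rightarrow> nat \<Rightarrow> nat \<Rightarrow> real" where
  "athr n p t = sqrt (asq n p t)"

text \<open>nu_a = E(Z^2 | |Z| >= a), Z standard normal.\<close>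
definition nu :: "real \<Rightarrow> real" where
  "nu a = (LINT z:{z. a \<le> \<bar>z\<bar>}|lborel. z\<^sup>2 * std_normal_density z)
          / (LINT z:{z. a \<le> \<bar>z\<bar>}|lborel. std_normal_density z)"

definition rfun :: "nat \<Rightarrow> nat \<Rightarrow> real \<Rightarrow> real" where
  "rfun n p t = (if t \<ge> sqrt (real p * ln (real n)) then sqrt (real p * ln (real n))
                 else max (t * ln (exp 1 * real p * ln (real n) / t\<^sup>2)) (ln (real n)))"

definition Tset :: "nat \<Rightarrow> nat \<Rightarrow> nat set" where
  "Tset n p = {2 ^ m | m. 2 ^ m \<le> nat \<lfloor>sqrt (real p * ln (real n))\<rfloor>} \<union> {p}"

definition Sstat :: "nat \<Rightarrow> nat \<Rightarrow> (nat \<Rightarrow> nat \<Rightarrow> real) \<Rightarrow> (nat \<Rightarrow> real)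
                      \<Rightarrow> nat \<Rightarrow> nat \<Rightarrow> nat \<Rightarrow> nat \<Rightarrow> real" where
  "Sstat n p Y g s e v t =
     (\<Sum>i<p. ((cusum (Y i) s e v)\<^sup>2 - nu (athr n p t))
              * (if \<bar>cusum (Y i) s e v\<bar> \<ge> athr n p t then 1 else 0)) - g t"

definition Smax :: "nat \<Rightarrow> nat \<Rightarrow> (nat \<Rightarrow> nat \<Rightarrow> real) \<Rightarrow> (nat \<Rightarrow> real)
                      \<Rightarrow> nat \<Rightarrow> nat \<Rightarrow> nat \<Rightarrow> real" where
  "Smax n p Y g s e v = Max ((Sstat n p Y g s e v) ` Tset n p)"

definition SmaxV :: "nat \<Rightarrow> nat \<Rightarrow> (nat \<Rightarrow> nat \<Rightarrow> real) \<Rightarrow> (nat \<Rightarrow> real)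
                      \<Rightarrow> nat \<Rightarrow> nat \<Rightarrow> real" where
  "SmaxV n p Y g s e = Max ((Smax n p Y g s e) ` {s<..<e})"

section \<open>Seeded intervals M(alpha, K); an interval (s,e] is the pair (s,e)\<close>

text \<open>l_1 = 1, l_{j+1} = max(l_j + 1, floor(alpha l_j)); only indices j >= 1 are used.\<close>
primrec lseq :: "real \<Rightarrow> nat \<Rightarrow> nat" where
  "lseq \<alpha> 0 = 1"
| "lseq \<alpha> (Suc j) = (if j = 0 then 1 else max (lseq \<alpha> j + 1) (nat \<lfloor>\<alpha> * real (lseq \<alpha> j)\<rfloor>))"

definition Hidx :: "real \<Rightarrow> nat \<Rightarrow> nat" where
  "Hidx \<alpha> n = Max {j. 1 \<le> j \<and> real (lseq \<alpha> j) \<le> real n / 2}"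

definition sstep :: "real \<Rightarrow> nat \<Rightarrow> nat" where
  "sstep K l = max 1 (nat \<lfloor>real l / K\<rfloor>)"

definition Iset :: "nat \<Rightarrow> real \<Rightarrow> nat \<Rightarrow> (nat \<times> nat) set" where
  "Iset n K l = {(n - 2 * l, n)}
      \<union> {(i * sstep K l, i * sstep K l + 2 * l) | i. i \<le> (n - 2 * l) div sstep K l}"

definition Mset :: "real \<Rightarrow> real \<Rightarrow> nat \<Rightarrow> (nat \<times> nat) set" where
  "Mset \<alpha> K n = (\<Union>j\<in>{1..Hidx \<alpha> n}. Iset n K (lseq \<alpha> j))"

definition Ocal :: "nat \<Rightarrow> nat \<Rightarrow> (nat \<Rightarrow> nat \<Rightarrow> real) \<Rightarrow> (nat \<Rightarrow> real) \<Rightarrow> (nat \<times> nat) set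
                     \<Rightarrow> nat \<Rightarrow> nat \<Rightarrow> (nat \<times> nat) set" where
  "Ocal n p Y gam Ms s e =
     {(sm, em) \<in> Ms. s \<le> sm \<and> em \<le> e \<and> {sm<..<em} \<noteq> {} \<and> SmaxV n p Y gam sm em > 0}"

text \<open>esac n p Y gam lam Ms s e B: B is a possible output of the call ESAC((s,e]) (the choice
  among several maximisers is left open, so this is a relation).\<close>
inductive esac :: "nat \<Rightarrow> nat \<Rightarrow> (nat \<Rightarrow> nat \<Rightarrow> real) \<Rightarrow> (nat \<Rightarrow> real) \<Rightarrow> (nat \<Rightarrow> real)
                   \<Rightarrow> (nat \<times> nat) set \<Rightarrow> nat \<Rightarrow> nat \<Rightarrow> nat set \<Rightarrow> bool"
  for n p Y gam lam Ms where
  stop_short: "e - s \<le> 1 \<Longrightarrow> esac n p Y gam lam Ms s e {}"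
| stop_empty: "e - s > 1 \<Longrightarrow> Ocal n p Y gam Ms s e = {} \<Longrightarrow> esac n p Y gam lam Ms s e {}"
| split: "\<lbrakk> e - s > 1;
            (sm, em) \<in> Ocal n p Y gam Ms s e;
            em - sm = Min ((\<lambda>(a, b). b - a) ` Ocal n p Y gam Ms s e);
            \<forall>(a, b) \<in> Ocal n p Y gam Ms s e. b - a = em - sm \<longrightarrow>
                SmaxV n p Y lam a b \<le> SmaxV n p Y lam sm em;
            sm < v; v < em;
            \<forall>v'. sm < v' \<and> v' < em \<longrightarrow> Smax n p Y lam sm em v' \<le> Smax n p Y lam sm em v;
            esac n p Y gam lam Ms s (sm + 1) B1;
            esac n p Y gam lam Ms (em - 1) e B2 \<rbrakk>
          \<Longrightarrow> esac n p Y gam lam Ms s e (insert v (B1 \<union> B2))"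

definition esac_success :: "nat \<Rightarrow> nat \<Rightarrow> real \<Rightarrow> (nat \<Rightarrow> nat \<Rightarrow> real) \<Rightarrow> real \<Rightarrow> (nat \<Rightarrow> real)
                            \<Rightarrow> real \<Rightarrow> real \<Rightarrow> real \<Rightarrow> (nat \<times> nat \<Rightarrow> real) \<Rightarrow> bool" where
  "esac_success n p \<sigma> mu \<gamma>0 lam \<alpha> K C1 W =
     (let Y = (\<lambda>i t. (mu i t + W (i, t)) / \<sigma>);
          out = esac n p Y (\<lambda>t. \<gamma>0 * rfun n p (real t)) lam (Mset \<alpha> K n) 0 n
      in (\<exists>B. out B) \<and>
         (\<forall>B. out B \<longrightarrow>
              card B = cpJ n p mu \<and>
              (\<forall>j\<in>{1..cpJ n p mu}.
                  \<bar>real (sorted_list_of_set B ! (j - 1)) - real (cpeta n p mu j)\<bar>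
                  \<le> C1 * \<sigma>\<^sup>2 / (phi n p mu j)\<^sup>2 * rfun n p (real (kspar n p mu j)))))"

end

theory Submission
  imports Defs "HOL-Computational_Algebra.Polynomial"
begin

text \<open>Write \<open>P = p ln n\<close>. The thresholded sums are sums over the rows of the functions
  \<open>(z\<^sup>2 - \<nu>\<^sub>a) 1{\<bar>z\<bar> \<ge> a}\<close> of independent unit-variance Gaussians. As
  \<open>a\<^sup>2 \<le> \<nu>\<^sub>a \<le> a\<^sup>2 + 2\<close>, such a function of a centred Gaussian has logarithmic moment generating
  function at most \<open>384 l\<^sup>2 exp (-a\<^sup>2/2)\<close> at \<open>l\<close>, and Chernoff's bound with
  \<open>l = min 1 (P ln n / t\<^sup>3) / 8\<close> shows that, with probability at least \<open>1 - 1/(4n)\<close>, no interval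
  without a change point exceeds the penalty. The same parameter applied to the lower tail, where
  \<open>E exp (-l (m+Z)\<^sup>2)\<close> is explicit, shows that every change point is detected on a seeded
  interval of half-length \<open>l\<^sub>j\<close>, equal to 1 or below \<open>16000 \<sigma>\<^sup>2 r(k\<^sub>j) / \<phi>\<^sub>j\<^sup>2\<close>. On this event the
  narrowest detected interval isolates one change point and is no longer than \<open>2 l\<^sub>j\<close> for every
  change point still to be found, which gives both the number and the accuracy.\<close>

text \<open>The dimension p is not bounded in terms of n, so the grid, with about log P points,
  cannot be paid for by a flat union bound: besides a factor n^(-8) for the n^3 positions, the
  failure probability at scale t must be summable over powers of two. One part of it decays
  exponentially in t because r(t) >= t; the other is at most of order t^2 / P, a geometric series
  dominated by its last term. As \<open>lam\<close> is arbitrary, nothing can be inferred from the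
  place of a maximum, and accuracy can only come from the length of the narrowest detected interval.
  Change points may be adjacent and their positions may have to be exact, which is why the
  bookkeeping uses 4 l <= \<Delta> + 3 and the error 2 l - 2: both fit l = 1. The penalty constant
  is 176 = 48 + 128, for variance and deviation. Signal energy 2000 r(k) overcomes it, and
  half-length l carries energy at least l \<phi>^2 / (4 \<sigma>^2); hence 8000 = 4 * 2000 for the
  target half-length, 32000 = 4 * 8000 for the error and 64000 = 8 * 8000 for the signal condition.
  That p ln n is never an integer excludes a tie between a power of two and sqrt P.\<close>

section \<open>Powers of e are not integers\<close>

lemma coeff_power_Ints:
  fixes q :: "real poly"
  assumes "\<And>i. coeff q i \<in> \<int>"
  shows "coeff (q ^ N) i \<in> \<int>"
proof (induction N arbitrary: i)
  case (Suc N)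
  then show ?case using assms by (auto simp: coeff_mult intro!: Ints_sum Ints_mult)
qed auto

text \<open>Hermite's argument: for \<open>q = X^N (1 - X)^N\<close> and the alternating sum \<open>F\<close> of the
  \<open>k^(2N-j) q^(j)\<close> over the derivatives of \<open>q\<close> one has \<open>(e^(kx) F)' = k^(2N+1) e^(kx) q\<close>,
  while \<open>N!\<close> divides \<open>F(0)\<close> and \<open>F(1)\<close>.\<close>

lemma exp_nat_not_nat:
  assumes "1 \<le> (k::nat)"
  shows "exp (real k) \<noteq> real a"
proof
  assume a: "exp (real k) = real a"
  \<comment> \<open>This sequence dominates the number \<open>I\<close> defined later, so the degree
    N is fixed at a place where it has dropped under 1.\<close>
  have "(\<lambda>N. real k * exp (real k) * (inverse (fact N) * (real k ^ 2) ^ N)) \<longlonglongrightarrow> real k * exp (real k) * 0"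
    by (intro tendsto_mult tendsto_const summable_LIMSEQ_zero summable_exp)
  then have "\<forall>\<^sub>F N in sequentially. real k * exp (real k) * (inverse (fact N) * (real k ^ 2) ^ N) < 1"
    by (rule order_tendstoD) simp
  then obtain N where N: "real k * exp (real k) * (inverse (fact N) * (real k ^ 2) ^ N) < 1"
    using eventually_happens'[OF sequentially_bot] by blast
  define q :: "real poly" where "q = [:0, 1:] ^ N * [:1, -1:] ^ N"
  define D where "D j = (pderiv ^^ j) q" for j
  define c where "c j = (- 1) ^ j * real k ^ (2 * N - j)" for j
  define F where "F = (\<Sum>j\<le>2 * N. smult (c j) (D j))"
  have deg: "degree q \<le> 2 * N"
    unfolding q_def by (rule order_trans[OF degree_mult_le]) (simp add: degree_power_eq)
  have D_top: "D (Suc (2 * N)) = 0"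
    using deg unfolding D_def by (intro poly_eqI) (subst coeff_higher_pderiv, simp add: coeff_eq_0)
  have key: "smult (real k) F + pderiv F = smult (real k ^ (2 * N + 1)) q"
  proof -
    \<comment> \<open>The alternating signs in \<open>c\<close> make \<open>k * c j\<close> the
      coefficient of \<open>u j\<close> and \<open>c j\<close> minus the coefficient of
      \<open>u (Suc j)\<close>, so the sum telescopes; its last term is killed by
      \<open>D_top\<close>.\<close>
    define u where "u j = smult ((- 1) ^ j * real k ^ (2 * N + 1 - j)) (D j)" for j
    have "smult (real k) F + pderiv F = (\<Sum>j\<le>2 * N. smult (real k * c j) (D j) + smult (c j) (D (Suc j)))"
    proof -
      have "smult (real k) F = (\<Sum>j\<le>2 * N. smult (real k) (smult (c j) (D j)))"
        by (intro poly_eqI) (simp add: F_def coeff_sum sum_distrib_left mult.assoc)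
      then show ?thesis by (simp add: F_def higher_pderiv_sum[of 1, simplified] pderiv_smult sum.distrib D_def)
    qed
    also have "\<dots> = (\<Sum>j\<le>2 * N. u j - u (Suc j))"
      by (intro sum.cong) (auto simp: u_def c_def Suc_diff_le mult.left_commute)
    also have "\<dots> = u 0 - u (Suc (2 * N))"
      by (rule sum_telescope)
    also have "\<dots> = smult (real k ^ (2 * N + 1)) q" using D_top by (simp add: u_def D_def)
    finally show ?thesis .
  qed
  have coeff_q: "coeff q j \<in> \<int>" "j < N \<Longrightarrow> coeff q j = 0" for j
  proof -
    have eq: "q = monom 1 N * [:1, -1:] ^ N" by (simp add: q_def monom_altdef)
    have "coeff ([:1, - 1:] ^ N :: real poly) i \<in> \<int>" for i
      by (rule coeff_power_Ints) (auto simp: coeff_pCons split: nat.splits)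
    then show "coeff q j \<in> \<int>" "j < N \<Longrightarrow> coeff q j = 0"
      by (auto simp: eq coeff_monom_mult)
  qed
  have D0: "poly (D j) 0 / fact N \<in> \<int>" for j
  proof (cases "j < N")
    case False
    have "poly (D j) 0 = fact j * coeff q j"
      by (simp add: poly_0_coeff_0 D_def coeff_higher_pderiv pochhammer_fact)
    moreover have "fact j / fact N \<in> (\<int> :: real set)"
    proof -
      obtain z where "(fact j :: nat) = fact N * z" using False fact_dvd[of N j] by (auto elim: dvdE)
      then have "(fact j :: real) = fact N * real z" by (metis of_nat_fact of_nat_mult)
      then show ?thesis by simp
    qed
    ultimately show ?thesis using coeff_q(1)[of j] by (metis Ints_mult times_divide_eq_left)
  qed (simp add: poly_0_coeff_0 D_def coeff_higher_pderiv coeff_q(2))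
  have D1: "poly (D j) 1 / fact N \<in> \<int>" for j
  proof -
    \<comment> \<open>The symmetry q(1 - x) = q(x), differentiated j times, transfers the
      divisibility by N! from 0 to 1.\<close>
    have "D j = smult ((- 1) ^ j) (pcompose (D j) [:1, -1:])"
    proof (induction j)
      case 0
      have "pcompose q [:1, -1:] = q"
        unfolding poly_eq_poly_eq_iff[symmetric]
        by (auto simp: q_def poly_pcompose poly_power mult.commute)
      then show ?case by (simp add: D_def)
    next
      case (Suc j)
      have "D (Suc j) = pderiv (D j)" by (simp add: D_def)
      also have "\<dots> = pderiv (smult ((- 1) ^ j) (pcompose (D j) [:1, -1:]))" using Suc by simp
      also have "\<dots> = smult ((- 1) ^ Suc j) (pcompose (D (Suc j)) [:1, -1:])"
        by (simp add: pderiv_smult pderiv_pcompose D_def pderiv_pCons)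
      finally show ?case .
    qed
    then have "poly (D j) 1 = poly (smult ((- 1) ^ j) (pcompose (D j) [:1, -1:])) 1"
      by (rule arg_cong)
    then have "poly (D j) 1 = (- 1) ^ j * poly (D j) 0" by (simp add: poly_pcompose)
    then show ?thesis using D0[of j] by (simp add: minus_one_power_iff)
  qed
  have F_int: "poly F x / fact N \<in> \<int>" if "\<And>j. poly (D j) x / fact N \<in> \<int>" for x
  proof -
    have "poly F x / fact N = (\<Sum>j\<le>2 * N. c j * (poly (D j) x / fact N))"
      by (simp add: F_def poly_sum sum_divide_distrib)
    also have "\<dots> \<in> \<int>" using that by (intro Ints_sum Ints_mult) (auto simp: c_def)
    finally show ?thesis .
  qed
  define G where "G x = exp (real k * x) * poly F x" for x
  have G': "(G has_real_derivative exp (real k * x) * (real k ^ (2 * N + 1) * poly q x)) (at x)" for x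
  proof -
    have "(G has_real_derivative exp (real k * x) * (real k * poly F x + poly (pderiv F) x)) (at x)"
      unfolding G_def by (auto intro!: derivative_eq_intros poly_DERIV simp: algebra_simps)
    also have "real k * poly F x + poly (pderiv F) x = poly (smult (real k) F + pderiv F) x" by simp
    finally show ?thesis unfolding key by simp
  qed
  obtain x where x: "0 < x" "x < 1" "G 1 - G 0 = (1 - 0) * (exp (real k * x) * (real k ^ (2 * N + 1) * poly q x))"
    using MVT2[of 0 1 G, OF _ G'] by auto
  have q: "0 < poly q x" "poly q x \<le> 1"
  proof -
    have "poly q x = (x * (1 - x)) ^ N" by (simp add: q_def power_mult_distrib)
    moreover have "0 < x * (1 - x)" "x * (1 - x) \<le> 1" using x by (auto intro: mult_le_one)
    ultimately show "0 < poly q x" "poly q x \<le> 1" by (auto intro: power_le_one)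
  qed
  define I where "I = (G 1 - G 0) / fact N"
  have "I = real a * (poly F 1 / fact N) - poly F 0 / fact N"
    by (simp add: I_def G_def a diff_divide_distrib)
  also have "\<dots> \<in> \<int>" by (intro Ints_diff Ints_mult Ints_of_nat F_int D0 D1)
  finally have "I \<in> \<int>" .
  moreover have "0 < I" unfolding I_def x(3) using q assms by simp
  moreover have "I < 1"
  proof -
    have "exp (real k * x) * (real k ^ (2 * N + 1) * poly q x) \<le> exp (real k) * (real k ^ (2 * N + 1) * 1)"
      using x q mult_left_le[of x "real k"] by (intro mult_mono) auto
    then have "I \<le> exp (real k) * (real k ^ (2 * N + 1) * 1) / fact N"
      unfolding I_def x(3) by (intro divide_right_mono) auto
    also have "\<dots> = real k * exp (real k) * (inverse (fact N) * (real k ^ 2) ^ N)"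
      unfolding power_add power_mult by (simp add: divide_inverse mult_ac)
    finally show ?thesis using N by simp
  qed
  ultimately show False by (auto elim!: Ints_cases)
qed

text \<open>Exponentiating p ln n = k would make e^k the integer n^p. The intended k is the square
  of a grid point.\<close>

lemma mult_ln_not_nat:
  assumes "2 \<le> n" "1 \<le> p"
  shows "real p * ln (real n) \<noteq> real k"
proof
  assume eq: "real p * ln (real n) = real k"
  have "0 < real p * ln (real n)" using assms by simp
  then have "1 \<le> k" using eq by (cases k) auto
  moreover have "exp (real k) = real (n ^ p)"
    using assms by (simp add: eq[symmetric] exp_of_nat_mult)
  ultimately show False using exp_nat_not_nat by blast
qed

section \<open>Truncated Gaussian moments\<close>

definition thresh :: "real \<Rightarrow> real \<Rightarrow> real" where
  "thresh a z = (z\<^sup>2 - nu a) * (if a \<le> \<bar>z\<bar> then 1 else 0)"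

lemma measurable_thresh [measurable]: "thresh a \<in> borel_measurable borel"
  unfolding thresh_def by measurable

lemma integrable_sq_std_normal: "integrable lborel (\<lambda>z. z\<^sup>2 * std_normal_density z)"
  using integrable_std_normal_moment[of 2] by (simp add: mult.commute)

lemma integrable_indicator_std_normal:
  "integrable lborel (\<lambda>z. indicator {z. a \<le> \<bar>z\<bar>} z * std_normal_density z)"
  "integrable lborel (\<lambda>z. indicator {z. a \<le> \<bar>z\<bar>} z * (z\<^sup>2 * std_normal_density z))"
  using integrable_mult_indicator[of "{z. a \<le> \<bar>z\<bar>}" lborel, OF _ integrable_normal_density[of 1 0]]
    integrable_mult_indicator[of "{z. a \<le> \<bar>z\<bar>}" lborel, OF _ integrable_sq_std_normal]
  by simp_all

definition tail0 :: "real \<Rightarrow> real" where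
  "tail0 a = (LINT z|lborel. indicator {z. a \<le> \<bar>z\<bar>} z * std_normal_density z)"

definition tail2 :: "real \<Rightarrow> real" where
  "tail2 a = (LINT z|lborel. indicator {z. a \<le> \<bar>z\<bar>} z * (z\<^sup>2 * std_normal_density z))"

lemma nu_eq: "nu a = tail2 a / tail0 a"
  by (simp add: nu_def tail0_def tail2_def set_lebesgue_integral_def)

lemma tail0_pos:
  assumes "0 \<le> a"
  shows "0 < tail0 a"
proof -
  let ?c = "std_normal_density (a + 1)"
  have "0 < ?c" by (simp add: normal_density_pos)
  also have "?c = (LINT z|lborel. indicator {a..a+1} z * ?c)"
    by simp
  also have "\<dots> \<le> tail0 a"
    unfolding tail0_def
  proof (rule integral_mono)
    show "integrable lborel (\<lambda>z. indicator {a..a+1} z * ?c)"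
      by (intro integrable_mult_left integrable_real_indicator) auto
  next
    fix z :: real
    show "indicator {a..a+1} z * ?c \<le> indicator {z. a \<le> \<bar>z\<bar>} z * std_normal_density z"
    proof (cases "z \<in> {a..a+1}")
      case True
      then have "z\<^sup>2 \<le> (a + 1)\<^sup>2" using assms by (intro power_mono) auto
      then have "?c \<le> std_normal_density z"
        by (simp add: std_normal_density_def divide_right_mono)
      then show ?thesis using True assms by simp
    qed simp
  qed (rule integrable_indicator_std_normal)
  finally show ?thesis .
qed

lemma nu_ge:
  assumes "0 \<le> a"
  shows "a\<^sup>2 \<le> nu a"
proof -
  have "a\<^sup>2 * tail0 a = (LINT z|lborel. a\<^sup>2 * (indicator {z. a \<le> \<bar>z\<bar>} z * std_normal_density z))"
    by (simp add: tail0_def)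
  also have "\<dots> \<le> tail2 a" unfolding tail2_def
  proof (rule integral_mono)
    fix z
    show "a\<^sup>2 * (indicator {z. a \<le> \<bar>z\<bar>} z * std_normal_density z)
      \<le> indicator {z. a \<le> \<bar>z\<bar>} z * (z\<^sup>2 * std_normal_density z)"
    proof (cases "a \<le> \<bar>z\<bar>")
      case True
      then have "a\<^sup>2 \<le> z\<^sup>2" using assms by (metis abs_le_square_iff abs_of_nonneg)
      then show ?thesis using True by (simp add: mult_right_mono)
    qed simp
  qed (intro integrable_mult_right integrable_indicator_std_normal)+
  finally show ?thesis using tail0_pos[OF assms] by (simp add: nu_eq field_simps)
qed

lemma nu_0: "nu 0 = 1"
proof -
  have "tail0 0 = 1" "tail2 0 = 1"
    using integral_std_normal_moment_even[of 1]
    by (simp_all add: tail0_def tail2_def mult.commute)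
  then show ?thesis by (simp add: nu_eq)
qed

text \<open>On \<open>\<bar>z\<bar> \<ge> a\<close> the integrand \<open>(z\<^sup>2 - a\<^sup>2 - 2) \<phi>(z)\<close> is at most the derivative of
  \<open>-(z - a\<^sup>2/z) \<phi>(z)\<close>, which vanishes at \<open>a\<close>, \<open>-a\<close> and infinity.\<close>

lemma nu_le:
  assumes "0 \<le> a"
  shows "nu a \<le> a\<^sup>2 + 2"
proof (cases "a = 0")
  case True then show ?thesis by (simp add: nu_0)
next
  case False
  with assms have a: "0 < a" by simp
  let ?\<phi> = std_normal_density
  define h where "h z = (z\<^sup>2 - a\<^sup>2 - 2) * ?\<phi> z" for z
  define G where "G z = - (z - a\<^sup>2 / z) * ?\<phi> z" for z
  define g where "g z = (z\<^sup>2 - a\<^sup>2 - 1 - a\<^sup>2 / z\<^sup>2) * ?\<phi> z" for z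
  have int_h: "integrable lborel h"
  proof -
    have "integrable lborel (\<lambda>z. z\<^sup>2 * ?\<phi> z - (a\<^sup>2 + 2) * ?\<phi> z)"
      by (intro Bochner_Integration.integrable_diff integrable_sq_std_normal integrable_mult_right) simp
    then show ?thesis by (simp add: h_def[abs_def] algebra_simps)
  qed
  have dphi: "(?\<phi> has_real_derivative - z * ?\<phi> z) (at z)" for z
  proof -
    have "((\<lambda>z. exp (- z\<^sup>2 / 2)) has_real_derivative exp (- z\<^sup>2 / 2) * - z) (at z)"
      by (auto intro!: derivative_eq_intros)
    from DERIV_cmult[OF this, of "1 / sqrt (2 * pi)"]
    show ?thesis unfolding std_normal_density_def by (simp add: mult.commute mult.left_commute)
  qed
  have dG: "(G has_real_derivative g z) (at z)" if "z \<noteq> 0" for z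
    unfolding G_def[abs_def] g_def using that
    by (auto intro!: derivative_eq_intros dphi simp: field_simps power2_eq_square)
  \<comment> \<open>\<open>G\<close> has a pole at 0, so each interval has to lie in one of the two
    tails. There the difference g - h = (1 - a^2 / z^2) \<phi>(z) is nonnegative.\<close>
  have FTC: "(LINT z|lborel. indicator {c..d} z * h z) \<le> G d - G c"
    if "c \<le> d" "a \<le> c \<or> d \<le> - a" for c d
  proof -
    have nz: "z \<noteq> 0 \<and> a\<^sup>2 \<le> z\<^sup>2" if "z \<in> {c..d}" for z
    proof
      have "a \<le> \<bar>z\<bar>" using that \<open>a \<le> c \<or> d \<le> - a\<close> by auto
      then show "a\<^sup>2 \<le> z\<^sup>2" using a by (metis abs_le_square_iff abs_of_pos)
      show "z \<noteq> 0" using \<open>a \<le> \<bar>z\<bar>\<close> a by auto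
    qed
    have hb: "has_bochner_integral lborel (\<lambda>z. indicator {c..d} z *\<^sub>R g z) (G d - G c)"
    proof (rule has_bochner_integral_FTC_Icc[OF \<open>c \<le> d\<close>])
      show "(G has_vector_derivative g z) (at z within {c..d})" if "c \<le> z" "z \<le> d" for z
        using dG[of z] nz[of z] that
        by (auto simp: has_real_derivative_iff_has_vector_derivative[symmetric] intro: has_field_derivative_at_within)
      show "continuous_on {c..d} g"
        unfolding g_def std_normal_density_def using nz by (intro continuous_intros) auto
    qed
    have "(LINT z|lborel. indicator {c..d} z * h z) \<le> (LINT z|lborel. indicator {c..d} z *\<^sub>R g z)"
    proof (rule integral_mono)
      show "integrable lborel (\<lambda>z. indicator {c..d} z * h z)"
        using integrable_mult_indicator[OF _ int_h, of "{c..d}"] by simp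
      show "integrable lborel (\<lambda>z. indicator {c..d} z *\<^sub>R g z)"
        using hb by (simp add: has_bochner_integral_iff)
      fix z
      show "indicator {c..d} z * h z \<le> indicator {c..d} z *\<^sub>R g z"
      proof (cases "z \<in> {c..d}")
        case True
        then have "a\<^sup>2 / z\<^sup>2 \<le> 1" using nz[of z] by (simp add: divide_le_eq_1)
        then show ?thesis using True by (simp add: h_def g_def mult_right_mono)
      qed simp
    qed
    also have "\<dots> = G d - G c" using hb by (rule has_bochner_integral_integral_eq)
    finally show ?thesis .
  qed
  \<comment> \<open>The fundamental theorem is available on compact intervals only, so both tails
    are cut at distance k from their ends; dominated convergence then removes the cut.\<close>
  let ?S = "\<lambda>k::nat. {a..a + real k} \<union> {- a - real k..- a}"
  have le: "(LINT z|lborel. indicator (?S k) z * h z) \<le> 0" for k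
  proof -
    have ind: "indicator (?S k) z = indicator {a..a + real k} z + (indicator {- a - real k..- a} z :: real)" for z
      using a by (auto simp: indicator_def)
    have int: "integrable lborel (\<lambda>z. indicator A z * h z)" if "A \<in> sets lborel" for A
      using integrable_mult_indicator[OF that int_h] by simp
    have "(LINT z|lborel. indicator (?S k) z * h z)
      = (LINT z|lborel. indicator {a..a + real k} z * h z) + (LINT z|lborel. indicator {- a - real k..- a} z * h z)"
      unfolding ind distrib_right by (rule Bochner_Integration.integral_add) (auto intro!: int)
    also have "\<dots> \<le> (G (a + real k) - G a) + (G (- a) - G (- a - real k))"
      by (intro add_mono FTC) auto
    also have "\<dots> = - 2 * ((a + real k) - a\<^sup>2 / (a + real k)) * ?\<phi> (a + real k)"
    proof -
      have "?\<phi> (- a - real k) = ?\<phi> (a + real k)" by (simp add: std_normal_density_def power2_eq_square algebra_simps)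
      moreover have "a\<^sup>2 / (- a - real k) = - (a\<^sup>2 / (a + real k))"
        by (metis minus_add_distrib minus_divide_right uminus_add_conv_diff add.commute diff_conv_add_uminus)
      ultimately show ?thesis using a by (simp add: G_def power2_eq_square algebra_simps)
    qed
    also have "\<dots> \<le> 0"
    proof -
      have "a\<^sup>2 \<le> (a + real k) * (a + real k)" unfolding power2_eq_square using a by (intro mult_mono) auto
      then have "a\<^sup>2 / (a + real k) \<le> a + real k" using a by (simp add: divide_le_eq)
      then have "0 \<le> (a + real k - a\<^sup>2 / (a + real k)) * ?\<phi> (a + real k)"
        by (intro mult_nonneg_nonneg) auto
      then show ?thesis by linarith
    qed
    finally show ?thesis .
  qed
  have "(\<lambda>k. LINT z|lborel. indicator (?S k) z * h z)
     \<longlonglongrightarrow> (LINT z|lborel. indicator {z. a \<le> \<bar>z\<bar>} z * h z)"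
  proof (rule integral_dominated_convergence[where w = "\<lambda>z. \<bar>h z\<bar>"])
    have [measurable]: "h \<in> borel_measurable borel" unfolding h_def[abs_def] by measurable
    show "(\<lambda>z. indicator {z. a \<le> \<bar>z\<bar>} z * h z) \<in> borel_measurable lborel" by measurable
    show "(\<lambda>z. indicator (?S k) z * h z) \<in> borel_measurable lborel" for k by measurable
    show "integrable lborel (\<lambda>z. \<bar>h z\<bar>)" using int_h by simp
    show "AE z in lborel. norm (indicator (?S k) z * h z) \<le> \<bar>h z\<bar>" for k
      by (auto simp: indicator_def)
    show "AE z in lborel. (\<lambda>k. indicator (?S k) z * h z) \<longlonglongrightarrow> indicator {z. a \<le> \<bar>z\<bar>} z * h z"
    proof (rule AE_I2)
      fix z :: real
      have "\<forall>\<^sub>F k in sequentially. indicator (?S k) z * h z = indicator {z. a \<le> \<bar>z\<bar>} z * h z"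
        using eventually_ge_at_top[of "nat \<lceil>\<bar>z\<bar>\<rceil>"]
      proof eventually_elim
        case (elim k)
        then have "\<bar>z\<bar> \<le> real k" by linarith
        then have "z \<in> ?S k \<longleftrightarrow> a \<le> \<bar>z\<bar>" using a by (auto simp: abs_le_iff abs_if split: if_splits)
        then show ?case by (simp add: indicator_def)
      qed
      then show "(\<lambda>k. indicator (?S k) z * h z) \<longlonglongrightarrow> indicator {z. a \<le> \<bar>z\<bar>} z * h z"
        by (rule tendsto_eventually)
    qed
  qed
  then have "(LINT z|lborel. indicator {z. a \<le> \<bar>z\<bar>} z * h z) \<le> 0"
    by (rule LIMSEQ_le_const2) (use le in blast)
  also have "(LINT z|lborel. indicator {z. a \<le> \<bar>z\<bar>} z * h z) = tail2 a - (a\<^sup>2 + 2) * tail0 a"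
  proof -
    have "(\<lambda>z. indicator {z. a \<le> \<bar>z\<bar>} z * h z) =
      (\<lambda>z. indicator {z. a \<le> \<bar>z\<bar>} z * (z\<^sup>2 * ?\<phi> z) - (a\<^sup>2 + 2) * (indicator {z. a \<le> \<bar>z\<bar>} z * ?\<phi> z))"
      by (auto simp: h_def algebra_simps)
    then show ?thesis
      unfolding tail0_def tail2_def
      by (simp add: Bochner_Integration.integral_diff integrable_indicator_std_normal)
  qed
  finally show ?thesis using tail0_pos[OF assms] by (simp add: nu_eq field_simps)
qed

text \<open>\<open>nu\<close> is the conditional second moment, so the centring is exact. This
  removes the linear term from the exponential moment, which therefore exceeds 1 only by a term of
  order l^2.\<close>

lemma integral_thresh:
  assumes "0 \<le> a"
  shows "integrable lborel (\<lambda>z. thresh a z * std_normal_density z)"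
    and "(LINT z|lborel. thresh a z * std_normal_density z) = 0"
proof -
  have eq: "(\<lambda>z. thresh a z * std_normal_density z) =
      (\<lambda>z. indicator {z. a \<le> \<bar>z\<bar>} z * (z\<^sup>2 * std_normal_density z)
         - nu a * (indicator {z. a \<le> \<bar>z\<bar>} z * std_normal_density z))"
    by (auto simp: thresh_def algebra_simps)
  show "integrable lborel (\<lambda>z. thresh a z * std_normal_density z)"
    unfolding eq by (intro Bochner_Integration.integrable_diff integrable_mult_right integrable_indicator_std_normal)
  have "(LINT z|lborel. thresh a z * std_normal_density z) = tail2 a - nu a * tail0 a"
    unfolding eq tail0_def tail2_def
    by (simp add: Bochner_Integration.integral_diff integrable_indicator_std_normal)
  then show "(LINT z|lborel. thresh a z * std_normal_density z) = 0"
    using tail0_pos[OF assms] by (simp add: nu_eq)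
qed

section \<open>Exponential moments\<close>

lemma exp_le_quadratic: "exp y \<le> 1 + y + y\<^sup>2 / 2 * exp \<bar>y\<bar>" for y :: real
proof -
  obtain t where t: "\<bar>t\<bar> \<le> \<bar>y\<bar>" "exp y = (\<Sum>m<2. y ^ m / fact m) + exp t / fact 2 * y ^ 2"
    using Maclaurin_exp_le[of y 2] by blast
  have "exp t \<le> exp \<bar>y\<bar>" using t(1) by simp
  then have "y\<^sup>2 / 2 * exp t \<le> y\<^sup>2 / 2 * exp \<bar>y\<bar>" by (intro mult_left_mono) auto
  then show ?thesis using t(2) by (simp add: numeral_2_eq_2 algebra_simps)
qed

text \<open>The right-hand side is shaped for integration: a density, a mean-zero term and two
  normal densities of total mass 2. The factor exp (-a^2 / 2) is the point of the estimate. It comes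
  from z^2 >= a^2 + (|z| - a)^2 on |z| >= a, which turns exp ((z^2 - a^2) / 4 - z^2 / 2) into exp
  (-a^2 / 2) times an unnormalised Gaussian of variance 2 centred at a or -a. The constant 192 is 64
  * 2 * 3 / 2.\<close>

lemma exp_thresh_le:
  assumes "0 \<le> a" "\<bar>l\<bar> \<le> 1 / 8"
  shows "exp (l * thresh a z) * std_normal_density z \<le> std_normal_density z
    + l * (thresh a z * std_normal_density z)
    + 192 * l\<^sup>2 * exp (- a\<^sup>2 / 2) * (normal_density a (sqrt 2) z + normal_density (- a) (sqrt 2) z)"
proof (cases "a \<le> \<bar>z\<bar>")
  case False
  then show ?thesis by (simp add: thresh_def)
next
  case True
  define f where "f = thresh a z"
  have w: "0 \<le> z\<^sup>2 - a\<^sup>2" using True assms(1) by (metis abs_le_square_iff abs_of_nonneg diff_ge_0_iff_ge)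
  have f: "\<bar>f\<bar> \<le> (z\<^sup>2 - a\<^sup>2) + 2"
    using True nu_ge[OF assms(1)] nu_le[OF assms(1)] w by (auto simp: f_def thresh_def abs_le_iff)
  \<comment> \<open>This is y^2 / 2 <= exp y at y = |f| / 8. One eighth of the exponent is spent on
    the polynomial factor and one eighth on \<open>l\<close>; the total |f| / 4 stays below the
    Gaussian decay.\<close>
  have f8: "f\<^sup>2 / 2 \<le> 64 * exp (\<bar>f\<bar> / 8)"
    using exp_lower_Taylor_quadratic[of "\<bar>f\<bar> / 8"] by (simp add: power_divide)
  have lf: "exp \<bar>l * f\<bar> \<le> exp (\<bar>f\<bar> / 8)"
    using mult_right_mono[OF assms(2), of "\<bar>f\<bar>"] by (simp add: abs_mult)
  have "f\<^sup>2 / 2 * exp \<bar>l * f\<bar> \<le> 64 * exp (\<bar>f\<bar> / 8) * exp (\<bar>f\<bar> / 8)"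
    using f8 lf by (intro mult_mono) auto
  also have "\<dots> = 64 * exp (\<bar>f\<bar> / 4)" by (simp flip: exp_add)
  also have "\<dots> \<le> 64 * (2 * exp ((z\<^sup>2 - a\<^sup>2) / 4))"
  proof -
    have "\<bar>f\<bar> / 4 \<le> 1 / 2 + (z\<^sup>2 - a\<^sup>2) / 4" using divide_right_mono[OF f, of 4] by (simp add: add_divide_distrib)
    then have "exp (\<bar>f\<bar> / 4) \<le> exp (1 / 2 + (z\<^sup>2 - a\<^sup>2) / 4)" by simp
    also have "\<dots> = exp (1 / 2) * exp ((z\<^sup>2 - a\<^sup>2) / 4)" by (simp add: exp_add)
    also have "\<dots> \<le> 2 * exp ((z\<^sup>2 - a\<^sup>2) / 4)" using exp_half_le2 by (intro mult_right_mono) auto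
    finally show ?thesis by simp
  qed
  finally have A: "f\<^sup>2 / 2 * exp \<bar>l * f\<bar> \<le> 128 * exp ((z\<^sup>2 - a\<^sup>2) / 4)" by simp
  have B: "exp ((z\<^sup>2 - a\<^sup>2) / 4) * std_normal_density z
    \<le> sqrt 2 * exp (- a\<^sup>2 / 2) * (normal_density a (sqrt 2) z + normal_density (- a) (sqrt 2) z)"
  proof -
    have nd: "sqrt 2 * normal_density c (sqrt 2) z = 1 / sqrt (2 * pi) * exp (- (z - c)\<^sup>2 / 4)" for c
      by (simp add: normal_density_def real_sqrt_mult field_simps)
    have sq: "a\<^sup>2 + (\<bar>z\<bar> - a)\<^sup>2 \<le> z\<^sup>2"
    proof -
      have "0 \<le> a * (\<bar>z\<bar> - a)" using True assms(1) by simp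
      moreover have "z\<^sup>2 = \<bar>z\<bar>\<^sup>2" by simp
      ultimately show ?thesis by (simp add: power2_eq_square algebra_simps)
    qed
    have "exp (- (\<bar>z\<bar> - a)\<^sup>2 / 4) \<le> exp (- (z - a)\<^sup>2 / 4) + exp (- (z - (- a))\<^sup>2 / 4)"
    proof (cases "0 \<le> z")
      case True then show ?thesis by simp
    next
      case False
      then have "(\<bar>z\<bar> - a)\<^sup>2 = (z - (- a))\<^sup>2" by (simp add: power2_eq_square algebra_simps)
      then show ?thesis by simp
    qed
    moreover have "exp ((z\<^sup>2 - a\<^sup>2) / 4) * exp (- z\<^sup>2 / 2) \<le> exp (- a\<^sup>2 / 2) * exp (- (\<bar>z\<bar> - a)\<^sup>2 / 4)"
      unfolding exp_add[symmetric] exp_le_cancel_iff using sq by (simp add: field_simps)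
    ultimately have "exp ((z\<^sup>2 - a\<^sup>2) / 4) * exp (- z\<^sup>2 / 2)
       \<le> exp (- a\<^sup>2 / 2) * (exp (- (z - a)\<^sup>2 / 4) + exp (- (z - (- a))\<^sup>2 / 4))"
      by (meson exp_ge_zero mult_left_mono order_trans)
    then have "1 / sqrt (2 * pi) * (exp ((z\<^sup>2 - a\<^sup>2) / 4) * exp (- z\<^sup>2 / 2))
       \<le> 1 / sqrt (2 * pi) * (exp (- a\<^sup>2 / 2) * (exp (- (z - a)\<^sup>2 / 4) + exp (- (z - (- a))\<^sup>2 / 4)))"
      by (intro mult_left_mono) auto
    moreover have "sqrt 2 * exp (- a\<^sup>2 / 2) * (normal_density a (sqrt 2) z + normal_density (- a) (sqrt 2) z)
       = exp (- a\<^sup>2 / 2) * (sqrt 2 * normal_density a (sqrt 2) z + sqrt 2 * normal_density (- a) (sqrt 2) z)"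
      by (simp add: algebra_simps)
    ultimately show ?thesis
      unfolding nd std_normal_density_def by (simp only: distrib_left mult_ac)
  qed
  have "exp (l * f) * std_normal_density z
     \<le> (1 + l * f + (l * f)\<^sup>2 / 2 * exp \<bar>l * f\<bar>) * std_normal_density z"
    by (intro mult_right_mono exp_le_quadratic) simp
  also have "(l * f)\<^sup>2 / 2 * exp \<bar>l * f\<bar> = l\<^sup>2 * (f\<^sup>2 / 2 * exp \<bar>l * f\<bar>)" by (simp add: power_mult_distrib)
  also have "(1 + l * f + l\<^sup>2 * (f\<^sup>2 / 2 * exp \<bar>l * f\<bar>)) * std_normal_density z
     \<le> (1 + l * f + l\<^sup>2 * (128 * exp ((z\<^sup>2 - a\<^sup>2) / 4))) * std_normal_density z"
    using A by (intro mult_right_mono add_left_mono mult_left_mono) auto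
  also have "\<dots> = std_normal_density z + l * (f * std_normal_density z)
      + 128 * l\<^sup>2 * (exp ((z\<^sup>2 - a\<^sup>2) / 4) * std_normal_density z)"
    by (simp add: algebra_simps)
  also have "\<dots> \<le> std_normal_density z + l * (f * std_normal_density z)
      + 128 * l\<^sup>2 * (sqrt 2 * exp (- a\<^sup>2 / 2) * (normal_density a (sqrt 2) z + normal_density (- a) (sqrt 2) z))"
    using B by (intro add_left_mono mult_left_mono) auto
  also have "\<dots> \<le> std_normal_density z + l * (f * std_normal_density z)
      + 192 * l\<^sup>2 * (exp (- a\<^sup>2 / 2) * (normal_density a (sqrt 2) z + normal_density (- a) (sqrt 2) z))"
  proof -
    have "sqrt 2 \<le> 3 / 2" by (rule real_le_lsqrt) (auto simp: power2_eq_square)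
    then have "128 * l\<^sup>2 * sqrt 2 \<le> 128 * l\<^sup>2 * (3 / 2)" by (intro mult_left_mono) auto
    then have "128 * l\<^sup>2 * sqrt 2 * (exp (- a\<^sup>2 / 2) * (normal_density a (sqrt 2) z + normal_density (- a) (sqrt 2) z))
      \<le> 128 * l\<^sup>2 * (3 / 2) * (exp (- a\<^sup>2 / 2) * (normal_density a (sqrt 2) z + normal_density (- a) (sqrt 2) z))"
      by (intro mult_right_mono) auto
    then show ?thesis by (simp add: mult.assoc)
  qed
  finally show ?thesis by (simp add: f_def mult.assoc)
qed

text \<open>Both signs of \<open>l\<close> are covered because the bound serves twice: for the upper
  tail of pure noise, and, with \<open>-l\<close>, for the signal-free rows in the lower
  tail.\<close>

lemma nn_integral_exp_thresh:
  assumes "0 \<le> a" "\<bar>l\<bar> \<le> 1 / 8"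
  shows "(\<integral>\<^sup>+z. ennreal (std_normal_density z) * ennreal (exp (l * thresh a z)) \<partial>lborel)
    \<le> ennreal (exp (384 * l\<^sup>2 * exp (- a\<^sup>2 / 2)))"
proof -
  define c where "c = 192 * l\<^sup>2 * exp (- a\<^sup>2 / 2)"
  define F where "F z = std_normal_density z + l * (thresh a z * std_normal_density z)
    + c * (normal_density a (sqrt 2) z + normal_density (- a) (sqrt 2) z)" for z
  have le: "exp (l * thresh a z) * std_normal_density z \<le> F z" for z
    using exp_thresh_le[OF assms, of z] by (simp add: F_def c_def)
  have F0: "0 \<le> F z" for z
    by (rule order_trans[OF _ le]) simp
  have int: "integrable lborel F" unfolding F_def[abs_def]
    by (intro Bochner_Integration.integrable_add integrable_mult_right integral_thresh assms) simp_all
  have "(\<integral>\<^sup>+z. ennreal (std_normal_density z) * ennreal (exp (l * thresh a z)) \<partial>lborel) \<le> (\<integral>\<^sup>+z. ennreal (F z) \<partial>lborel)"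
    using le by (intro nn_integral_mono) (simp add: ennreal_mult'[symmetric] mult.commute ennreal_leI)
  also have "\<dots> = ennreal (LINT z|lborel. F z)"
    using int F0 by (intro nn_integral_eq_integral) auto
  also have "(LINT z|lborel. F z) = 1 + 2 * c"
    unfolding F_def
    by (simp add: Bochner_Integration.integral_add integral_thresh[OF assms(1)])
  also have "ennreal (1 + 2 * c) \<le> ennreal (exp (2 * c))"
    by (intro ennreal_leI exp_ge_add_one_self)
  finally show ?thesis by (simp add: c_def mult.assoc)
qed

section \<open>Lower tails: exponential moments of shifted Gaussians\<close>

lemma nn_integral_exp_neg_shifted_square:
  assumes "0 \<le> l"
  shows "(\<integral>\<^sup>+z. ennreal (std_normal_density z) * ennreal (exp (- l * (m + z)\<^sup>2)) \<partial>lborel)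
    = ennreal (exp (- l * m\<^sup>2 / (1 + 2 * l)) / sqrt (1 + 2 * l))"
proof -
  define c where "c = 1 + 2 * l"
  have c: "0 < c" using assms by (simp add: c_def)
  define K where "K = exp (- l * m\<^sup>2 / c) / sqrt c"
  have eq: "std_normal_density z * exp (- l * (m + z)\<^sup>2)
      = K * normal_density (- 2 * l * m / c) (1 / sqrt c) z" for z
  proof -
    \<comment> \<open>Completing the square: the product is a multiple of the normal density with
      mean -2 l m / c and variance 1 / c, so the integral is just the multiple
      \<open>K\<close>.\<close>
    have e: "- z\<^sup>2 / 2 + - l * (m + z)\<^sup>2 = - l * m\<^sup>2 / c + - (z - (- 2 * l * m / c))\<^sup>2 * c / 2"
    proof -
      have "(- z\<^sup>2 / 2 + - l * (m + z)\<^sup>2) * (2 * c) = (- l * m\<^sup>2 / c + - (z - (- 2 * l * m / c))\<^sup>2 * c / 2) * (2 * c)"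
      proof -
        have "(- l * m\<^sup>2 / c + - (z - (- 2 * l * m / c))\<^sup>2 * c / 2) * (2 * c) = - 2 * l * m\<^sup>2 - (c * z + 2 * l * m)\<^sup>2"
          using c by (simp add: power2_eq_square field_simps)
        also have "\<dots> = (- z\<^sup>2 / 2 + - l * (m + z)\<^sup>2) * (2 * c)"
          unfolding c_def by (simp add: power2_eq_square algebra_simps)
        finally show ?thesis by (rule sym)
      qed
      then show ?thesis using c by (metis mult_eq_0_iff mult_right_cancel order_less_irrefl zero_neq_numeral)
    qed
    have "std_normal_density z * exp (- l * (m + z)\<^sup>2) = 1 / sqrt (2 * pi) * exp (- z\<^sup>2 / 2 + - l * (m + z)\<^sup>2)"
      by (simp add: std_normal_density_def flip: exp_add)
    also have "\<dots> = 1 / sqrt (2 * pi) * (exp (- l * m\<^sup>2 / c) * exp (- (z - (- 2 * l * m / c))\<^sup>2 * c / 2))"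
      unfolding e exp_add ..
    also have "\<dots> = K * normal_density (- 2 * l * m / c) (1 / sqrt c) z"
      using c by (simp add: normal_density_def K_def real_sqrt_mult real_sqrt_divide power_divide)
    finally show ?thesis .
  qed
  have "(\<integral>\<^sup>+z. ennreal (std_normal_density z) * ennreal (exp (- l * (m + z)\<^sup>2)) \<partial>lborel)
    = (\<integral>\<^sup>+z. ennreal (K * normal_density (- 2 * l * m / c) (1 / sqrt c) z) \<partial>lborel)"
    by (simp only: ennreal_mult'[symmetric] normal_density_nonneg exp_ge_zero eq)
  also have "\<dots> = ennreal (LINT z|lborel. K * normal_density (- 2 * l * m / c) (1 / sqrt c) z)"
    using c by (intro nn_integral_eq_integral integrable_mult_right integrable_normal_density) (auto simp: K_def)
  also have "\<dots> = ennreal K" using c by simp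
  finally show ?thesis by (simp add: K_def c_def)
qed

lemma exp_neg_shifted_le:
  fixes l m :: real
  assumes "0 \<le> l" "l \<le> 1 / 8"
  shows "exp (- l * m\<^sup>2 / (1 + 2 * l)) \<le> exp (- l * m\<^sup>2 / 2)"
proof -
  have "l * m\<^sup>2 / 2 \<le> l * m\<^sup>2 / (1 + 2 * l)"
    using assms by (intro divide_left_mono) auto
  then show ?thesis by simp
qed

text \<open>Thresholding costs at most 2 a^2 + 2: x^2 - 2 a^2 - 2 is a lower bound for
  \<open>thresh a x\<close> above the threshold since \<open>nu a\<close> is at most a^2 + 2, and is
  negative below it. A cost of this size per row is affordable only on the few rows that carry
  signal.\<close>

lemma nn_integral_exp_neg_thresh_shifted:
  assumes "0 \<le> a" "0 \<le> l" "l \<le> 1 / 8"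
  shows "(\<integral>\<^sup>+z. ennreal (std_normal_density z) * ennreal (exp (- l * thresh a (m + z))) \<partial>lborel)
    \<le> ennreal (exp (l * (2 * a\<^sup>2 + 2) - l * m\<^sup>2 / 2))"
proof -
  have le: "- l * thresh a x \<le> l * (2 * a\<^sup>2 + 2) + (- l * x\<^sup>2)" for x
  proof -
    have "x\<^sup>2 - 2 * a\<^sup>2 - 2 \<le> thresh a x"
    proof (cases "a \<le> \<bar>x\<bar>")
      case True
      have "nu a \<le> 2 * a\<^sup>2 + 2" using nu_le[OF assms(1)] zero_le_power2[of a] by linarith
      then show ?thesis using True by (simp add: thresh_def)
    next
      case False
      then have "x\<^sup>2 \<le> a\<^sup>2" using assms(1) by (metis abs_le_square_iff abs_of_nonneg less_eq_real_def not_le)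
      then have "x\<^sup>2 - 2 * a\<^sup>2 - 2 \<le> 0" using zero_le_power2[of a] by linarith
      then show ?thesis using False by (simp add: thresh_def)
    qed
    then have "l * (x\<^sup>2 - 2 * a\<^sup>2 - 2) \<le> l * thresh a x" using assms by (intro mult_left_mono) auto
    then show ?thesis by (simp add: algebra_simps)
  qed
  have "(\<integral>\<^sup>+z. ennreal (std_normal_density z) * ennreal (exp (- l * thresh a (m + z))) \<partial>lborel)
    \<le> (\<integral>\<^sup>+z. ennreal (exp (l * (2 * a\<^sup>2 + 2))) * (ennreal (std_normal_density z) * ennreal (exp (- l * (m + z)\<^sup>2))) \<partial>lborel)"
  proof (rule nn_integral_mono)
    fix z
    have "exp (- l * thresh a (m + z)) \<le> exp (l * (2 * a\<^sup>2 + 2)) * exp (- l * (m + z)\<^sup>2)"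
      using le[of "m + z"] by (simp flip: exp_add)
    then have "std_normal_density z * exp (- l * thresh a (m + z))
       \<le> std_normal_density z * (exp (l * (2 * a\<^sup>2 + 2)) * exp (- l * (m + z)\<^sup>2))"
      by (intro mult_left_mono) auto
    then show "ennreal (std_normal_density z) * ennreal (exp (- l * thresh a (m + z)))
      \<le> ennreal (exp (l * (2 * a\<^sup>2 + 2))) * (ennreal (std_normal_density z) * ennreal (exp (- l * (m + z)\<^sup>2)))"
      by (simp add: ennreal_mult'[symmetric] ennreal_leI mult.left_commute)
  qed
  also have "\<dots> = ennreal (exp (l * (2 * a\<^sup>2 + 2))) * ennreal (exp (- l * m\<^sup>2 / (1 + 2 * l)) / sqrt (1 + 2 * l))"
    by (simp add: nn_integral_cmult nn_integral_exp_neg_shifted_square[OF assms(2), simplified])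
  also have "\<dots> \<le> ennreal (exp (l * (2 * a\<^sup>2 + 2))) * ennreal (exp (- l * m\<^sup>2 / 2))"
  proof (intro mult_left_mono ennreal_leI)
    have "exp (- l * m\<^sup>2 / (1 + 2 * l)) / sqrt (1 + 2 * l) \<le> exp (- l * m\<^sup>2 / (1 + 2 * l)) / 1"
      using assms by (intro divide_left_mono) auto
    then show "exp (- l * m\<^sup>2 / (1 + 2 * l)) / sqrt (1 + 2 * l) \<le> exp (- l * m\<^sup>2 / 2)"
      using exp_neg_shifted_le[OF assms(2,3), of m] by (simp only: div_by_1)
  qed simp
  also have "\<dots> = ennreal (exp (l * (2 * a\<^sup>2 + 2) - l * m\<^sup>2 / 2))"
    by (simp add: ennreal_mult'[symmetric] flip: exp_add)
  finally show ?thesis .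
qed

text \<open>Without a threshold all p rows count, and a cost of order l per row would exceed the
  gain. Keeping the factor 1 / sqrt (1 + 2 l), which cancels the centring exp l up to second order,
  reduces the cost to 2 l^2 per row.\<close>

lemma nn_integral_exp_neg_square_shifted:
  assumes "0 \<le> l" "l \<le> 1 / 8"
  shows "(\<integral>\<^sup>+z. ennreal (std_normal_density z) * ennreal (exp (- l * thresh 0 (m + z))) \<partial>lborel)
    \<le> ennreal (exp (2 * l\<^sup>2 - l * m\<^sup>2 / 2))"
proof -
  have eq: "exp (- l * thresh 0 (m + z)) = exp l * exp (- l * (m + z)\<^sup>2)" for z
    by (simp add: thresh_def nu_0 algebra_simps flip: exp_add)
  have "(\<integral>\<^sup>+z. ennreal (std_normal_density z) * ennreal (exp (- l * thresh 0 (m + z))) \<partial>lborel)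
    = (\<integral>\<^sup>+z. ennreal (exp l) * (ennreal (std_normal_density z) * ennreal (exp (- l * (m + z)\<^sup>2))) \<partial>lborel)"
    unfolding eq by (intro nn_integral_cong) (simp add: ennreal_mult'[symmetric] mult.left_commute)
  also have "\<dots> = ennreal (exp l) * ennreal (exp (- l * m\<^sup>2 / (1 + 2 * l)) / sqrt (1 + 2 * l))"
    by (simp add: nn_integral_cmult nn_integral_exp_neg_shifted_square[OF assms(1), simplified])
  also have "\<dots> = ennreal (exp l * (exp (- l * m\<^sup>2 / (1 + 2 * l)) / sqrt (1 + 2 * l)))"
    by (rule ennreal_mult'[symmetric]) simp
  also have "\<dots> \<le> ennreal (exp (2 * l\<^sup>2 - l * m\<^sup>2 / 2))"
  proof (rule ennreal_leI)
    have "2 * l - (2 * l)\<^sup>2 \<le> ln (1 + 2 * l)"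
      using ln_one_plus_pos_lower_bound[of "2 * l"] assms by simp
    then have "l - 2 * l\<^sup>2 \<le> ln (sqrt (1 + 2 * l))"
      using assms by (simp add: ln_sqrt power2_eq_square)
    then have "exp (l - 2 * l\<^sup>2) \<le> sqrt (1 + 2 * l)"
      using assms by (subst (asm) ln_ge_iff) auto
    then have "exp l \<le> exp (2 * l\<^sup>2) * sqrt (1 + 2 * l)"
      by (simp add: exp_diff field_simps)
    then have "exp l / sqrt (1 + 2 * l) \<le> exp (2 * l\<^sup>2)"
      using assms by (simp add: divide_le_eq)
    then have "exp l / sqrt (1 + 2 * l) * exp (- l * m\<^sup>2 / (1 + 2 * l)) \<le> exp (2 * l\<^sup>2) * exp (- l * m\<^sup>2 / 2)"
      using exp_neg_shifted_le[OF assms, of m] by (intro mult_mono) auto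
    also have "\<dots> = exp (2 * l\<^sup>2 + - l * m\<^sup>2 / 2)" by (rule exp_add[symmetric])
    finally show "exp l * (exp (- l * m\<^sup>2 / (1 + 2 * l)) / sqrt (1 + 2 * l)) \<le> exp (2 * l\<^sup>2 - l * m\<^sup>2 / 2)"
      by simp
  qed
  finally show ?thesis .
qed

section \<open>Chernoff bounds for the CUSUM noise\<close>

text \<open>The functions and the bounds depend on the row, since in the lower tail rows with and
  without signal are estimated differently. Working with nonnegative integrals avoids any
  integrability side condition.\<close>

lemma (in prob_space) Chernoff_std_normal:
  assumes I: "finite I"
    and ind: "indep_vars (\<lambda>_. borel) Z I"
    and std: "\<And>i. i \<in> I \<Longrightarrow> distributed M lborel (Z i) std_normal_density"
    and g[measurable]: "\<And>i. g i \<in> borel_measurable borel"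
    and b: "\<And>i. i \<in> I \<Longrightarrow>
      (\<integral>\<^sup>+z. ennreal (std_normal_density z) * ennreal (exp (g i z)) \<partial>lborel) \<le> ennreal (exp (b i))"
  shows "prob {\<omega> \<in> space M. x \<le> (\<Sum>i\<in>I. g i (Z i \<omega>))} \<le> exp ((\<Sum>i\<in>I. b i) - x)"
proof -
  have Z[measurable]: "Z i \<in> borel_measurable M" if "i \<in> I" for i
    using distributed_measurable[OF std[OF that]] by simp
  have meas: "(\<lambda>\<omega>. \<Sum>i\<in>I. g i (Z i \<omega>)) \<in> borel_measurable M"
    by (intro borel_measurable_sum measurable_compose[OF Z g])
  have "emeasure M {\<omega> \<in> space M. x \<le> (\<Sum>i\<in>I. g i (Z i \<omega>))}
      = (\<integral>\<^sup>+\<omega>. indicator {\<omega> \<in> space M. x \<le> (\<Sum>i\<in>I. g i (Z i \<omega>))} \<omega> \<partial>M)"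
    using meas by (intro nn_integral_indicator[symmetric]) measurable
  also have "\<dots> \<le> (\<integral>\<^sup>+\<omega>. ennreal (exp (- x)) * (\<Prod>i\<in>I. ennreal (exp (g i (Z i \<omega>)))) \<partial>M)"
  proof (rule nn_integral_mono)
    fix \<omega>
    have "(\<Prod>i\<in>I. ennreal (exp (g i (Z i \<omega>)))) = ennreal (exp (\<Sum>i\<in>I. g i (Z i \<omega>)))"
      using I by (simp add: prod_ennreal exp_sum)
    then have eq: "ennreal (exp (- x)) * (\<Prod>i\<in>I. ennreal (exp (g i (Z i \<omega>))))
        = ennreal (exp ((\<Sum>i\<in>I. g i (Z i \<omega>)) - x))"
      by (simp add: ennreal_mult'[symmetric] flip: exp_add)
    show "indicator {\<omega> \<in> space M. x \<le> (\<Sum>i\<in>I. g i (Z i \<omega>))} \<omega>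
      \<le> ennreal (exp (- x)) * (\<Prod>i\<in>I. ennreal (exp (g i (Z i \<omega>))))"
      unfolding eq by (auto simp: indicator_def simp flip: ennreal_1 intro!: ennreal_leI)
  qed
  also have "\<dots> = ennreal (exp (- x)) * (\<integral>\<^sup>+\<omega>. (\<Prod>i\<in>I. ennreal (exp (g i (Z i \<omega>)))) \<partial>M)"
    by (intro nn_integral_cmult borel_measurable_prod_ennreal
        measurable_compose[OF measurable_compose[OF Z g]]) auto
  also have "(\<integral>\<^sup>+\<omega>. (\<Prod>i\<in>I. ennreal (exp (g i (Z i \<omega>)))) \<partial>M)
      = (\<Prod>i\<in>I. \<integral>\<^sup>+\<omega>. ennreal (exp (g i (Z i \<omega>))) \<partial>M)"
    by (intro indep_vars_nn_integral I indep_vars_compose2[OF ind]) auto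
  also have "\<dots> \<le> (\<Prod>i\<in>I. ennreal (exp (b i)))"
  proof (intro prod_mono_ennreal)
    fix i assume i: "i \<in> I"
    have "(\<integral>\<^sup>+\<omega>. ennreal (exp (g i (Z i \<omega>))) \<partial>M)
      = (\<integral>\<^sup>+z. ennreal (std_normal_density z) * ennreal (exp (g i z)) \<partial>lborel)"
      by (rule distributed_nn_integral[OF std[OF i], symmetric]) simp
    then show "(\<integral>\<^sup>+\<omega>. ennreal (exp (g i (Z i \<omega>))) \<partial>M) \<le> ennreal (exp (b i))"
      using b[OF i] by simp
  qed
  also have "ennreal (exp (- x)) * (\<Prod>i\<in>I. ennreal (exp (b i))) = ennreal (exp ((\<Sum>i\<in>I. b i) - x))"
    using I by (simp add: prod_ennreal exp_sum[symmetric] ennreal_mult'[symmetric] flip: exp_add)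
  finally have "emeasure M {\<omega> \<in> space M. x \<le> (\<Sum>i\<in>I. g i (Z i \<omega>))} \<le> ennreal (exp ((\<Sum>i\<in>I. b i) - x))"
    by (simp add: mult_left_mono)
  then show ?thesis by (simp add: emeasure_eq_measure)
qed

section \<open>The CUSUM as a linear functional of unit norm, and its Gaussian law\<close>

definition noise_cusum :: "real \<Rightarrow> nat \<Rightarrow> nat \<Rightarrow> nat \<Rightarrow> nat \<Rightarrow> (nat \<times> nat \<Rightarrow> real) \<Rightarrow> real" where
  "noise_cusum \<sigma> s e v i W = cusum (\<lambda>t. W (i, t) / \<sigma>) s e v"

text \<open>The coefficient of \<open>y t\<close> in the CUSUM. The vector of these coefficients is
  a unit vector, which is why the scaled noise has variance one.\<close>

definition cusum_weight :: "nat \<Rightarrow> nat \<Rightarrow> nat \<Rightarrow> nat \<Rightarrow> real" where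
  "cusum_weight s e v t =
     (if t \<le> v then sqrt ((real e - real v) / ((real e - real s) * (real v - real s)))
      else - sqrt ((real v - real s) / ((real e - real s) * (real e - real v))))"

lemma cusum_eq_sum:
  assumes "s < v" "v < e"
  shows "cusum y s e v = (\<Sum>t\<in>{s<..e}. cusum_weight s e v t * y t)"
proof -
  have "{s<..e} = {s<..v} \<union> {v<..e}" using assms by auto
  then have "(\<Sum>t\<in>{s<..e}. cusum_weight s e v t * y t)
      = (\<Sum>t\<in>{s<..v}. cusum_weight s e v t * y t) + (\<Sum>t\<in>{v<..e}. cusum_weight s e v t * y t)"
    by (simp add: sum.union_disjoint Int_def)
  also have "(\<Sum>t\<in>{s<..v}. cusum_weight s e v t * y t)
      = sqrt ((real e - real v) / ((real e - real s) * (real v - real s))) * (\<Sum>t\<in>{s<..v}. y t)"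
    unfolding sum_distrib_left by (rule sum.cong) (auto simp: cusum_weight_def)
  also have "(\<Sum>t\<in>{v<..e}. cusum_weight s e v t * y t)
      = - sqrt ((real v - real s) / ((real e - real s) * (real e - real v))) * (\<Sum>t\<in>{v<..e}. y t)"
    unfolding sum_distrib_left by (rule sum.cong) (auto simp: cusum_weight_def)
  finally show ?thesis by (simp add: cusum_def)
qed

lemma sum_cusum_weight_sq:
  assumes "s < v" "v < e"
  shows "(\<Sum>t\<in>{s<..e}. (cusum_weight s e v t)\<^sup>2) = 1"
proof -
  have "{s<..e} = {s<..v} \<union> {v<..e}" using assms by auto
  then have "(\<Sum>t\<in>{s<..e}. (cusum_weight s e v t)\<^sup>2)
      = (\<Sum>t\<in>{s<..v}. (cusum_weight s e v t)\<^sup>2) + (\<Sum>t\<in>{v<..e}. (cusum_weight s e v t)\<^sup>2)"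
    by (simp add: sum.union_disjoint Int_def)
  also have "(\<Sum>t\<in>{s<..v}. (cusum_weight s e v t)\<^sup>2)
      = (real v - real s) * ((real e - real v) / ((real e - real s) * (real v - real s)))"
    using assms by (simp add: cusum_weight_def of_nat_diff)
  also have "(\<Sum>t\<in>{v<..e}. (cusum_weight s e v t)\<^sup>2)
      = (real e - real v) * ((real v - real s) / ((real e - real s) * (real e - real v)))"
    using assms by (simp add: cusum_weight_def of_nat_diff)
  also have "(real v - real s) * ((real e - real v) / ((real e - real s) * (real v - real s)))
     + (real e - real v) * ((real v - real s) / ((real e - real s) * (real e - real v)))
     = (real e - real v) / (real e - real s) + (real v - real s) / (real e - real s)"
    using assms by simp
  also have "\<dots> = 1" unfolding add_divide_distrib[symmetric] using assms by simp
  finally show ?thesis .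
qed

text \<open>A vanishing weight would turn a summand into a degenerate variable without a density,
  outside the rule for sums of independent normals.\<close>

lemma cusum_weight_nz:
  assumes "s < v" "v < e"
  shows "cusum_weight s e v t \<noteq> 0"
  using assms by (auto simp: cusum_weight_def)

context
  fixes n p :: nat and \<sigma> :: real
  assumes \<sigma>: "0 < \<sigma>"
begin

abbreviation "noise1 \<equiv> density lborel (normal_density 0 \<sigma>)"

lemma prob_space_gauss_noise: "prob_space (gauss_noise p n \<sigma>)"
  unfolding gauss_noise_def by (intro prob_space_PiM prob_space_normal_density \<sigma>)

interpretation N: prob_space "gauss_noise p n \<sigma>"
  by (rule prob_space_gauss_noise)

lemma distr_coordinate:
  assumes "x \<in> {..<p} \<times> {1..n}"
  shows "distr (gauss_noise p n \<sigma>) noise1 (\<lambda>W. W x) = noise1"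
  unfolding gauss_noise_def
  by (rule distr_PiM_component[OF prob_space_normal_density[OF \<sigma>] assms])

lemma coordinate_measurable:
  assumes "x \<in> {..<p} \<times> {1..n}"
  shows "(\<lambda>W. W x) \<in> measurable (gauss_noise p n \<sigma>) noise1"
  unfolding gauss_noise_def using assms by (rule measurable_component_singleton)

lemma coordinate_distributed:
  assumes "x \<in> {..<p} \<times> {1..n}"
  shows "distributed (gauss_noise p n \<sigma>) lborel (\<lambda>W. W x) (normal_density 0 \<sigma>)"
proof -
  have "distr (gauss_noise p n \<sigma>) lborel (\<lambda>W. W x) = distr (gauss_noise p n \<sigma>) noise1 (\<lambda>W. W x)"
    by (rule distr_cong) auto
  then show ?thesis
    unfolding distributed_def using distr_coordinate[OF assms] coordinate_measurable[OF assms]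
    by (auto simp: measurable_density_eq2 cong: measurable_cong_sets)
qed

lemma indep_coordinates:
  "N.indep_vars (\<lambda>_. noise1) (\<lambda>x W. W x) ({..<p} \<times> {1..n})"
proof (cases "{..<p} \<times> {1..n} = {}")
  \<comment> \<open>The characterisation of independence by a product law requires a nonempty index
    set, so p = 0 or n = 0 is treated apart.\<close>
  case True
  then show ?thesis unfolding N.indep_vars_def N.indep_sets_def by auto
next
  case False
  let ?I = "{..<p} \<times> {1..n}"
  have "distr (gauss_noise p n \<sigma>) (PiM ?I (\<lambda>_. noise1)) (\<lambda>W. \<lambda>x\<in>?I. W x)
      = distr (gauss_noise p n \<sigma>) (gauss_noise p n \<sigma>) (\<lambda>W. W)"
  proof (rule distr_cong)
    fix W assume "W \<in> space (gauss_noise p n \<sigma>)"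
    then show "(\<lambda>x\<in>?I. W x) = W"
      by (intro extensionalityI[of _ ?I]) (auto simp: gauss_noise_def space_PiM PiE_def)
  qed (auto simp: gauss_noise_def)
  also have "\<dots> = PiM ?I (\<lambda>_. noise1)" by (simp add: distr_id2 gauss_noise_def)
  also have "\<dots> = PiM ?I (\<lambda>x. distr (gauss_noise p n \<sigma>) noise1 (\<lambda>W. W x))"
    by (rule PiM_cong) (simp_all add: distr_coordinate)
  finally show ?thesis
    by (subst N.indep_vars_iff_distr_eq_PiM'[OF False coordinate_measurable]) auto
qed

lemma noise_cusum_distributed:
  assumes "s < v" "v < e" "e \<le> n" "i < p"
  shows "distributed (gauss_noise p n \<sigma>) lborel (noise_cusum \<sigma> s e v i) std_normal_density"
proof -
  let ?J = "{i} \<times> {s<..e}"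
  let ?c = "\<lambda>x. cusum_weight s e v (snd x) / \<sigma>"
  have sub: "?J \<subseteq> {..<p} \<times> {1..n}" using assms by auto
  have c: "?c x \<noteq> 0" for x using cusum_weight_nz[OF assms(1,2)] \<sigma> by simp
  have "distributed (gauss_noise p n \<sigma>) lborel (\<lambda>W. \<Sum>x\<in>?J. ?c x * W x)
     (normal_density (\<Sum>x\<in>?J. 0) (sqrt (\<Sum>x\<in>?J. (\<bar>?c x\<bar> * \<sigma>)\<^sup>2)))"
  proof (rule N.sum_indep_normal)
    show "?J \<noteq> {}" using assms by auto
    show "N.indep_vars (\<lambda>_. borel) (\<lambda>x W. ?c x * W x) ?J"
      by (rule N.indep_vars_compose2[OF N.indep_vars_subset[OF indep_coordinates sub]]) measurable
    fix x assume x: "x \<in> ?J"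
    show "0 < \<bar>?c x\<bar> * \<sigma>" using c[of x] \<sigma> by simp
    show "distributed (gauss_noise p n \<sigma>) lborel (\<lambda>W. ?c x * W x) (normal_density 0 (\<bar>?c x\<bar> * \<sigma>))"
      using N.normal_density_affine[OF coordinate_distributed \<sigma> c, of x 0] x sub by auto
  qed simp
  moreover have "(\<Sum>x\<in>?J. (\<bar>?c x\<bar> * \<sigma>)\<^sup>2) = 1"
  proof -
    have "(\<Sum>x\<in>?J. (\<bar>?c x\<bar> * \<sigma>)\<^sup>2) = (\<Sum>x\<in>?J. (cusum_weight s e v (snd x))\<^sup>2)"
      using \<sigma> by (intro sum.cong) (auto simp: power_mult_distrib power_divide)
    also have "\<dots> = (\<Sum>t\<in>{s<..e}. (cusum_weight s e v t)\<^sup>2)"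
      by (simp add: sum.cartesian_product[symmetric, where g = "\<lambda>_ t. (cusum_weight s e v t)\<^sup>2", unfolded split_def, simplified])
    finally show ?thesis using sum_cusum_weight_sq[OF assms(1,2)] by simp
  qed
  moreover have "(\<lambda>W. \<Sum>x\<in>?J. ?c x * W x) = noise_cusum \<sigma> s e v i"
  proof
    fix W
    have "(\<Sum>x\<in>?J. ?c x * W x) = (\<Sum>t\<in>{s<..e}. cusum_weight s e v t / \<sigma> * W (i, t))"
      by (rule sum.reindex_bij_witness[of _ "\<lambda>t. (i, t)" snd]) auto
    then show "(\<Sum>x\<in>?J. ?c x * W x) = noise_cusum \<sigma> s e v i W"
      by (simp add: noise_cusum_def cusum_eq_sum[OF assms(1,2)])
  qed
  ultimately show ?thesis by simp
qed

text \<open>Different rows read disjoint blocks of independent coordinates, so any measurable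
  functions of the blocks are independent.\<close>

lemma indep_noise_cusum:
  assumes "s < v" "v < e" "e \<le> n"
  shows "N.indep_vars (\<lambda>_. borel) (noise_cusum \<sigma> s e v) {..<p}"
proof -
  let ?K = "\<lambda>i::nat. {i} \<times> {1..n}"
  let ?Y = "\<lambda>i g. \<Sum>t\<in>{s<..e}. cusum_weight s e v t / \<sigma> * g (i, t)"
  have "N.indep_vars (\<lambda>i. PiM (?K i) (\<lambda>_. noise1)) (\<lambda>i W. \<lambda>x\<in>?K i. W x) {..<p}"
    by (rule N.indep_vars_restrict[OF indep_coordinates]) (auto simp: disjoint_family_on_def)
  then have "N.indep_vars (\<lambda>_. borel) (\<lambda>i W. ?Y i (\<lambda>x\<in>?K i. W x)) {..<p}"
  proof (rule N.indep_vars_compose2)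
    fix i assume "i \<in> {..<p}"
    show "?Y i \<in> borel_measurable (PiM (?K i) (\<lambda>_. noise1))"
    proof (intro borel_measurable_sum borel_measurable_times borel_measurable_const)
      fix t assume "t \<in> {s<..e}"
      then have "(i, t) \<in> ?K i" using assms by auto
      then have "(\<lambda>g. g (i, t)) \<in> measurable (PiM (?K i) (\<lambda>_. noise1)) noise1"
        by (rule measurable_component_singleton)
      then show "(\<lambda>g. g (i, t)) \<in> borel_measurable (PiM (?K i) (\<lambda>_. noise1))"
        by (simp cong: measurable_cong_sets)
    qed
  qed
  moreover have "(\<lambda>W. ?Y i (\<lambda>x\<in>?K i. W x)) = noise_cusum \<sigma> s e v i" for i
  proof
    fix W
    have "?Y i (\<lambda>x\<in>?K i. W x) = (\<Sum>t\<in>{s<..e}. cusum_weight s e v t / \<sigma> * W (i, t))"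
      using assms by (intro sum.cong) auto
    then show "?Y i (\<lambda>x\<in>?K i. W x) = noise_cusum \<sigma> s e v i W"
      by (simp add: noise_cusum_def cusum_eq_sum[OF assms(1,2)])
  qed
  ultimately show ?thesis by simp
qed

lemma Chernoff_noise_cusum:
  assumes "s < v" "v < e" "e \<le> n"
    and "\<And>i. g i \<in> borel_measurable borel"
    and "\<And>i. i < p \<Longrightarrow>
      (\<integral>\<^sup>+z. ennreal (std_normal_density z) * ennreal (exp (g i z)) \<partial>lborel) \<le> ennreal (exp (b i))"
  shows "measure (gauss_noise p n \<sigma>)
      {W \<in> space (gauss_noise p n \<sigma>). x \<le> (\<Sum>i<p. g i (noise_cusum \<sigma> s e v i W))}
    \<le> exp ((\<Sum>i<p. b i) - x)"
  by (rule N.Chernoff_std_normal[OF finite_lessThan indep_noise_cusum])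
     (use assms noise_cusum_distributed in auto)

end

section \<open>The penalty and the threshold\<close>

lemma ln_nat_ge_half: "2 \<le> n \<Longrightarrow> 1 / 2 \<le> ln (real n)"
proof -
  assume "2 \<le> n"
  then have "ln 2 \<le> ln (real n)" by simp
  moreover have "1 / 2 \<le> ln (2 :: real)" using ln2_ge_two_thirds by simp
  ultimately show ?thesis by simp
qed

text \<open>The dense branch is where \<open>t \<le> p\<close> matters: sqrt P <= t <= p forces ln n
  <= p, and then ln n <= sqrt (p ln n).\<close>

lemma rfun_ge_ln:
  assumes "2 \<le> n" "1 \<le> t" "t \<le> p"
  shows "ln (real n) \<le> rfun n p (real t)"
proof (cases "real t \<ge> sqrt (real p * ln (real n))")
  case False
  then show ?thesis by (simp add: rfun_def)
next
  case True
  let ?L = "ln (real n)"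
  have L: "0 \<le> ?L" using assms by simp
  have "sqrt (real p * ?L) \<le> real p" using True assms by simp
  then have "real p * ?L \<le> (real p)\<^sup>2" by (rule sqrt_le_D)
  then have "?L \<le> real p" using assms by (simp add: power2_eq_square)
  then have "?L * ?L \<le> real p * ?L" using L by (intro mult_right_mono)
  then have "?L \<le> sqrt (real p * ?L)" by (intro real_le_rsqrt) (simp add: power2_eq_square)
  then show ?thesis using True by (simp add: rfun_def)
qed

locale sparse_regime =
  fixes n p t :: nat
  assumes n: "2 \<le> n" and p: "1 \<le> p" and t: "1 \<le> t"
    and t_le: "real t \<le> sqrt (real p * ln (real n))"
begin

definition "P = real p * ln (real n)"
definition "\<Lambda> = ln (exp 1 * P / (real t)\<^sup>2)"
text \<open>With exp (-a^2 / 2) <= (t^2 / P)^2 the variance term summed over p rows is of order l^2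
  t^4 / (P ln n). It stays below a multiple of l t, hence of l r(t), as long as l is at most of
  order P ln n / t^3; the cap 1/8 is the range of the moment bound.\<close>

definition "l = 1 / 8 * min 1 (P * ln (real n) / (real t) ^ 3)"

lemma ln_pos: "0 < ln (real n)"
  using n by simp

lemma t_sq_le: "(real t)\<^sup>2 \<le> P"
  using sqrt_ge_absD[of "real t"] t_le by (simp add: P_def)

lemma P_pos: "0 < P"
  using ln_pos p by (simp add: P_def)

lemma \<Lambda>_eq: "\<Lambda> = 1 + ln (P / (real t)\<^sup>2)"
  using P_pos t ln_mult[of "exp 1" "P / (real t)\<^sup>2"] by (simp add: \<Lambda>_def)

lemma \<Lambda>_ge_1: "1 \<le> \<Lambda>"
  using t_sq_le t by (simp add: \<Lambda>_eq)

text \<open>The grid contains powers of two above \<open>p\<close> when \<open>p < ln n\<close>. For such a \<open>t\<close> equal to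
  \<open>sqrt P\<close> the penalty would be \<open>sqrt P < ln n\<close>, too small for a union bound; this case does not
  arise because \<open>p ln n\<close> is not an integer.\<close>

lemma t_less: "real t < sqrt P"
proof -
  have "real t \<noteq> sqrt P"
  proof
    assume "real t = sqrt P"
    then have "real (t\<^sup>2) = real p * ln (real n)" using P_pos by (simp add: P_def)
    then show False using mult_ln_not_nat[OF n p, of "t\<^sup>2"] by simp
  qed
  then show ?thesis using t_le by (simp add: P_def)
qed

lemma rfun_eq: "rfun n p (real t) = max (real t * \<Lambda>) (ln (real n))"
  using t_less by (simp add: rfun_def P_def \<Lambda>_def mult.assoc)

lemma rfun_ge: "real t * \<Lambda> \<le> rfun n p (real t)" "ln (real n) \<le> rfun n p (real t)"
  by (simp_all add: rfun_eq)

lemma rfun_ge_t: "real t \<le> rfun n p (real t)"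
  using rfun_ge(1) mult_left_mono[OF \<Lambda>_ge_1, of "real t"] by simp

lemma athr_sq: "(athr n p t)\<^sup>2 = 4 * \<Lambda>"
  using \<Lambda>_ge_1 t_le by (simp add: athr_def asq_def \<Lambda>_def P_def mult.assoc)

text \<open>The factor 4 in \<open>asq\<close> gives exp (-2 \<Lambda>), that is, the square of t^2
  / (e P). The square is what keeps the variance summed over all p rows small.\<close>

lemma exp_athr: "exp (- (athr n p t)\<^sup>2 / 2) \<le> ((real t)\<^sup>2 / P)\<^sup>2"
proof -
  have "0 < P / (real t)\<^sup>2" using P_pos t by simp
  then have "exp (- \<Lambda>) = exp (- 1) * ((real t)\<^sup>2 / P)"
    unfolding \<Lambda>_eq by (simp add: exp_diff exp_minus field_simps)
  also have "\<dots> \<le> 1 * ((real t)\<^sup>2 / P)" using P_pos by (intro mult_right_mono) auto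
  finally have "(exp (- \<Lambda>))\<^sup>2 \<le> ((real t)\<^sup>2 / P)\<^sup>2" by (intro power_mono) auto
  moreover have "exp (- (athr n p t)\<^sup>2 / 2) = (exp (- \<Lambda>))\<^sup>2"
    unfolding athr_sq by (simp flip: exp_double)
  ultimately show ?thesis by simp
qed

lemma l_bounds: "0 < l" "l \<le> 1 / 8" "\<bar>l\<bar> \<le> 1 / 8"
  using P_pos ln_pos t by (auto simp: l_def)

lemma variance_le: "real p * (384 * l\<^sup>2 * exp (- (athr n p t)\<^sup>2 / 2)) \<le> 48 * l * real t"
proof -
  have l_le: "l \<le> P * ln (real n) / (8 * (real t) ^ 3)"
    by (simp add: l_def min_def field_simps)
  have "real p * (384 * l\<^sup>2 * exp (- (athr n p t)\<^sup>2 / 2)) \<le> real p * (384 * l\<^sup>2 * ((real t)\<^sup>2 / P)\<^sup>2)"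
    by (intro mult_left_mono exp_athr) auto
  also have "\<dots> = (384 * l * real p * (real t) ^ 4 / P\<^sup>2) * l"
    by (simp add: power2_eq_square power4_eq_xxxx)
  also have "\<dots> \<le> (384 * l * real p * (real t) ^ 4 / P\<^sup>2) * (P * ln (real n) / (8 * (real t) ^ 3))"
    using l_bounds by (intro mult_left_mono l_le) auto
  also have "\<dots> = 48 * l * real t * (real p * ln (real n) / P)"
    using P_pos t by (simp add: power2_eq_square power4_eq_xxxx power3_eq_cube)
  also have "real p * ln (real n) / P = 1" using P_pos unfolding P_def[symmetric] by simp
  finally show ?thesis by simp
qed

text \<open>This is the exponent that a deviation of size r(t) buys. In the branch where the cap is
  inactive, r(t) >= t lowers the power of t in the denominator from 3 to 2.\<close>

lemma l_rfun_ge: "1 / 8 * min (rfun n p (real t)) (P * ln (real n) / (real t)\<^sup>2) \<le> l * rfun n p (real t)"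
proof -
  let ?r = "rfun n p (real t)" and ?q = "P * ln (real n) / (real t) ^ 3"
  have r: "0 \<le> ?r" using rfun_ge_t by linarith
  have q: "0 \<le> ?q" using P_pos ln_pos by simp
  have "P * ln (real n) / (real t)\<^sup>2 = ?q * real t"
    using t by (simp add: power2_eq_square power3_eq_cube)
  also have "\<dots> \<le> ?q * ?r" using q rfun_ge_t by (intro mult_left_mono)
  finally have "min ?r (P * ln (real n) / (real t)\<^sup>2) \<le> min 1 ?q * ?r"
    by (auto simp: min_def)
  then show ?thesis by (simp add: l_def)
qed

lemma ln_le_min: "ln (real n) \<le> min (rfun n p (real t)) (P * ln (real n) / (real t)\<^sup>2)"
proof -
  have "1 \<le> P / (real t)\<^sup>2" using t_sq_le t by simp
  then have "1 * ln (real n) \<le> P / (real t)\<^sup>2 * ln (real n)" using ln_pos by (intro mult_right_mono) auto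
  then show ?thesis using rfun_ge(2) by simp
qed

end

lemma athr_nonneg: "0 \<le> athr n p t" if "1 \<le> t" "1 \<le> p" "2 \<le> n"
proof (cases "real t \<le> sqrt (real p * ln (real n))")
  case True
  then interpret sparse_regime n p t using that by unfold_locales auto
  show ?thesis using \<Lambda>_ge_1 t_le by (simp add: athr_def asq_def \<Lambda>_def P_def mult.assoc)
next
  case False then show ?thesis by (simp add: athr_def asq_def)
qed

section \<open>False positives\<close>

lemma Tset_eq: "Tset n p = (\<lambda>m. 2 ^ m) ` {m. 2 ^ m \<le> nat \<lfloor>sqrt (real p * ln (real n))\<rfloor>} \<union> {p}"
  by (auto simp: Tset_def)

lemma finite_powers_le: "finite {m. 2 ^ m \<le> (N::nat)}"
  by (rule finite_subset[of _ "{..N}"]) (auto intro: order_trans[OF less_imp_le[OF less_exp]])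

lemma finite_Tset: "finite (Tset n p)"
  unfolding Tset_eq by (intro finite_UnI finite_imageI finite_powers_le) simp

text \<open>A geometric sum is controlled by its largest term. It is meant for t^2 = 4^m <= P, where
  a bound by the number of scales would involve p.\<close>

lemma sum_powers_of_4_le:
  fixes A :: "nat set" and x :: real
  assumes "finite A" "\<And>m. m \<in> A \<Longrightarrow> 4 ^ m \<le> x" "0 \<le> x"
  shows "(\<Sum>m\<in>A. 4 ^ m) \<le> 4 / 3 * x"
proof (cases "A = {}")
  case False
  have "(\<Sum>m\<in>A. 4 ^ m) \<le> (\<Sum>m<Suc (Max A). (4::real) ^ m)"
    using assms(1) by (intro sum_mono2) (auto simp: less_Suc_eq_le)
  also have "\<dots> = (4 ^ Suc (Max A) - 1) / 3" by (subst geometric_sum) auto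
  also have "\<dots> \<le> 4 / 3 * 4 ^ Max A" by simp
  also have "\<dots> \<le> 4 / 3 * x" using assms False by (intro mult_left_mono) auto
  finally show ?thesis .
qed (use assms in simp)

definition false_positive :: "nat \<Rightarrow> nat \<Rightarrow> real \<Rightarrow> nat \<Rightarrow> nat \<Rightarrow> nat \<Rightarrow> nat \<Rightarrow> (nat \<times> nat \<Rightarrow> real) set" where
  "false_positive n p \<sigma> s e v t = {W \<in> space (gauss_noise p n \<sigma>).
     176 * rfun n p (real t) \<le> (\<Sum>i<p. thresh (athr n p t) (noise_cusum \<sigma> s e v i W))}"

definition splits :: "nat \<Rightarrow> (nat \<times> nat \<times> nat) set" where
  "splits n = {(s, e, v). s < v \<and> v < e \<and> e \<le> n}"

lemma splits_subset: "splits n \<subseteq> {..<n} \<times> {1..n} \<times> {..<n}"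
  by (auto simp: splits_def)

lemma finite_splits: "finite (splits n)"
  using splits_subset by (rule finite_subset) simp

lemma card_splits_le: "real (card (splits n)) \<le> real n ^ 3"
proof -
  have "card (splits n) \<le> card ({..<n} \<times> {1..n} \<times> {..<n})"
    by (intro card_mono splits_subset) simp
  also have "\<dots> = n ^ 3" by (simp add: card_cartesian_product power3_eq_cube)
  finally show ?thesis by (metis of_nat_le_iff of_nat_power)
qed

lemma exp_ln_mult: "2 \<le> n \<Longrightarrow> exp (- real k * ln (real n)) = 1 / real n ^ k"
  by (simp add: exp_minus exp_of_nat_mult inverse_eq_divide)

context
  fixes n p :: nat and \<sigma> :: real
  assumes n: "2 \<le> n" and p: "1 \<le> p" and \<sigma>: "0 < \<sigma>"
begin

lemma null_tail_sparse:
  assumes "s < v" "v < e" "e \<le> n"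
    and t: "1 \<le> t" "real t \<le> sqrt (real p * ln (real n))"
  shows "measure (gauss_noise p n \<sigma>) {W \<in> space (gauss_noise p n \<sigma>).
      176 * rfun n p (real t) \<le> (\<Sum>i<p. thresh (athr n p t) (noise_cusum \<sigma> s e v i W))}
    \<le> exp (- 16 * min (rfun n p (real t)) (real p * ln (real n) * ln (real n) / (real t)\<^sup>2))"
proof -
  interpret sparse_regime n p t using n p t by unfold_locales
  let ?r = "rfun n p (real t)" and ?a = "athr n p t"
  let ?Z = "noise_cusum \<sigma> s e v"
  have eq: "176 * ?r \<le> (\<Sum>i<p. thresh ?a (?Z i W)) \<longleftrightarrow> l * (176 * ?r) \<le> (\<Sum>i<p. l * thresh ?a (?Z i W))" for W
    using l_bounds(1) by (simp flip: sum_distrib_left)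
  have "measure (gauss_noise p n \<sigma>) {W \<in> space (gauss_noise p n \<sigma>).
      l * (176 * ?r) \<le> (\<Sum>i<p. l * thresh ?a (?Z i W))}
    \<le> exp ((\<Sum>i<p. 384 * l\<^sup>2 * exp (- ?a\<^sup>2 / 2)) - l * (176 * ?r))"
    by (rule Chernoff_noise_cusum[OF \<sigma> assms(1-3), where g = "\<lambda>_ z. l * thresh ?a z"])
       (use nn_integral_exp_thresh[OF athr_nonneg[OF t p n] l_bounds(3)] in auto)
  also have "\<dots> \<le> exp (- 16 * min ?r (P * ln (real n) / (real t)\<^sup>2))"
  proof -
    have "48 * l * real t \<le> 48 * l * ?r" using l_bounds rfun_ge_t by (intro mult_left_mono) auto
    moreover have "(\<Sum>i<p. 384 * l\<^sup>2 * exp (- ?a\<^sup>2 / 2)) = real p * (384 * l\<^sup>2 * exp (- ?a\<^sup>2 / 2))" by simp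
    ultimately have "(\<Sum>i<p. 384 * l\<^sup>2 * exp (- ?a\<^sup>2 / 2)) - l * (176 * ?r) \<le> - 128 * (l * ?r)"
      using variance_le by linarith
    also have "\<dots> \<le> - 16 * min ?r (P * ln (real n) / (real t)\<^sup>2)"
      using l_rfun_ge by linarith
    finally show ?thesis by simp
  qed
  finally show ?thesis unfolding eq P_def .
qed

text \<open>The parameter balances the quadratic cost p l^2 against the linear gain l sqrt P: both
  become multiples of ln n. The assumption says ln n <= p, which puts \<open>l\<close> into the
  admissible range.\<close>

lemma dense_parameter:
  assumes "sqrt (real p * ln (real n)) \<le> real p"
  defines "l \<equiv> 1 / 8 * sqrt (ln (real n) / real p)"
  shows "0 < l" "l \<le> 1 / 8" "l * sqrt (real p * ln (real n)) = ln (real n) / 8" "real p * l\<^sup>2 = ln (real n) / 64"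
proof -
  let ?L = "ln (real n)"
  have L: "0 < ?L" using n by simp
  have "real p * ?L \<le> (real p)\<^sup>2" using assms(1) by (rule sqrt_le_D)
  then have "?L \<le> real p" using p by (simp add: power2_eq_square)
  then show "0 < l" "l \<le> 1 / 8" using L p by (simp_all add: l_def)
  have "sqrt (?L / real p) * sqrt (real p * ?L) = sqrt (?L\<^sup>2)"
    unfolding real_sqrt_mult[symmetric] using p by (simp add: power2_eq_square)
  then show "l * sqrt (real p * ?L) = ?L / 8" using L by (simp add: l_def)
  show "real p * l\<^sup>2 = ?L / 64" using L p by (simp add: l_def power_mult_distrib power_divide)
qed

lemma null_tail_dense:
  assumes "s < v" "v < e" "e \<le> n" and d: "sqrt (real p * ln (real n)) < real p"
  shows "measure (gauss_noise p n \<sigma>) {W \<in> space (gauss_noise p n \<sigma>).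
      176 * rfun n p (real p) \<le> (\<Sum>i<p. thresh (athr n p p) (noise_cusum \<sigma> s e v i W))}
    \<le> exp (- 16 * ln (real n))"
proof -
  let ?Z = "noise_cusum \<sigma> s e v" and ?P = "real p * ln (real n)"
  define l where "l = 1 / 8 * sqrt (ln (real n) / real p)"
  note l = dense_parameter[OF less_imp_le[OF d], folded l_def]
  have a: "athr n p p = 0" using d by (simp add: athr_def asq_def)
  have r: "rfun n p (real p) = sqrt ?P" using d by (simp add: rfun_def)
  have eq: "176 * sqrt ?P \<le> (\<Sum>i<p. thresh 0 (?Z i W)) \<longleftrightarrow> l * (176 * sqrt ?P) \<le> (\<Sum>i<p. l * thresh 0 (?Z i W))" for W
    using l(1) by (simp flip: sum_distrib_left)
  have "measure (gauss_noise p n \<sigma>) {W \<in> space (gauss_noise p n \<sigma>).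
      l * (176 * sqrt ?P) \<le> (\<Sum>i<p. l * thresh 0 (?Z i W))}
    \<le> exp ((\<Sum>i<p. 384 * l\<^sup>2) - l * (176 * sqrt ?P))"
    by (rule Chernoff_noise_cusum[OF \<sigma> assms(1-3), where g = "\<lambda>_ z. l * thresh 0 z"])
       (use nn_integral_exp_thresh[of 0 l] l in auto)
  also have "\<dots> = exp (- 16 * ln (real n))"
  proof -
    have "(\<Sum>i<p. 384 * l\<^sup>2) = 384 * (real p * l\<^sup>2)" by simp
    moreover have "l * (176 * sqrt ?P) = 176 * (l * sqrt ?P)" by simp
    ultimately show ?thesis unfolding l(3,4) by simp
  qed
  finally show ?thesis unfolding a r eq .
qed

lemma power_le_sqrt:
  assumes "2 ^ m \<le> nat \<lfloor>sqrt (real p * ln (real n))\<rfloor>"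
  shows "real (2 ^ m) \<le> sqrt (real p * ln (real n))"
proof -
  have "0 \<le> sqrt (real p * ln (real n))" using n by simp
  then show ?thesis using assms by (metis of_nat_floor of_nat_le_iff order_trans)
qed

text \<open>Half of the exponent 16 pays for the positions, the other half for summability over m.
  If the minimum is r(t), then r(t) >= 2^m >= m + 1 yields a geometric factor. Otherwise the
  remaining exp (-4 u), with u = P / t^2 and ln n >= 1/2, is at most 1 / (4 u), which is the term
  with 4^m.\<close>

lemma false_positive_power_le:
  assumes "s < v" "v < e" "e \<le> n" and m: "2 ^ m \<le> nat \<lfloor>sqrt (real p * ln (real n))\<rfloor>"
  shows "measure (gauss_noise p n \<sigma>) (false_positive n p \<sigma> s e v (2 ^ m))
    \<le> exp (- 8 * ln (real n)) * ((1 / 2) ^ Suc m + 4 ^ m / (4 * (real p * ln (real n))))"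
proof -
  let ?t = "2 ^ m :: nat" and ?L = "ln (real n)"
  interpret sparse_regime n p ?t using n p power_le_sqrt[OF m] by unfold_locales auto
  let ?r = "rfun n p (real ?t)"
  have L: "1 / 2 \<le> ?L" using n by (rule ln_nat_ge_half)
  have "measure (gauss_noise p n \<sigma>) (false_positive n p \<sigma> s e v ?t) \<le> exp (- 16 * min ?r (P * ?L / (real ?t)\<^sup>2))"
    unfolding false_positive_def P_def
    by (rule null_tail_sparse[OF assms(1-3)]) (use power_le_sqrt[OF m] in auto)
  also have "\<dots> \<le> exp (- 16 * ?r) + exp (- 16 * (P * ?L / (real ?t)\<^sup>2))"
    by (auto simp: min_def)
  also have "exp (- 16 * ?r) \<le> exp (- 8 * ?L) * (1 / 2) ^ Suc m"
  proof -
    have "real (Suc m) \<le> 2 ^ m" using of_nat_mono[OF Suc_leI[OF less_exp[of m]], where 'a = real] by simp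
    then have "- 16 * ?r \<le> - 8 * ?L + - real (Suc m)" using rfun_ge(2) rfun_ge_t by simp
    then have "exp (- 16 * ?r) \<le> exp (- 8 * ?L) * exp (- real (Suc m))" by (simp flip: exp_add)
    also have "exp (- real (Suc m)) = exp (- 1) ^ Suc m" using exp_of_nat_mult[of "Suc m" "- 1 :: real"] by simp
    also have "exp (- 1) ^ Suc m \<le> (1 / 2 :: real) ^ Suc m"
    proof (rule power_mono)
      have "2 \<le> exp (1 :: real)" using exp_ge_add_one_self[of 1] by simp
      then show "exp (- 1) \<le> (1 / 2 :: real)" by (simp add: exp_minus field_simps)
    qed simp
    finally show ?thesis by simp
  qed
  also have "exp (- 16 * (P * ?L / (real ?t)\<^sup>2)) \<le> exp (- 8 * ?L) * (4 ^ m / (4 * P))"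
  proof -
    let ?u = "P / (real ?t)\<^sup>2"
    have u: "1 \<le> ?u" using t_sq_le by simp
    have uL: "1 * ?L \<le> ?u * ?L" "?u * (1 / 2) \<le> ?u * ?L"
      using u L by (intro mult_right_mono mult_left_mono; linarith)+
    then have "exp (- 16 * (?u * ?L)) \<le> exp (- 8 * ?L + - (4 * ?u))" by simp
    also have "\<dots> = exp (- 8 * ?L) * exp (- (4 * ?u))" by (rule exp_add)
    also have "exp (- (4 * ?u)) \<le> 1 / (4 * ?u)"
    proof -
      have le: "4 * ?u \<le> exp (4 * ?u)" using exp_ge_add_one_self[of "4 * ?u"] by linarith
      show ?thesis unfolding exp_minus inverse_eq_divide
        by (intro divide_left_mono mult_pos_pos exp_gt_zero le) (use u in linarith)+
    qed
    also have "1 / (4 * ?u) = 4 ^ m / (4 * P)"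
      using P_pos by (simp add: power2_eq_square field_simps flip: power_mult_distrib)
    finally show ?thesis by simp
  qed
  finally show ?thesis by (simp add: P_def distrib_left)
qed

lemma false_positive_p_le:
  assumes "s < v" "v < e" "e \<le> n"
  shows "measure (gauss_noise p n \<sigma>) (false_positive n p \<sigma> s e v p) \<le> exp (- 8 * ln (real n))"
proof (cases "real p \<le> sqrt (real p * ln (real n))")
  \<comment> \<open>This happens exactly for p <= ln n; then the scale p is itself thresholded and
    falls under the sparse bound.\<close>
  case True
  interpret sparse_regime n p p using n p True by unfold_locales auto
  have "measure (gauss_noise p n \<sigma>) (false_positive n p \<sigma> s e v p)
      \<le> exp (- 16 * min (rfun n p (real p)) (P * ln (real n) / (real p)\<^sup>2))"
    unfolding false_positive_def P_def by (rule null_tail_sparse[OF assms p True])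
  also have "\<dots> \<le> exp (- 8 * ln (real n))"
    unfolding exp_le_cancel_iff using ln_le_min ln_pos by linarith
  finally show ?thesis .
next
  case False
  have "measure (gauss_noise p n \<sigma>) (false_positive n p \<sigma> s e v p) \<le> exp (- 16 * ln (real n))"
    unfolding false_positive_def by (rule null_tail_dense[OF assms]) (use False in simp)
  also have "\<dots> \<le> exp (- 8 * ln (real n))" using n by simp
  finally show ?thesis .
qed

lemma sum_false_positive_le:
  assumes "s < v" "v < e" "e \<le> n"
  shows "(\<Sum>t\<in>Tset n p. measure (gauss_noise p n \<sigma>) (false_positive n p \<sigma> s e v t)) \<le> 3 * exp (- 8 * ln (real n))"
proof -
  let ?E = "exp (- 8 * ln (real n))" and ?P = "real p * ln (real n)"
  let ?f = "\<lambda>t. measure (gauss_noise p n \<sigma>) (false_positive n p \<sigma> s e v t)"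
  define A where "A = {m. 2 ^ m \<le> nat \<lfloor>sqrt ?P\<rfloor>}"
  have A: "finite A" unfolding A_def by (rule finite_powers_le)
  have P: "0 < ?P" using n p by simp
  have "(\<Sum>t\<in>Tset n p. ?f t) \<le> ?f p + (\<Sum>t\<in>(\<lambda>m. 2 ^ m) ` A. ?f t)"
    unfolding Tset_eq A_def[symmetric] using A by (simp add: sum.insert_if)
  also have "(\<Sum>t\<in>(\<lambda>m. 2 ^ m) ` A. ?f t) = (\<Sum>m\<in>A. ?f (2 ^ m))"
    by (subst sum.reindex) (auto intro!: inj_onI)
  also have "\<dots> \<le> (\<Sum>m\<in>A. ?E * ((1 / 2) ^ Suc m + 4 ^ m / (4 * ?P)))"
    by (intro sum_mono false_positive_power_le assms) (simp add: A_def)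
  also have "\<dots> = ?E * ((\<Sum>m\<in>A. (1 / 2) ^ Suc m) + (\<Sum>m\<in>A. 4 ^ m) / (4 * ?P))"
    by (simp only: sum_distrib_left[symmetric] sum.distrib sum_divide_distrib)
  also have "\<dots> \<le> ?E * (1 + 1)"
  proof (intro mult_left_mono add_mono)
    have "(\<Sum>m\<in>A. (1 / 2 :: real) ^ Suc m) \<le> (\<Sum>m. (1 / 2) ^ Suc m)"
      using A by (intro sum_le_suminf) (auto intro: summable_geometric)
    also have "\<dots> = 1" using power_half_series by (rule sums_unique[symmetric])
    finally show "(\<Sum>m\<in>A. (1 / 2 :: real) ^ Suc m) \<le> 1" .
    have "(\<Sum>m\<in>A. (4::real) ^ m) \<le> 4 / 3 * ?P"
    proof (rule sum_powers_of_4_le[OF A])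
      fix m assume "m \<in> A"
      then have "real (2 ^ m) \<le> sqrt ?P" unfolding A_def by (intro power_le_sqrt) simp
      then have "(real (2 ^ m))\<^sup>2 \<le> ?P" using sqrt_ge_absD[of "real (2 ^ m)"] by simp
      then show "4 ^ m \<le> ?P" by (simp add: power2_eq_square flip: power_mult_distrib)
    qed (use P in simp)
    also have "\<dots> \<le> 4 * ?P" using P by simp
    finally show "(\<Sum>m\<in>A. 4 ^ m) / (4 * ?P) \<le> 1" using P by simp
  qed simp
  finally show ?thesis using false_positive_p_le[OF assms] by simp
qed

lemma measurable_noise_cusum:
  assumes "s < v" "v < e" "e \<le> n" "i < p"
  shows "noise_cusum \<sigma> s e v i \<in> borel_measurable (gauss_noise p n \<sigma>)"
  using distributed_measurable[OF noise_cusum_distributed[OF \<sigma> assms]] by simp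

lemma measurable_sum_thresh:
  assumes "s < v" "v < e" "e \<le> n"
  shows "(\<lambda>W. \<Sum>i<p. thresh a (m i + noise_cusum \<sigma> s e v i W)) \<in> borel_measurable (gauss_noise p n \<sigma>)"
  by (intro borel_measurable_sum measurable_compose[OF _ measurable_thresh] borel_measurable_add
      borel_measurable_const measurable_noise_cusum assms) simp

lemma false_positive_sets:
  assumes "s < v" "v < e" "e \<le> n"
  shows "false_positive n p \<sigma> s e v t \<in> sets (gauss_noise p n \<sigma>)"
  unfolding false_positive_def
  using measurable_sum_thresh[OF assms, of "athr n p t" "\<lambda>_. 0"] by simp

lemma false_positive_event_le:
  "measure (gauss_noise p n \<sigma>) (\<Union>(s, e, v)\<in>splits n. \<Union>t\<in>Tset n p. false_positive n p \<sigma> s e v t)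
    \<le> 1 / (4 * real n)"
proof -
  let ?M = "gauss_noise p n \<sigma>"
  interpret N: prob_space ?M by (rule prob_space_gauss_noise[OF \<sigma>])
  have "measure ?M (\<Union>(s, e, v)\<in>splits n. \<Union>t\<in>Tset n p. false_positive n p \<sigma> s e v t)
     \<le> (\<Sum>(s, e, v)\<in>splits n. measure ?M (\<Union>t\<in>Tset n p. false_positive n p \<sigma> s e v t))"
    unfolding case_prod_beta
    by (rule N.finite_measure_subadditive_finite[OF finite_splits])
       (auto simp: splits_def intro!: sets.finite_UN finite_Tset false_positive_sets)
  also have "\<dots> \<le> (\<Sum>(s, e, v)\<in>splits n. 3 * exp (- 8 * ln (real n)))"
  proof (rule sum_mono, clarify)
    fix s e v assume "(s, e, v) \<in> splits n"
    then have *: "s < v" "v < e" "e \<le> n" by (auto simp: splits_def)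
    have "measure ?M (\<Union>t\<in>Tset n p. false_positive n p \<sigma> s e v t)
       \<le> (\<Sum>t\<in>Tset n p. measure ?M (false_positive n p \<sigma> s e v t))"
      by (rule N.finite_measure_subadditive_finite[OF finite_Tset])
         (auto intro!: false_positive_sets *)
    also have "\<dots> \<le> 3 * exp (- 8 * ln (real n))" by (rule sum_false_positive_le[OF *])
    finally show "measure ?M (\<Union>t\<in>Tset n p. false_positive n p \<sigma> s e v t) \<le> 3 * exp (- 8 * ln (real n))" .
  qed
  also have "\<dots> = real (card (splits n)) * (3 / real n ^ 8)"
    using exp_ln_mult[OF n, of 8] by (simp add: case_prod_beta)
  \<comment> \<open>There are n^3 triples against 3 n^(-8); since n >= 2, the surplus 3 / n^4 is at
    most 3/16.\<close>
  also have "\<dots> \<le> real n ^ 3 * (3 / real n ^ 8)"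
    by (intro mult_right_mono card_splits_le) simp
  also have "\<dots> = 3 / real n ^ 4 * (1 / real n)"
    using n by (simp add: field_simps eval_nat_numeral)
  also have "\<dots> \<le> 1 / 4 * (1 / real n)"
  proof (rule mult_right_mono)
    have "(2::real) ^ 4 \<le> real n ^ 4" using n by (intro power_mono) auto
    then show "3 / real n ^ 4 \<le> 1 / 4" using n by (simp add: divide_le_eq)
  qed simp
  finally show ?thesis by simp
qed

section \<open>Missed change points\<close>

lemma detection_dense:
  assumes "s < v" "v < e" "e \<le> n" and d: "sqrt (real p * ln (real n)) < real p"
    and m: "2000 * sqrt (real p * ln (real n)) \<le> (\<Sum>i<p. (m i)\<^sup>2)"
  shows "measure (gauss_noise p n \<sigma>) {W \<in> space (gauss_noise p n \<sigma>).
      (\<Sum>i<p. thresh (athr n p p) (m i + noise_cusum \<sigma> s e v i W)) \<le> 176 * rfun n p (real p)}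
    \<le> exp (- 4 * ln (real n))"
proof -
  let ?Z = "noise_cusum \<sigma> s e v" and ?P = "real p * ln (real n)"
  define l where "l = 1 / 8 * sqrt (ln (real n) / real p)"
  note l = dense_parameter[OF less_imp_le[OF d], folded l_def]
  have a: "athr n p p = 0" using d by (simp add: athr_def asq_def)
  have r: "rfun n p (real p) = sqrt ?P" using d by (simp add: rfun_def)
  have eq: "(\<Sum>i<p. thresh 0 (m i + ?Z i W)) \<le> 176 * sqrt ?P
      \<longleftrightarrow> - l * (176 * sqrt ?P) \<le> (\<Sum>i<p. - l * thresh 0 (m i + ?Z i W))" for W
    using l(1) by (simp add: sum_negf flip: sum_distrib_left)
  have "measure (gauss_noise p n \<sigma>) {W \<in> space (gauss_noise p n \<sigma>).
      - l * (176 * sqrt ?P) \<le> (\<Sum>i<p. - l * thresh 0 (m i + ?Z i W))}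
    \<le> exp ((\<Sum>i<p. 2 * l\<^sup>2 - l * (m i)\<^sup>2 / 2) - - l * (176 * sqrt ?P))"
    by (rule Chernoff_noise_cusum[OF \<sigma> assms(1-3), where g = "\<lambda>i z. - l * thresh 0 (m i + z)"])
       (use nn_integral_exp_neg_square_shifted[of l] l in auto)
  also have "\<dots> \<le> exp (- 4 * ln (real n))"
  proof -
    \<comment> \<open>In units of ln n: the signal contributes -125, the penalty 22 and the
      second-order centring cost 1/32.\<close>
    have "(\<Sum>i<p. 2 * l\<^sup>2 - l * (m i)\<^sup>2 / 2) = 2 * (real p * l\<^sup>2) - l * (\<Sum>i<p. (m i)\<^sup>2) / 2"
      by (simp add: sum_subtractf sum_distrib_left sum_divide_distrib)
    moreover have "l * (2000 * sqrt ?P) \<le> l * (\<Sum>i<p. (m i)\<^sup>2)"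
      using l(1) m by (intro mult_left_mono) auto
    moreover have "l * (2000 * sqrt ?P) = 250 * ln (real n)" "l * (176 * sqrt ?P) = 22 * ln (real n)"
      using l(3) by simp_all
    moreover have "0 < ln (real n)" using n by simp
    ultimately have "(\<Sum>i<p. 2 * l\<^sup>2 - l * (m i)\<^sup>2 / 2) - - l * (176 * sqrt ?P) \<le> - 4 * ln (real n)"
      unfolding l(4) by linarith
    then show ?thesis by simp
  qed
  finally show ?thesis unfolding a r eq .
qed

text \<open>The grid point \<open>t\<close> approximates the sparsity \<open>k\<close> within a
  factor 2. Three costs in units of l r(t) have to be covered by the signal: the variance (48), the
  threshold on the k signal rows (20) and the penalty (176).\<close>

lemma detection_sparse:
  assumes "s < v" "v < e" "e \<le> n"
    and k: "k = card {i. i < p \<and> m i \<noteq> 0}" "t \<le> k" "k \<le> 2 * t" "1 \<le> t"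
    and k_le: "real k \<le> sqrt (real p * ln (real n))"
    and m: "2000 * rfun n p (real k) \<le> (\<Sum>i<p. (m i)\<^sup>2)"
  shows "measure (gauss_noise p n \<sigma>) {W \<in> space (gauss_noise p n \<sigma>).
      (\<Sum>i<p. thresh (athr n p t) (m i + noise_cusum \<sigma> s e v i W)) \<le> 176 * rfun n p (real t)}
    \<le> exp (- 4 * ln (real n))"
proof -
  interpret sparse_regime n p t using n p k k_le by unfold_locales auto
  interpret k: sparse_regime n p k using n p k k_le by unfold_locales auto
  let ?Z = "noise_cusum \<sigma> s e v" and ?r = "rfun n p (real t)" and ?a = "athr n p t"
  let ?v = "384 * l\<^sup>2 * exp (- ?a\<^sup>2 / 2)"
  \<comment> \<open>Rows without signal use the centred bound at \<open>-l\<close>, so only their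
    variance enters; rows with signal pay the threshold and gain their squared mean.\<close>
  define b where "b i = (if m i = 0 then ?v else l * (2 * ?a\<^sup>2 + 2) - l * (m i)\<^sup>2 / 2)" for i
  have eq: "(\<Sum>i<p. thresh ?a (m i + ?Z i W)) \<le> 176 * ?r
      \<longleftrightarrow> - l * (176 * ?r) \<le> (\<Sum>i<p. - l * thresh ?a (m i + ?Z i W))" for W
    using l_bounds(1) by (simp add: sum_negf flip: sum_distrib_left)
  note a = athr_nonneg[OF k(4) p n]
  have "measure (gauss_noise p n \<sigma>) {W \<in> space (gauss_noise p n \<sigma>).
      - l * (176 * ?r) \<le> (\<Sum>i<p. - l * thresh ?a (m i + ?Z i W))}
    \<le> exp ((\<Sum>i<p. b i) - - l * (176 * ?r))"
  proof (rule Chernoff_noise_cusum[OF \<sigma> assms(1-3), where g = "\<lambda>i z. - l * thresh ?a (m i + z)"])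
    fix i
    show "(\<integral>\<^sup>+z. ennreal (std_normal_density z) * ennreal (exp (- l * thresh ?a (m i + z))) \<partial>lborel)
      \<le> ennreal (exp (b i))"
    proof (cases "m i = 0")
      case True
      then show ?thesis using nn_integral_exp_thresh[OF a, of "- l"] l_bounds by (simp add: b_def)
    next
      case False
      then show ?thesis using nn_integral_exp_neg_thresh_shifted[OF a, of l "m i"] l_bounds by (simp add: b_def)
    qed
  qed measurable
  also have "\<dots> \<le> exp (- 4 * ln (real n))"
  proof -
    have "(\<Sum>i<p. b i) \<le> (\<Sum>i<p. ?v + (if m i \<noteq> 0 then l * (2 * ?a\<^sup>2 + 2) else 0) - l * (m i)\<^sup>2 / 2)"
      by (intro sum_mono) (simp add: b_def)
    also have "\<dots> = real p * ?v + real k * (l * (2 * ?a\<^sup>2 + 2)) - l * (\<Sum>i<p. (m i)\<^sup>2) / 2"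
    proof -
      have "(\<Sum>i<p. if m i \<noteq> 0 then l * (2 * ?a\<^sup>2 + 2) else 0) = (\<Sum>i\<in>{i. i < p \<and> m i \<noteq> 0}. l * (2 * ?a\<^sup>2 + 2))"
        by (rule sum.mono_neutral_cong_right) auto
      then show ?thesis by (simp add: sum_subtractf sum.distrib sum_distrib_left sum_divide_distrib k(1))
    qed
    also have "\<dots> \<le> 48 * l * ?r + 20 * l * ?r - 1000 * l * rfun n p (real k)"
    proof (intro diff_mono add_mono)
      have "48 * l * real t \<le> 48 * l * ?r" using l_bounds rfun_ge_t by (intro mult_left_mono) auto
      then show "real p * ?v \<le> 48 * l * ?r" using variance_le by linarith
      have "real k * (2 * ?a\<^sup>2 + 2) \<le> (2 * real t) * (2 * ?a\<^sup>2 + 2)"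
        using k(3) by (intro mult_right_mono) auto
      also have "\<dots> = 16 * (real t * \<Lambda>) + 4 * real t" unfolding athr_sq by (simp add: algebra_simps)
      also have "\<dots> \<le> 20 * ?r" using rfun_ge(1) rfun_ge_t by linarith
      finally have "l * (real k * (2 * ?a\<^sup>2 + 2)) \<le> l * (20 * ?r)" using l_bounds by (intro mult_left_mono) auto
      then show "real k * (l * (2 * ?a\<^sup>2 + 2)) \<le> 20 * l * ?r" by (simp add: mult_ac)
      have "l * (2000 * rfun n p (real k)) \<le> l * (\<Sum>i<p. (m i)\<^sup>2)" using l_bounds m by (intro mult_left_mono) auto
      then show "1000 * l * rfun n p (real k) \<le> l * (\<Sum>i<p. (m i)\<^sup>2) / 2" by simp
    qed
    also have "\<dots> \<le> 68 * (l * ?r) - 333 * (l * ?r)"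
    proof -
      \<comment> \<open>As k <= 2 t, the logarithm changes by at most ln 4 <= 2, and \<Lambda> >= 1
        absorbs this into a factor 3. So r(t) <= 3 r(k), and the gain 1000 l r(k) is at least 333 l
        r(t).\<close>
      have "real t * \<Lambda> \<le> real k * (3 * k.\<Lambda>)"
      proof (rule mult_mono)
        have "P / (real t)\<^sup>2 \<le> 4 * (P / (real k)\<^sup>2)"
        proof -
          have "(real k)\<^sup>2 \<le> (2 * real t)\<^sup>2" using k(3) by (intro power_mono) auto
          then have "P * (real k)\<^sup>2 \<le> P * (4 * (real t)\<^sup>2)" using P_pos by (intro mult_left_mono) (auto simp: power2_eq_square)
          moreover have "0 < real k" "0 < real t" using k(2,4) by auto
          ultimately show ?thesis by (simp add: field_simps)
        qed
        then have "ln (P / (real t)\<^sup>2) \<le> ln (4 * (P / (real k)\<^sup>2))"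
          by (rule ln_mono) (use P_pos k in auto)
        also have "\<dots> = ln 4 + ln (P / (real k)\<^sup>2)"
          using P_pos k(2,4) by (subst ln_mult) auto
        also have "ln (4::real) \<le> 2"
          using ln_realpow[of 2 2] ln_le_minus_one[of "2::real"] by simp
        finally show "\<Lambda> \<le> 3 * k.\<Lambda>"
          using k.\<Lambda>_ge_1 unfolding \<Lambda>_eq k.\<Lambda>_eq by (simp add: P_def k.P_def)
      qed (use k \<Lambda>_ge_1 in auto)
      then have "?r \<le> 3 * rfun n p (real k)"
        using k.rfun_ge k.ln_pos unfolding rfun_eq by auto
      then have "l * ?r \<le> l * (3 * rfun n p (real k))" using l_bounds by (intro mult_left_mono) auto
      moreover have "0 \<le> l * rfun n p (real k)" using l_bounds k.rfun_ge(2) ln_pos by simp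
      ultimately show ?thesis by linarith
    qed
    finally have "(\<Sum>i<p. b i) - - l * (176 * ?r) \<le> - 89 * (l * ?r)" by simp
    also have "\<dots> \<le> - 4 * ln (real n)" using l_rfun_ge ln_le_min ln_pos by linarith
    finally show ?thesis by simp
  qed
  finally show ?thesis unfolding eq .
qed

text \<open>For k <= sqrt P the witness is the largest power of two up to k. For larger k it is p:
  then sqrt P < k <= p, so there is no threshold at scale p and both penalties equal sqrt P up to
  their constant.\<close>

lemma detection_tail:
  assumes "s < v" "v < e" "e \<le> n"
    and k: "k = card {i. i < p \<and> m i \<noteq> 0}" "1 \<le> k"
    and m: "2000 * rfun n p (real k) \<le> (\<Sum>i<p. (m i)\<^sup>2)"
  shows "\<exists>t\<in>Tset n p. measure (gauss_noise p n \<sigma>) {W \<in> space (gauss_noise p n \<sigma>).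
      (\<Sum>i<p. thresh (athr n p t) (m i + noise_cusum \<sigma> s e v i W)) \<le> 176 * rfun n p (real t)}
    \<le> exp (- 4 * ln (real n))"
proof (cases "real k \<le> sqrt (real p * ln (real n))")
  case True
  obtain j where j: "2 ^ j \<le> k" "k < 2 ^ (j + 1)" using ex_power_ivl1[of 2 k] k(2) by auto
  have "2 ^ j \<le> nat \<lfloor>sqrt (real p * ln (real n))\<rfloor>"
    using j(1) True by (meson le_nat_floor of_nat_le_iff order_trans)
  then have "2 ^ j \<in> Tset n p" by (auto simp: Tset_def)
  then show ?thesis
    using detection_sparse[OF assms(1-3) k(1) j(1) _ _ True m] j(2) by (intro bexI[of _ "2 ^ j"]) auto
next
  case False
  have "k \<le> card {..<p}" unfolding k(1) by (intro card_mono) auto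
  then have "sqrt (real p * ln (real n)) < real p" using False by simp
  moreover have "rfun n p (real k) = sqrt (real p * ln (real n))" using False by (simp add: rfun_def)
  ultimately show ?thesis
    using detection_dense[OF assms(1-3)] m by (intro bexI[of _ p]) (auto simp: Tset_def)
qed

end

section \<open>The recursion\<close>

lemma finite_Ocal: "finite Ms \<Longrightarrow> finite (Ocal n p Y gam Ms s e)"
  unfolding Ocal_def by (rule finite_subset[of _ Ms]) auto

text \<open>Success also asserts that an output exists, which a relation does not provide by itself.
  Detected intervals have an interior point, so both recursive segments are strictly shorter and
  maximisers exist.\<close>

lemma esac_total:
  assumes "finite Ms"
  shows "\<exists>B. esac n p Y gam lam Ms s e B"
proof (induction "e - s" arbitrary: s e rule: less_induct)
  case less
  show ?case
  proof (cases "e - s \<le> 1 \<or> Ocal n p Y gam Ms s e = {}")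
    case True
    then show ?thesis by (meson esac.stop_short esac.stop_empty not_le)
  next
    case False
    let ?O = "Ocal n p Y gam Ms s e"
    have fin: "finite ?O" using assms by (rule finite_Ocal)
    let ?len = "\<lambda>(a::nat, b::nat). b - a"
    have "Min (?len ` ?O) \<in> ?len ` ?O"
      using False fin by (intro Min_in) auto
    then obtain I where "I \<in> ?O" "Min (?len ` ?O) = ?len I" by (rule imageE)
    then have ne: "{I \<in> ?O. ?len I = Min (?len ` ?O)} \<noteq> {}" by (metis (mono_tags, lifting) empty_iff mem_Collect_eq)
    let ?O' = "{I \<in> ?O. ?len I = Min (?len ` ?O)}"
    let ?S = "\<lambda>(a, b). SmaxV n p Y lam a b"
    have "Max (?S ` ?O') \<in> ?S ` ?O'" using ne fin by (intro Max_in) auto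
    then obtain sm em where I: "(sm, em) \<in> ?O'" "SmaxV n p Y lam sm em = Max (?S ` ?O')" by auto
    have le: "s \<le> sm" "em \<le> e" "sm + 1 < em"
    proof -
      from I(1) have "s \<le> sm" "em \<le> e" "{sm<..<em} \<noteq> {}" by (auto simp: Ocal_def)
      moreover from this(3) obtain v where "sm < v" "v < em" by auto
      ultimately show "s \<le> sm" "em \<le> e" "sm + 1 < em" by auto
    qed
    have max: "\<forall>(a, b) \<in> ?O. b - a = em - sm \<longrightarrow> SmaxV n p Y lam a b \<le> SmaxV n p Y lam sm em"
    proof (clarify)
      fix a b assume "(a, b) \<in> ?O" "b - a = em - sm"
      then have "(a, b) \<in> ?O'" using I(1) by auto
      then have "?S (a, b) \<le> Max (?S ` ?O')" using fin by (intro Max_ge) auto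
      then show "SmaxV n p Y lam a b \<le> SmaxV n p Y lam sm em" using I(2) by simp
    qed
    have "Max (Smax n p Y lam sm em ` {sm<..<em}) \<in> Smax n p Y lam sm em ` {sm<..<em}"
      using le by (intro Max_in) (auto intro!: exI[of _ "sm + 1"])
    then obtain v where v: "sm < v" "v < em"
      "Smax n p Y lam sm em v = Max (Smax n p Y lam sm em ` {sm<..<em})" by auto
    have vmax: "\<forall>v'. sm < v' \<and> v' < em \<longrightarrow> Smax n p Y lam sm em v' \<le> Smax n p Y lam sm em v"
      unfolding v(3) by (auto intro!: Max_ge)
    obtain B1 where B1: "esac n p Y gam lam Ms s (sm + 1) B1"
      using less[of "sm + 1" s] le by fastforce
    obtain B2 where B2: "esac n p Y gam lam Ms (em - 1) e B2"
      using less[of e "em - 1"] le by fastforce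
    have "esac n p Y gam lam Ms s e (insert v (B1 \<union> B2))"
      by (rule esac.split[OF _ _ _ max v(1,2) vmax B1 B2]) (use False I(1) in auto)
    then show ?thesis by blast
  qed
qed

text \<open>The invariant of the recursion is that the seeded interval certifying a change point stays
  inside the current segment for as long as the change point itself does. The narrowest detected
  interval is then no longer than any of the certifying intervals, hence it isolates a single change
  point and does not cut into the certifying intervals of the others.\<close>

lemma esac_matches_changepoints:
  fixes lh sd ed :: "nat \<Rightarrow> nat"
  assumes "esac n p Y gam lam Ms s e B"
    and "\<And>\<eta>. \<eta> \<in> CP \<Longrightarrow> s < \<eta> \<Longrightarrow> \<eta> < e \<Longrightarrow> s \<le> sd \<eta> \<and> ed \<eta> \<le> e"
    and fin: "finite Ms"
    and det: "\<And>\<eta>. \<eta> \<in> CP \<Longrightarrow> (sd \<eta>, ed \<eta>) \<in> Ms \<and> sd \<eta> < \<eta> \<and> \<eta> < ed \<eta> \<and> ed \<eta> = sd \<eta> + 2 * lh \<eta>"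
    and sep: "\<And>\<eta> \<eta>'. \<eta> \<in> CP \<Longrightarrow> \<eta>' \<in> CP \<Longrightarrow> \<eta> < \<eta>' \<Longrightarrow>
                 \<eta> + 4 * lh \<eta> \<le> \<eta>' + 3 \<and> \<eta> + 4 * lh \<eta>' \<le> \<eta>' + 3"
    and pos: "\<And>\<eta>. \<eta> \<in> CP \<Longrightarrow> SmaxV n p Y gam (sd \<eta>) (ed \<eta>) > 0"
    and null: "\<And>a b. (a, b) \<in> Ms \<Longrightarrow> a + 1 < b \<Longrightarrow> {a<..<b} \<inter> CP = {} \<Longrightarrow> SmaxV n p Y gam a b \<le> 0"
  shows "\<exists>f. strict_mono_on (CP \<inter> {s<..<e}) f \<and> B = f ` (CP \<inter> {s<..<e}) \<and>
             (\<forall>\<eta> \<in> CP \<inter> {s<..<e}. s < f \<eta> \<and> f \<eta> < e \<and> \<bar>int (f \<eta>) - int \<eta>\<bar> \<le> 2 * int (lh \<eta>) - 2)"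
  using assms(1,2)
proof (induction rule: esac.induct)
  case (stop_short e s)
  then have "CP \<inter> {s<..<e} = {}" by auto
  then show ?case by (intro exI[of _ id]) auto
next
  case (stop_empty e s)
  have "CP \<inter> {s<..<e} = {}"
  proof (rule ccontr)
    assume "CP \<inter> {s<..<e} \<noteq> {}"
    then obtain \<eta> where h: "\<eta> \<in> CP" "s < \<eta>" "\<eta> < e" by auto
    then have "(sd \<eta>, ed \<eta>) \<in> Ocal n p Y gam Ms s e"
      using stop_empty(3)[OF h] det[OF h(1)] pos[OF h(1)] by (auto simp: Ocal_def)
    then show False using stop_empty by simp
  qed
  then show ?case by (intro exI[of _ id]) auto
next
  case (split e s sm em v B1 B2)
  note fin_O = finite_Ocal[OF fin, of n p Y gam s e]
  have O: "(sm, em) \<in> Ms" "s \<le> sm" "em \<le> e" "{sm<..<em} \<noteq> {}" "SmaxV n p Y gam sm em > 0"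
    using split.hyps(2) by (auto simp: Ocal_def)
  have lt: "sm + 1 < em" using split.hyps by linarith
  have short: "em - sm \<le> 2 * lh \<eta>" if "\<eta> \<in> CP" "s < \<eta>" "\<eta> < e" for \<eta>
  proof -
    have "(sd \<eta>, ed \<eta>) \<in> Ocal n p Y gam Ms s e"
      using split.prems[OF that] det[OF that(1)] pos[OF that(1)] by (auto simp: Ocal_def)
    then have "ed \<eta> - sd \<eta> \<in> (\<lambda>(a, b). b - a) ` Ocal n p Y gam Ms s e" by force
    then have "em - sm \<le> ed \<eta> - sd \<eta>"
      unfolding split.hyps(3) using fin_O by (intro Min_le) auto
    then show ?thesis using det[OF that(1)] by simp
  qed
  obtain \<eta> where \<eta>: "\<eta> \<in> CP" "sm < \<eta>" "\<eta> < em"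
    using null[OF O(1) lt] O(5) by force
  have \<eta>_s: "s < \<eta>" "\<eta> < e" using \<eta> O by auto
  \<comment> \<open>Two change points inside the chosen interval would be at most 2 l - 2 apart,
    where l is the half-length for \<eta>, whereas separation demands at least 4 l - 3. This is
    impossible for l >= 1.\<close>
  have other: "\<eta>' \<le> sm \<and> \<eta>' < \<eta> \<or> em \<le> \<eta>' \<and> \<eta> < \<eta>'" if "\<eta>' \<in> CP" "s < \<eta>'" "\<eta>' < e" "\<eta>' \<noteq> \<eta>" for \<eta>'
  proof (rule ccontr)
    assume "\<not> ?thesis"
    then have "sm < \<eta>'" "\<eta>' < em" using that \<eta> by auto
    then show False
    proof (cases "\<eta> < \<eta>'")
      case True
      then show False
        using sep[OF \<eta>(1) that(1) True] short[OF \<eta>(1) \<eta>_s] \<open>\<eta>' < em\<close> \<eta>(2) by linarith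
    next
      case False
      then have lt': "\<eta>' < \<eta>" using that(4) by simp
      then show False
        using sep[OF that(1) \<eta>(1) lt'] short[OF \<eta>(1) \<eta>_s] \<open>sm < \<eta>'\<close> \<eta>(3) by linarith
    qed
  qed
  \<comment> \<open>With l the half-length for \<eta>', the inequalities \<eta> < em <= sm + 2 l and
    \<eta>' + 4 l <= \<eta> + 3 give \<eta>' + 2 l <= sm + 2, while \<open>ed \<eta>'\<close> is at
    most \<eta>' + 2 l - 1. The overlap of one point in the recursion, \<open>sm + 1\<close>, is
    exactly what is needed; \<open>right\<close> is the mirror image.\<close>
  have left: "s \<le> sd \<eta>' \<and> ed \<eta>' \<le> sm + 1" if "\<eta>' \<in> CP" "s < \<eta>'" "\<eta>' < sm + 1" for \<eta>'
  proof -
    have lt': "\<eta>' < e" "\<eta>' < \<eta>" using that O(3) \<eta>(2) lt by linarith+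
    then show ?thesis
      using split.prems[OF that(1,2) lt'(1)] short[OF that(1,2) lt'(1)]
        sep[OF that(1) \<eta>(1) lt'(2)] det[OF that(1)] \<eta>(3) by linarith
  qed
  have right: "em - 1 \<le> sd \<eta>' \<and> ed \<eta>' \<le> e" if "\<eta>' \<in> CP" "em - 1 < \<eta>'" "\<eta>' < e" for \<eta>'
  proof -
    have lt': "s < \<eta>'" "\<eta> < \<eta>'" using that O(2) \<eta>(3) lt by linarith+
    then show ?thesis
      using split.prems[OF that(1) lt'(1) that(3)] short[OF that(1) lt'(1) that(3)]
        sep[OF \<eta>(1) that(1) lt'(2)] det[OF that(1)] \<eta>(2) by linarith
  qed
  obtain f1 where f1: "strict_mono_on (CP \<inter> {s<..<sm + 1}) f1" "B1 = f1 ` (CP \<inter> {s<..<sm + 1})"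
    "\<And>\<eta>. \<eta> \<in> CP \<inter> {s<..<sm + 1} \<Longrightarrow> s < f1 \<eta> \<and> f1 \<eta> < sm + 1 \<and> \<bar>int (f1 \<eta>) - int \<eta>\<bar> \<le> 2 * int (lh \<eta>) - 2"
    using split.IH(1)[OF left] by blast
  obtain f2 where f2: "strict_mono_on (CP \<inter> {em - 1<..<e}) f2" "B2 = f2 ` (CP \<inter> {em - 1<..<e})"
    "\<And>\<eta>. \<eta> \<in> CP \<inter> {em - 1<..<e} \<Longrightarrow> em - 1 < f2 \<eta> \<and> f2 \<eta> < e \<and> \<bar>int (f2 \<eta>) - int \<eta>\<bar> \<le> 2 * int (lh \<eta>) - 2"
    using split.IH(2)[OF right] by blast
  define f where "f \<equiv> \<lambda>x. if x \<le> sm then f1 x else if x < em then v else f2 x"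
  have parts: "CP \<inter> {s<..<e} = insert \<eta> (CP \<inter> {s<..<sm + 1} \<union> CP \<inter> {em - 1<..<e})"
  proof (intro equalityI subsetI)
    fix x assume "x \<in> CP \<inter> {s<..<e}"
    then show "x \<in> insert \<eta> (CP \<inter> {s<..<sm + 1} \<union> CP \<inter> {em - 1<..<e})"
      using other[of x] lt by (cases "x = \<eta>") auto
  next
    fix x assume "x \<in> insert \<eta> (CP \<inter> {s<..<sm + 1} \<union> CP \<inter> {em - 1<..<e})"
    then show "x \<in> CP \<inter> {s<..<e}"
      using \<eta> \<eta>_s O(2,3) lt by auto
  qed
  have fl: "f x = f1 x" if "x \<in> CP \<inter> {s<..<sm + 1}" for x using that by (auto simp: f_def)
  have fr: "f x = f2 x" if "x \<in> CP \<inter> {em - 1<..<e}" for x using that lt by (auto simp: f_def)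
  have fm: "f \<eta> = v" using \<eta> by (auto simp: f_def)
  show ?case
  proof (intro exI[of _ f] conjI ballI)
    show "insert v (B1 \<union> B2) = f ` (CP \<inter> {s<..<e})"
      unfolding parts image_insert image_Un f1(2) f2(2) fm
      by (intro arg_cong[where f = "insert v"] arg_cong2[where f = "(\<union>)"] image_cong refl)
         (simp_all only: fl fr)
    show "strict_mono_on (CP \<inter> {s<..<e}) f"
    proof (rule strict_mono_onI)
      fix x y assume xy: "x \<in> CP \<inter> {s<..<e}" "y \<in> CP \<inter> {s<..<e}" "x < y"
      have cases: "z \<in> CP \<inter> {s<..<sm + 1} \<or> z = \<eta> \<or> z \<in> CP \<inter> {em - 1<..<e}"
        if "z \<in> CP \<inter> {s<..<e}" for z
        using that unfolding parts by blast
      from cases[OF xy(1)] show "f x < f y"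
      proof (elim disjE)
        assume x: "x \<in> CP \<inter> {s<..<sm + 1}"
        from cases[OF xy(2)] show ?thesis
        proof (elim disjE)
          assume "y \<in> CP \<inter> {s<..<sm + 1}"
          then show ?thesis
            using strict_mono_onD[OF f1(1) x _ xy(3)] by (simp only: fl[OF x] fl)
        next
          assume "y = \<eta>"
          then show ?thesis using fl[OF x] f1(3)[OF x] fm split.hyps(5) by simp
        next
          assume "y \<in> CP \<inter> {em - 1<..<e}"
          then show ?thesis using fl[OF x] fr[of y] f1(3)[OF x] f2(3)[of y] lt by linarith
        qed
      next
        assume x: "x = \<eta>"
        from cases[OF xy(2)] show ?thesis
        proof (elim disjE)
          assume "y \<in> CP \<inter> {em - 1<..<e}"
          then show ?thesis unfolding x fm using fr[of y] f2(3)[of y] split.hyps(6) by linarith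
        qed (use x xy(3) \<eta>(2) in simp_all)
      next
        assume x: "x \<in> CP \<inter> {em - 1<..<e}"
        from cases[OF xy(2)] show ?thesis
        proof (elim disjE)
          assume "y \<in> CP \<inter> {em - 1<..<e}"
          then show ?thesis
            using strict_mono_onD[OF f2(1) x _ xy(3)] by (simp only: fr[OF x] fr)
        next
          assume "y = \<eta>"
          then have False using x xy(3) \<eta>(3) by auto
          then show ?thesis ..
        next
          assume "y \<in> CP \<inter> {s<..<sm + 1}"
          then have False using x xy(3) lt by auto
          then show ?thesis ..
        qed
      qed
    qed
  next
    fix x assume "x \<in> CP \<inter> {s<..<e}"
    then consider "x \<in> CP \<inter> {s<..<sm + 1}" | "x = \<eta>" | "x \<in> CP \<inter> {em - 1<..<e}"
      unfolding parts by blast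
    then have "s < f x \<and> f x < e \<and> \<bar>int (f x) - int x\<bar> \<le> 2 * int (lh x) - 2"
    proof cases
      case 1 then show ?thesis using fl[OF 1] f1(3)[OF 1] O(3) lt by linarith
    next
      case 2
      \<comment> \<open>Both \<open>v\<close> and \<eta> are interior points of an interval of
        length at most twice the half-length. The bound depends on nothing else and so is uniform in
        \<open>lam\<close>.\<close>
      then show ?thesis
        unfolding 2 fm using split.hyps(5,6) \<eta>(2,3) O(2,3) short[OF \<eta>(1) \<eta>_s] by linarith
    next
      case 3 then show ?thesis using fr[OF 3] f2(3)[OF 3] O(2) lt by linarith
    qed
    then show "s < f x" "f x < e" "\<bar>int (f x) - int x\<bar> \<le> 2 * int (lh x) - 2" by auto
  qed
qed

lemma sorted_list_of_set_image_strict_mono_on: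
  fixes f :: "nat \<Rightarrow> nat"
  assumes "finite A" "strict_mono_on A f"
  shows "sorted_list_of_set (f ` A) = map f (sorted_list_of_set A)"
proof (rule sorted_distinct_set_unique)
  have "sorted_wrt (<) (map f (sorted_list_of_set A))"
    unfolding sorted_wrt_map
    by (rule sorted_wrt_mono_rel[OF _ strict_sorted_list_of_set[of A]])
       (use assms in \<open>auto simp: strict_mono_on_def\<close>)
  then show "sorted (map f (sorted_list_of_set A))" "distinct (map f (sorted_list_of_set A))"
    by (auto simp: strict_sorted_iff)
qed (use assms in auto)

section \<open>Seeded intervals\<close>

lemma lseq_ge: "j \<le> lseq \<alpha> j"
proof (induction j)
  case (Suc j)
  then show ?case by (cases "j = 0") auto
qed simp

lemma lseq_pos: "0 < lseq \<alpha> j"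
  by (cases j) auto

text \<open>In the branch l + 1 the bound is l >= 1, in the other it is \<alpha> <= 2. Scales that
  at most double leave no gap between x and 2 x.\<close>

lemma lseq_Suc_le_double:
  assumes "\<alpha> \<le> 2"
  shows "lseq \<alpha> (Suc j) \<le> 2 * lseq \<alpha> j"
proof -
  have "\<lfloor>\<alpha> * real (lseq \<alpha> j)\<rfloor> \<le> \<lfloor>2 * real (lseq \<alpha> j)\<rfloor>"
    using assms by (intro floor_mono mult_right_mono) auto
  also have "\<dots> = int (2 * lseq \<alpha> j)"
    by (metis floor_of_nat of_nat_mult of_nat_numeral)
  finally show ?thesis using lseq_pos[of \<alpha> j] by (auto simp: nat_le_iff)
qed

lemma finite_scales: "finite {j. 1 \<le> j \<and> real (lseq \<alpha> j) \<le> real n / 2}"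
proof (rule finite_subset)
  show "{j. 1 \<le> j \<and> real (lseq \<alpha> j) \<le> real n / 2} \<subseteq> {..n}"
  proof safe
    fix j assume "real (lseq \<alpha> j) \<le> real n / 2"
    then show "j \<le> n" using lseq_ge[of j \<alpha>] by linarith
  qed
qed simp

lemma lseq_Hidx:
  assumes "1 \<le> j" "2 * lseq \<alpha> j \<le> n"
  shows "j \<le> Hidx \<alpha> n"
  unfolding Hidx_def
proof (rule Max_ge)
  show "finite {j. 1 \<le> j \<and> real (lseq \<alpha> j) \<le> real n / 2}" by (rule finite_scales)
qed (use assms in auto)

lemma Hidx_lseq:
  assumes "2 \<le> n" "j \<in> {1..Hidx \<alpha> n}"
  shows "2 * lseq \<alpha> j \<le> n"
proof -
  let ?A = "{j. 1 \<le> j \<and> real (lseq \<alpha> j) \<le> real n / 2}"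
  have "Hidx \<alpha> n \<in> ?A" unfolding Hidx_def
  proof (rule Max_in[OF finite_scales])
    have "1 \<in> ?A" using assms(1) by simp
    then show "?A \<noteq> {}" by blast
  qed
  then have le: "2 * lseq \<alpha> (Hidx \<alpha> n) \<le> n" by (simp add: field_simps)
  have "lseq \<alpha> i \<le> lseq \<alpha> (Suc i)" for i by auto
  then have "lseq \<alpha> j \<le> lseq \<alpha> (Hidx \<alpha> n)"
    by (rule lift_Suc_mono_le[of "lseq \<alpha>"]) (use assms(2) in simp)
  then show ?thesis using le by simp
qed

lemma sstep_pos: "0 < sstep K l"
  by (simp add: sstep_def)

lemma Mset_bounds:
  assumes "2 \<le> n" "(a, b) \<in> Mset \<alpha> K n"
  shows "a + 1 < b" "b \<le> n"
proof -
  from assms(2) obtain j where j: "j \<in> {1..Hidx \<alpha> n}" "(a, b) \<in> Iset n K (lseq \<alpha> j)"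
    by (auto simp: Mset_def)
  note le = Hidx_lseq[OF assms(1) j(1)]
  from j(2) consider "a = n - 2 * lseq \<alpha> j" "b = n"
    | i where "a = i * sstep K (lseq \<alpha> j)" "b = a + 2 * lseq \<alpha> j" "i \<le> (n - 2 * lseq \<alpha> j) div sstep K (lseq \<alpha> j)"
    by (auto simp: Iset_def)
  then show "a + 1 < b" "b \<le> n"
  proof (atomize(full), cases)
    case 1 then show "a + 1 < b \<and> b \<le> n" using le lseq_pos[of \<alpha> j] by linarith
  next
    case (2 i)
    have "a \<le> (n - 2 * lseq \<alpha> j) div sstep K (lseq \<alpha> j) * sstep K (lseq \<alpha> j)"
      using 2 by (simp add: mult_le_mono1)
    also have "\<dots> \<le> n - 2 * lseq \<alpha> j" by simp
    finally show "a + 1 < b \<and> b \<le> n" using 2 le lseq_pos[of \<alpha> j] by linarith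
  qed
qed

lemma finite_Mset: "2 \<le> n \<Longrightarrow> finite (Mset \<alpha> K n)"
proof (rule finite_subset)
  assume n: "2 \<le> n"
  show "Mset \<alpha> K n \<subseteq> {..n} \<times> {..n}"
    using Mset_bounds[OF n] by fastforce
qed simp

text \<open>The least scale reaching x works: its predecessor is below x. The exception is the first
  scale, which has no predecessor to compare with.\<close>

lemma exists_scale:
  fixes x :: real
  assumes "\<alpha> \<le> 2"
  obtains j where "1 \<le> j" "x \<le> lseq \<alpha> j" "lseq \<alpha> j = 1 \<or> lseq \<alpha> j < 2 * x"
proof -
  define j where "j = (LEAST j. 1 \<le> j \<and> x \<le> lseq \<alpha> j)"
  have "x \<le> lseq \<alpha> (nat \<lceil>x\<rceil> + 1)" using lseq_ge[of "nat \<lceil>x\<rceil> + 1" \<alpha>] by linarith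
  then have j: "1 \<le> j \<and> x \<le> lseq \<alpha> j"
    unfolding j_def using LeastI[of "\<lambda>j. 1 \<le> j \<and> x \<le> lseq \<alpha> j", OF conjI[OF le_add2]] by blast
  have "lseq \<alpha> j = 1 \<or> lseq \<alpha> j < 2 * x"
  proof (cases "j = 1")
    case False
    then obtain i where i: "j = Suc i" "1 \<le> i" using j by (cases j) auto
    then have "\<not> x \<le> lseq \<alpha> i" using not_less_Least[of i "\<lambda>j. 1 \<le> j \<and> x \<le> lseq \<alpha> j"] unfolding j_def[symmetric] by auto
    then show ?thesis using lseq_Suc_le_double[OF assms, of i] unfolding i(1) by linarith
  qed simp
  then show ?thesis using that j by blast
qed

text \<open>Take the last grid shift not beyond \<eta> - l. As K >= 2, the step is 1, with no
  rounding at all, or at most l / 2. So \<eta> keeps distance l from the left end and l / 2 from the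
  right end.\<close>

lemma exists_seeded_interval:
  assumes "2 \<le> K" "1 \<le> j" "lseq \<alpha> j \<le> \<eta>" "\<eta> + lseq \<alpha> j \<le> n"
  obtains s where "(s, s + 2 * lseq \<alpha> j) \<in> Mset \<alpha> K n"
    "s + lseq \<alpha> j \<le> \<eta>" "2 * \<eta> \<le> 2 * s + 3 * lseq \<alpha> j"
proof -
  define l where "l = lseq \<alpha> j"
  define d where "d = sstep K l"
  have l: "0 < l" and d: "0 < d" by (simp_all add: l_def d_def lseq_pos sstep_pos)
  have le: "l \<le> \<eta>" "\<eta> + l \<le> n" using assms by (simp_all add: l_def)
  define i where "i = (\<eta> - l) div d"
  have i: "i \<le> (n - 2 * l) div d" unfolding i_def using le by (intro div_le_mono) auto
  have j: "j \<in> {1..Hidx \<alpha> n}" using lseq_Hidx[OF assms(2)] le assms(2) by (simp add: l_def)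
  have mem: "(i * d, i * d + 2 * l) \<in> Mset \<alpha> K n"
    unfolding Mset_def using j i by (intro UN_I[OF j]) (auto simp: Iset_def l_def d_def)
  have up: "i * d \<le> \<eta> - l" by (simp add: i_def)
  have lo: "\<eta> - l < i * d + d" 
    using div_mult_mod_eq[of "\<eta> - l" d] mod_less_divisor[OF d, of "\<eta> - l"] unfolding i_def by linarith
  have "d = 1 \<or> 2 * d \<le> l"
  proof -
    have "real l / K \<le> real l / 2" using assms(1) by (intro divide_left_mono) auto
    then have "2 * nat \<lfloor>real l / K\<rfloor> \<le> l" by linarith
    then show ?thesis by (auto simp: d_def sstep_def max_def)
  qed
  then have "2 * \<eta> \<le> 2 * (i * d) + 3 * l" using up lo le l by auto
  with that mem up le show ?thesis by (auto simp: l_def)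
qed

section \<open>Measurability of success\<close>

text \<open>Success is defined through an inductive relation and has no explicit measurable form. It
  is enough that it is determined by the truth values of finitely many measurable predicates: it is
  then a finite union of their atoms.\<close>

lemma sets_Collect_finite_signature:
  assumes "finite X" "\<And>P. P \<in> X \<Longrightarrow> {w \<in> space M. P w} \<in> sets M"
    and S: "\<And>w w'. w \<in> space M \<Longrightarrow> w' \<in> space M \<Longrightarrow> (\<And>P. P \<in> X \<Longrightarrow> P w \<longleftrightarrow> P w') \<Longrightarrow> S w \<Longrightarrow> S w'"
  shows "{w \<in> space M. S w} \<in> sets M"
proof -
  let ?C = "{c \<in> Pow X. \<exists>w\<in>space M. S w \<and> {P \<in> X. P w} = c}"
  have "{w \<in> space M. S w} = (\<Union>c\<in>?C. {w \<in> space M. \<forall>P\<in>X. P w \<longleftrightarrow> P \<in> c})"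
  proof (intro equalityI subsetI)
    fix w assume "w \<in> {w \<in> space M. S w}"
    then show "w \<in> (\<Union>c\<in>?C. {w \<in> space M. \<forall>P\<in>X. P w \<longleftrightarrow> P \<in> c})"
      by (intro UN_I[of "{P \<in> X. P w}"]) auto
  next
    fix w assume "w \<in> (\<Union>c\<in>?C. {w \<in> space M. \<forall>P\<in>X. P w \<longleftrightarrow> P \<in> c})"
    then obtain c where c: "c \<in> ?C" "w \<in> space M" "\<forall>P\<in>X. P w \<longleftrightarrow> P \<in> c" by (rule UN_E) simp
    from c(1) obtain w' where w': "w' \<in> space M" "S w'" "{P \<in> X. P w'} = c" by (simp, elim conjE bexE)
    have "S w" by (rule S[OF w'(1) c(2) _ w'(2)]) (use c(3) w'(3) in force)
    then show "w \<in> {w \<in> space M. S w}" using c(2) by simp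
  qed
  moreover have "{w \<in> space M. \<forall>P\<in>X. P w \<longleftrightarrow> P \<in> c} \<in> sets M" for c
  proof (rule sets.sets_Collect_finite_All[OF _ assms(1)])
    fix P assume "P \<in> X"
    then have "{w \<in> space M. P w} \<in> sets M" by (rule assms(2))
    then show "{w \<in> space M. P w \<longleftrightarrow> P \<in> c} \<in> sets M"
      by (cases "P \<in> c") (auto intro: sets.sets_Collect_neg)
  qed
  ultimately show ?thesis using assms(1) by (auto intro!: sets.finite_UN)
qed

text \<open>The procedure sees the data only through the signs of the detection statistics and
  through pairwise comparisons between maxima; these are the predicates in the finite
  signature.\<close>

lemma esac_cong:
  assumes "esac n p Y gam lam Ms s e B"
    and O: "\<And>a b. (a, b) \<in> Ms \<Longrightarrow> SmaxV n p Y gam a b > 0 \<longleftrightarrow> SmaxV n p Y' gam a b > 0"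
    and V: "\<And>a b a' b'. (a, b) \<in> Ms \<Longrightarrow> (a', b') \<in> Ms \<Longrightarrow>
      SmaxV n p Y lam a b \<le> SmaxV n p Y lam a' b' \<longleftrightarrow> SmaxV n p Y' lam a b \<le> SmaxV n p Y' lam a' b'"
    and S: "\<And>a b v v'. (a, b) \<in> Ms \<Longrightarrow> v \<in> {a<..<b} \<Longrightarrow> v' \<in> {a<..<b} \<Longrightarrow>
      Smax n p Y lam a b v' \<le> Smax n p Y lam a b v \<longleftrightarrow> Smax n p Y' lam a b v' \<le> Smax n p Y' lam a b v"
  shows "esac n p Y' gam lam Ms s e B"
  using assms(1)
proof (induction rule: esac.induct)
  case (stop_short e s)
  then show ?case by (rule esac.stop_short)
next
  case (stop_empty e s)
  have "Ocal n p Y gam Ms s e = Ocal n p Y' gam Ms s e" unfolding Ocal_def using O by blast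
  then show ?case using stop_empty by (intro esac.stop_empty) auto
next
  case (split e s sm em v B1 B2)
  have eq: "Ocal n p Y gam Ms s e = Ocal n p Y' gam Ms s e" unfolding Ocal_def using O by blast
  have Ms: "(a, b) \<in> Ms" if "(a, b) \<in> Ocal n p Y gam Ms s e" for a b
    using that by (auto simp: Ocal_def)
  show ?case
  proof (rule esac.split[OF split.hyps(1) _ _ _ split.hyps(5,6) _ split.IH])
    show "(sm, em) \<in> Ocal n p Y' gam Ms s e" "em - sm = Min ((\<lambda>(a, b). b - a) ` Ocal n p Y' gam Ms s e)"
      using split.hyps(2,3) unfolding eq by auto
    show "\<forall>(a, b)\<in>Ocal n p Y' gam Ms s e. b - a = em - sm \<longrightarrow> SmaxV n p Y' lam a b \<le> SmaxV n p Y' lam sm em"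
      using split.hyps(4) V[OF Ms Ms[OF split.hyps(2)]] unfolding eq[symmetric] by blast
    show "\<forall>v'. sm < v' \<and> v' < em \<longrightarrow> Smax n p Y' lam sm em v' \<le> Smax n p Y' lam sm em v"
      using split.hyps(5-7) S[OF Ms[OF split.hyps(2)]] by auto
  qed
qed

section \<open>Statistics of the observations: mean plus noise\<close>

lemma Sstat_eq_thresh:
  "Sstat n p Y g s e v t = (\<Sum>i<p. thresh (athr n p t) (cusum (Y i) s e v)) - g t"
  by (simp add: Sstat_def thresh_def)

lemma cusum_observation:
  assumes "s < v" "v < e"
  shows "cusum (\<lambda>t. (mu i t + W (i, t)) / \<sigma>) s e v = cusum (\<lambda>t. mu i t / \<sigma>) s e v + noise_cusum \<sigma> s e v i W"
  unfolding noise_cusum_def cusum_eq_sum[OF assms]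
  by (simp add: add_divide_distrib distrib_left sum.distrib)

text \<open>For distinct values this is the signal of a single jump located at the split; for a = b
  it shows that the CUSUM ignores a constant mean.\<close>

lemma cusum_step:
  fixes y :: "nat \<Rightarrow> real"
  assumes "s < v" "v < e"
    and "\<And>t. t \<in> {s<..v} \<Longrightarrow> y t = a" "\<And>t. t \<in> {v<..e} \<Longrightarrow> y t = b"
  shows "cusum y s e v = sqrt ((real e - real v) * (real v - real s) / (real e - real s)) * (a - b)"
proof -
  have sq: "sqrt (x / (z * w)) * w = sqrt (x * w / z)" if "0 < w" "0 < z" for x z w :: real
  proof -
    have "sqrt (x / (z * w)) * w = sqrt (x / (z * w)) * sqrt (w\<^sup>2)" using that by simp
    also have "\<dots> = sqrt (x / (z * w) * w\<^sup>2)" by (rule real_sqrt_mult[symmetric])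
    also have "x / (z * w) * w\<^sup>2 = x * w / z" using that by (simp add: power2_eq_square)
    finally show ?thesis .
  qed
  have "(\<Sum>t\<in>{s<..v}. y t) = (real v - real s) * a" "(\<Sum>t\<in>{v<..e}. y t) = (real e - real v) * b"
    using assms by (simp_all add: of_nat_diff)
  then have "cusum y s e v
    = (sqrt ((real e - real v) / ((real e - real s) * (real v - real s))) * (real v - real s)) * a
    - (sqrt ((real v - real s) / ((real e - real s) * (real e - real v))) * (real e - real v)) * b"
    by (simp add: cusum_def)
  also have "\<dots> = sqrt ((real e - real v) * (real v - real s) / (real e - real s)) * a
    - sqrt ((real e - real v) * (real v - real s) / (real e - real s)) * b"
  proof -
    have "sqrt ((real e - real v) / ((real e - real s) * (real v - real s))) * (real v - real s)
        = sqrt ((real e - real v) * (real v - real s) / (real e - real s))"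
      by (rule sq) (use assms(1,2) in auto)
    moreover have "sqrt ((real v - real s) / ((real e - real s) * (real e - real v))) * (real e - real v)
        = sqrt ((real v - real s) * (real e - real v) / (real e - real s))"
      by (rule sq) (use assms(1,2) in auto)
    ultimately show ?thesis by (simp only: mult.commute[of "real v - real s" "real e - real v"])
  qed
  finally show ?thesis by (simp add: right_diff_distrib)
qed

lemma Tset_nonempty: "Tset n p \<noteq> {}"
  by (auto simp: Tset_def)

text \<open>The assumption \<open>a + 1 < b\<close> guarantees a split point: the value of
  \<open>Max\<close> on the empty set is unspecified.\<close>

lemma SmaxV_le_0:
  assumes "a + 1 < b" "\<And>v t. v \<in> {a<..<b} \<Longrightarrow> t \<in> Tset n p \<Longrightarrow> Sstat n p Y g a b v t \<le> 0"
  shows "SmaxV n p Y g a b \<le> 0"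
proof -
  have "a + 1 \<in> {a<..<b}" using assms(1) by simp
  then have "{a<..<b} \<noteq> {}" by blast
  then show ?thesis
    unfolding SmaxV_def Smax_def using assms(2) finite_Tset Tset_nonempty by (subst Max_le_iff) auto
qed

lemma SmaxV_gt_0:
  assumes "v \<in> {a<..<b}" "t \<in> Tset n p" "0 < Sstat n p Y g a b v t"
  shows "0 < SmaxV n p Y g a b"
proof -
  have "0 < Smax n p Y g a b v"
    unfolding Smax_def using assms finite_Tset Tset_nonempty by (subst Max_gr_iff) auto
  then show ?thesis unfolding SmaxV_def using assms(1) by (subst Max_gr_iff) auto
qed

section \<open>Change points\<close>

lemma finite_cps: "finite (cps n p mu)"
  by (rule finite_subset[of _ "{..<n}"]) (auto simp: cps_def)

lemma card_cps_le: "card (cps n p mu) \<le> n"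
  using card_mono[of "{..<n}" "cps n p mu"] by (auto simp: cps_def)

lemma cpeta_nth: "1 \<le> j \<Longrightarrow> j \<le> cpJ n p mu \<Longrightarrow> cpeta n p mu j = sorted_list_of_set (cps n p mu) ! (j - 1)"
  by (simp add: cpeta_def)

lemma cpeta_in_cps: "j \<in> {1..cpJ n p mu} \<Longrightarrow> cpeta n p mu j \<in> cps n p mu"
proof -
  assume j: "j \<in> {1..cpJ n p mu}"
  then have "j - 1 < length (sorted_list_of_set (cps n p mu))" by (auto simp: cpJ_def)
  then have "sorted_list_of_set (cps n p mu) ! (j - 1) \<in> set (sorted_list_of_set (cps n p mu))"
    by (rule nth_mem)
  then show ?thesis using j finite_cps by (simp add: cpeta_nth)
qed

lemma cps_obtain_index:
  assumes "\<eta> \<in> cps n p mu"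
  obtains j where "j \<in> {1..cpJ n p mu}" "cpeta n p mu j = \<eta>"
proof -
  have "\<eta> \<in> set (sorted_list_of_set (cps n p mu))" using assms finite_cps by simp
  then obtain i where i: "i < length (sorted_list_of_set (cps n p mu))" "sorted_list_of_set (cps n p mu) ! i = \<eta>"
    unfolding in_set_conv_nth by blast
  show ?thesis
  proof
    show "Suc i \<in> {1..cpJ n p mu}" using i by (simp add: cpJ_def)
    then show "cpeta n p mu (Suc i) = \<eta>" using i by (simp add: cpeta_nth)
  qed
qed

lemma cpeta_Suc:
  assumes "j \<le> cpJ n p mu" "1 \<le> n"
  shows "cpeta n p mu j < cpeta n p mu (Suc j)"
proof -
  have len: "length (sorted_list_of_set (cps n p mu)) = cpJ n p mu" by (simp add: cpJ_def)
  have rng: "0 < cpeta n p mu i \<and> cpeta n p mu i < n" if "i \<in> {1..cpJ n p mu}" for i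
    using cpeta_in_cps[OF that] by (auto simp: cps_def)
  consider "j = 0" "cpJ n p mu = 0" | "j = 0" "1 \<le> cpJ n p mu" | "1 \<le> j" "j = cpJ n p mu" | "1 \<le> j" "Suc j \<le> cpJ n p mu"
    using assms by linarith
  then show ?thesis
  proof cases
    case 1 then show ?thesis using assms by (simp add: cpeta_def)
  next
    case 2
    then have "cpeta n p mu j = 0" by (simp add: cpeta_def)
    then show ?thesis using rng[of "Suc j"] 2 by auto
  next
    case 3
    then have "cpeta n p mu (Suc j) = n" by (simp add: cpeta_def)
    moreover have "cpeta n p mu j < n" using rng[of j] 3 by auto
    ultimately show ?thesis by linarith
  next
    case 4
    then show ?thesis
      using sorted_wrt_nth_less[OF strict_sorted_list_of_set[of "cps n p mu"], of "j - 1" j] len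
      by (simp add: cpeta_nth)
  qed
qed

lemma cpeta_pred:
  assumes "j \<in> {1..cpJ n p mu}" "1 \<le> n"
  shows "cpeta n p mu (j - 1) < cpeta n p mu j"
  using assms cpeta_Suc[of "j - 1" n p mu] by (cases j) auto

lemma cpeta_mono:
  assumes "i \<le> j" "j \<le> Suc (cpJ n p mu)" "1 \<le> n"
  shows "cpeta n p mu i \<le> cpeta n p mu j"
  using assms(1,2)
proof (induction j rule: dec_induct)
  case (step j)
  then show ?case using cpeta_Suc[of j n p mu] assms(3) by simp
qed simp

text \<open>The indices 0 and J + 1 are included, so the same statement gives the distance to other
  change points and to both ends of the data. Strict monotonicity of \<open>cpeta\<close> is needed
  because \<open>Delta\<close> is built from truncated subtraction.\<close>

lemma Delta_separates:
  assumes j: "j \<in> {1..cpJ n p mu}" and i: "i \<le> Suc (cpJ n p mu)" "i \<noteq> j" and n: "1 \<le> n"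
  shows "cpeta n p mu i + Delta n p mu j \<le> cpeta n p mu j \<or> cpeta n p mu j + Delta n p mu j \<le> cpeta n p mu i"
proof (cases "i < j")
  case True
  have "cpeta n p mu i \<le> cpeta n p mu (j - 1)" using True j by (intro cpeta_mono n) auto
  moreover have "cpeta n p mu (j - 1) < cpeta n p mu j" by (rule cpeta_pred[OF j n])
  moreover have "Delta n p mu j \<le> cpeta n p mu j - cpeta n p mu (j - 1)" by (simp add: Delta_def)
  ultimately show ?thesis by linarith
next
  case False
  have "cpeta n p mu (j + 1) \<le> cpeta n p mu i" using False i j by (intro cpeta_mono n) auto
  moreover have "cpeta n p mu j < cpeta n p mu (j + 1)" using cpeta_Suc[of j n p mu] j n by simp
  moreover have "Delta n p mu j \<le> cpeta n p mu (j + 1) - cpeta n p mu j" by (simp add: Delta_def)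
  ultimately show ?thesis by linarith
qed

lemma Delta_pos: "j \<in> {1..cpJ n p mu} \<Longrightarrow> 1 \<le> n \<Longrightarrow> 1 \<le> Delta n p mu j"
  using cpeta_pred[of j n p mu] cpeta_Suc[of j n p mu] by (simp add: Delta_def Suc_le_eq)

text \<open>A change point at v concerns the pair v, v + 1. Those at the end points a and b
  therefore do not disturb the columns a + 1, ..., b.\<close>

lemma mean_constant:
  assumes "{a<..<b} \<inter> cps n p mu = {}" "b \<le> n" "i < p" "t \<in> {a<..b}"
  shows "mu i t = mu i (Suc a)"
proof -
  have const: "t \<le> b \<longrightarrow> mu i t = mu i (Suc a)" if "Suc a \<le> t" for t
    using that
  proof (induction t rule: dec_induct)
    case (step t)
    have "mu i t = mu i (Suc t)" if "Suc t \<le> b"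
    proof (rule ccontr)
      assume "mu i t \<noteq> mu i (Suc t)"
      then have "t \<in> cps n p mu" using step that assms(2,3) by (auto simp: cps_def)
      moreover have "t \<in> {a<..<b}" using step(1) that by simp
      ultimately show False using assms(1) by blast
    qed
    then show ?case using step.IH by (metis Suc_leD)
  qed simp
  show ?thesis using const[of t] assms(4) by auto
qed

lemma phi_kspar_facts:
  assumes "j \<in> {1..cpJ n p mu}"
  shows "0 < (phi n p mu j)\<^sup>2" "(phi n p mu j)\<^sup>2 = (\<Sum>i<p. (theta n p mu j i)\<^sup>2)" "1 \<le> kspar n p mu j"
    "kspar n p mu j \<le> p"
proof -
  obtain i where i: "i < p" "theta n p mu j i \<noteq> 0"
    using cpeta_in_cps[OF assms] by (auto simp: cps_def theta_def)
  show eq: "(phi n p mu j)\<^sup>2 = (\<Sum>i<p. (theta n p mu j i)\<^sup>2)"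
    by (simp add: phi_def sum_nonneg)
  have "0 < (theta n p mu j i)\<^sup>2" using i by simp
  also have "\<dots> \<le> (\<Sum>i<p. (theta n p mu j i)\<^sup>2)" using i by (intro member_le_sum) auto
  finally show "0 < (phi n p mu j)\<^sup>2" using eq by simp
  have "card {i} \<le> kspar n p mu j" unfolding kspar_def using i by (intro card_mono) auto
  then show "1 \<le> kspar n p mu j" by simp
  have "kspar n p mu j \<le> card {..<p}" unfolding kspar_def by (intro card_mono) auto
  then show "kspar n p mu j \<le> p" by simp
qed

section \<open>The good event\<close>

locale change_point_model =
  fixes n p :: nat and \<sigma> :: real and mu :: "nat \<Rightarrow> nat \<Rightarrow> real" and lam :: "nat \<Rightarrow> real" and \<alpha> K :: real
  assumes n: "2 \<le> n" and p: "1 \<le> p" and \<sigma>: "0 < \<sigma>" and \<alpha>: "\<alpha> \<le> 2" and K: "2 \<le> K"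
    and snr: "\<And>j. j \<in> {1..cpJ n p mu} \<Longrightarrow>
      64000 * rfun n p (real (kspar n p mu j)) \<le> (phi n p mu j)\<^sup>2 * real (Delta n p mu j) / \<sigma>\<^sup>2"
begin

abbreviation "CP \<equiv> cps n p mu"
abbreviation "Ms \<equiv> Mset \<alpha> K n"
abbreviation "M \<equiv> gauss_noise p n \<sigma>"
abbreviation "gam \<equiv> (\<lambda>t. 176 * rfun n p (real t))"
abbreviation "obs W \<equiv> (\<lambda>i t. (mu i t + W (i, t)) / \<sigma>)"
abbreviation "mean s e v i \<equiv> cusum (\<lambda>t. mu i t / \<sigma>) s e v"

lemma n1: "1 \<le> n" using n by simp

lemma Sstat_obs:
  assumes "s < v" "v < e"
  shows "Sstat n p (obs W) g s e v t = (\<Sum>i<p. thresh (athr n p t) (mean s e v i + noise_cusum \<sigma> s e v i W)) - g t"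
  unfolding Sstat_eq_thresh cusum_observation[OF assms] ..

lemma measurable_Smax:
  assumes "s < v" "v < e" "e \<le> n"
  shows "(\<lambda>W. Smax n p (obs W) g s e v) \<in> borel_measurable M"
  unfolding Smax_def
  by (intro borel_measurable_Max finite_Tset)
     (unfold Sstat_obs[OF assms(1,2)], intro borel_measurable_diff measurable_sum_thresh[OF n p \<sigma> assms] borel_measurable_const)

lemma measurable_SmaxV:
  assumes "e \<le> n"
  shows "(\<lambda>W. SmaxV n p (obs W) g s e) \<in> borel_measurable M"
  unfolding SmaxV_def by (intro borel_measurable_Max measurable_Smax) (use assms in auto)

lemma esac_success_sets: "{W \<in> space M. esac_success n p \<sigma> mu 176 lam \<alpha> K C W} \<in> sets M"
proof -
  \<comment> \<open>One family for each kind of question asked by the recursion: detection of an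
    interval, comparison of two intervals, comparison of two splits in one interval.\<close>
  define X1 where "X1 = (\<Union>I\<in>Ms. {\<lambda>W. 0 < SmaxV n p (obs W) gam (fst I) (snd I)})"
  define X2 where "X2 = (\<Union>I\<in>Ms. \<Union>I'\<in>Ms.
      {\<lambda>W. SmaxV n p (obs W) lam (fst I) (snd I) \<le> SmaxV n p (obs W) lam (fst I') (snd I')})"
  define X3 where "X3 = (\<Union>I\<in>Ms. \<Union>v\<in>{fst I<..<snd I}. \<Union>v'\<in>{fst I<..<snd I}.
      {\<lambda>W. Smax n p (obs W) lam (fst I) (snd I) v' \<le> Smax n p (obs W) lam (fst I) (snd I) v})"
  have Ms: "snd I \<le> n" if "I \<in> Ms" for I
    using Mset_bounds(2)[OF n, of "fst I" "snd I"] that by simp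
  show ?thesis
  proof (rule sets_Collect_finite_signature[where X = "X1 \<union> X2 \<union> X3"])
    show "finite (X1 \<union> X2 \<union> X3)"
      unfolding X1_def X2_def X3_def
      by (intro finite_UnI finite_UN_I finite_Mset n) simp_all
    fix P assume "P \<in> X1 \<union> X2 \<union> X3"
    then show "{W \<in> space M. P W} \<in> sets M"
    proof (elim UnE)
      assume "P \<in> X1"
      then obtain I where I: "I \<in> Ms" "P = (\<lambda>W. 0 < SmaxV n p (obs W) gam (fst I) (snd I))"
        unfolding X1_def by (elim UN_E singletonE)
      show ?thesis unfolding I(2)
        by (intro borel_measurable_less borel_measurable_const measurable_SmaxV Ms I)
    next
      assume "P \<in> X2"
      then obtain I I' where I: "I \<in> Ms" "I' \<in> Ms"
          "P = (\<lambda>W. SmaxV n p (obs W) lam (fst I) (snd I) \<le> SmaxV n p (obs W) lam (fst I') (snd I'))"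
        unfolding X2_def by (elim UN_E singletonE)
      show ?thesis unfolding I(3)
        by (intro borel_measurable_le measurable_SmaxV Ms I)
    next
      assume "P \<in> X3"
      then obtain I v v' where I: "I \<in> Ms" "v \<in> {fst I<..<snd I}" "v' \<in> {fst I<..<snd I}"
          "P = (\<lambda>W. Smax n p (obs W) lam (fst I) (snd I) v' \<le> Smax n p (obs W) lam (fst I) (snd I) v)"
        unfolding X3_def by (elim UN_E singletonE)
      show ?thesis unfolding I(4)
        by (intro borel_measurable_le measurable_Smax Ms I(1)) (use I(2,3) in simp_all)
    qed
  next
    fix W W' assume same: "\<And>P. P \<in> X1 \<union> X2 \<union> X3 \<Longrightarrow> P W \<longleftrightarrow> P W'"
      and suc: "esac_success n p \<sigma> mu 176 lam \<alpha> K C W"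
    have s1: "0 < SmaxV n p (obs W) gam a b \<longleftrightarrow> 0 < SmaxV n p (obs W') gam a b" if "(a, b) \<in> Ms" for a b
    proof (rule same[OF UnI1[OF UnI1]])
      show "(\<lambda>W. 0 < SmaxV n p (obs W) gam a b) \<in> X1"
        unfolding X1_def by (rule UN_I[OF that]) simp
    qed
    have s2: "SmaxV n p (obs W) lam a b \<le> SmaxV n p (obs W) lam a' b' \<longleftrightarrow> SmaxV n p (obs W') lam a b \<le> SmaxV n p (obs W') lam a' b'"
      if "(a, b) \<in> Ms" "(a', b') \<in> Ms" for a b a' b'
    proof (rule same[OF UnI1[OF UnI2]])
      show "(\<lambda>W. SmaxV n p (obs W) lam a b \<le> SmaxV n p (obs W) lam a' b') \<in> X2"
        unfolding X2_def by (rule UN_I[OF that(1)], rule UN_I[OF that(2)]) simp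
    qed
    have s3: "Smax n p (obs W) lam a b v' \<le> Smax n p (obs W) lam a b v \<longleftrightarrow> Smax n p (obs W') lam a b v' \<le> Smax n p (obs W') lam a b v"
      if "(a, b) \<in> Ms" "v \<in> {a<..<b}" "v' \<in> {a<..<b}" for a b v v'
    proof (rule same[OF UnI2])
      show "(\<lambda>W. Smax n p (obs W) lam a b v' \<le> Smax n p (obs W) lam a b v) \<in> X3"
        unfolding X3_def by (rule UN_I[OF that(1)], rule UN_I[of v], use that(2) in simp, rule UN_I[of v'], use that(3) in simp) simp
    qed
    have "esac n p (obs W) gam lam Ms 0 n = esac n p (obs W') gam lam Ms 0 n"
    proof (intro ext iffI)
      fix B
      assume "esac n p (obs W) gam lam Ms 0 n B"
      then show "esac n p (obs W') gam lam Ms 0 n B" by (rule esac_cong) (rule s1 s2 s3; assumption)+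
    next
      fix B
      assume "esac n p (obs W') gam lam Ms 0 n B"
      then show "esac n p (obs W) gam lam Ms 0 n B" by (rule esac_cong) (rule s1[symmetric] s2[symmetric] s3[symmetric]; assumption)+
    qed
    then show "esac_success n p \<sigma> mu 176 lam \<alpha> K C W'"
      using suc unfolding esac_success_def Let_def by simp
  qed
qed

lemma exists_certificate:
  assumes j: "j \<in> {1..cpJ n p mu}" and \<eta>: "\<eta> = cpeta n p mu j"
  shows "\<exists>s l. (s, s + 2 * l) \<in> Ms \<and> s < \<eta> \<and> \<eta> < s + 2 * l \<and> 4 * l \<le> Delta n p mu j + 3 \<and>
    2 * real l - 2 \<le> 32000 * \<sigma>\<^sup>2 / (phi n p mu j)\<^sup>2 * rfun n p (real (kspar n p mu j)) \<and>
    (\<exists>t\<in>Tset n p. measure M {W \<in> space M. Sstat n p (obs W) gam s (s + 2 * l) \<eta> t \<le> 0} \<le> exp (- 4 * ln (real n)))"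
proof -
  define k where "k = kspar n p mu j"
  define r where "r = rfun n p (real k)"
  define f where "f = (phi n p mu j)\<^sup>2"
  \<comment> \<open>A half-length of at least x suffices: it gives signal energy x f / (4
    \<sigma>^2) = 2000 r. The signal condition says 8 x <= \<Delta>, which leaves room for the
    factor 2 lost in the choice of the scale.\<close>
  define x where "x = 8000 * r * \<sigma>\<^sup>2 / f"
  note ph = phi_kspar_facts[OF j, folded k_def f_def]
  have r: "0 < r" unfolding r_def using rfun_ge_ln[OF n ph(3,4)] ln_nat_ge_half[OF n] by linarith
  have \<sigma>2: "0 < \<sigma>\<^sup>2" using \<sigma> by simp
  have x0: "0 < x" using r ph \<sigma>2 by (simp add: x_def)
  have \<Delta>x: "8 * x \<le> real (Delta n p mu j)"
    using snr[OF j, folded k_def f_def r_def] ph(1) \<sigma>2 by (simp add: x_def field_simps)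
  obtain i where i: "1 \<le> i" "x \<le> lseq \<alpha> i" "lseq \<alpha> i = 1 \<or> lseq \<alpha> i < 2 * x"
    using exists_scale[OF \<alpha>] by blast
  \<comment> \<open>For l = 1 the bound on 4 l holds because \<Delta> >= 1, and the error bound is
    0; every other l is below 2 x.\<close>
  define l where "l = lseq \<alpha> i"
  have l0: "1 \<le> l" using lseq_pos[of \<alpha> i] by (simp add: l_def)
  have l4: "4 * l \<le> Delta n p mu j + 3"
  proof (cases "l = 1")
    case True then show ?thesis using Delta_pos[OF j n1] by simp
  next
    case False
    then have "real l < 2 * x" using i(3) by (simp add: l_def)
    then have "4 * real l < real (Delta n p mu j)" using \<Delta>x by linarith
    then show ?thesis by linarith
  qed
  have bnd: "\<eta> \<ge> Delta n p mu j" "\<eta> + Delta n p mu j \<le> n"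
  proof -
    have \<eta>_n: "\<eta> < n" using cpeta_in_cps[OF j] by (simp add: \<eta> cps_def)
    show "\<eta> \<ge> Delta n p mu j" using Delta_separates[OF j, of 0] Delta_pos[OF j n1] n1 j \<eta> by (auto simp: cpeta_def[of _ _ _ 0])
    have "cpeta n p mu (Suc (cpJ n p mu)) = n" by (simp add: cpeta_def)
    then show "\<eta> + Delta n p mu j \<le> n"
      using Delta_separates[OF j, of "Suc (cpJ n p mu)"] n1 j \<eta> \<eta>_n by auto
  qed
  have l_\<Delta>: "l \<le> Delta n p mu j" using l4 l0 by linarith
  obtain s where s: "(s, s + 2 * l) \<in> Ms" "s + l \<le> \<eta>" "2 * \<eta> \<le> 2 * s + 3 * l"
    using exists_seeded_interval[OF K i(1), of \<alpha> \<eta> n] l_\<Delta> bnd unfolding l_def by force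
  define e where "e = s + 2 * l"
  have se: "s < \<eta>" "\<eta> < e" "e \<le> n" using s l0 Mset_bounds(2)[OF n s(1)] by (auto simp: e_def)
  \<comment> \<open>The ends of the interval are within 3 l / 2 of \<eta>, while other change points
    are at distance at least \<Delta> >= 4 l - 3.\<close>
  have far: "\<eta>' = \<eta>" if h: "\<eta>' \<in> CP" "s < \<eta>'" "\<eta>' < e" for \<eta>'
  proof (rule ccontr)
    assume ne: "\<eta>' \<noteq> \<eta>"
    obtain j' where j': "j' \<in> {1..cpJ n p mu}" "cpeta n p mu j' = \<eta>'" by (rule cps_obtain_index[OF h(1)])
    then have "\<eta>' + Delta n p mu j \<le> \<eta> \<or> \<eta> + Delta n p mu j \<le> \<eta>'"
      using Delta_separates[OF j _ _ n1, of j'] ne \<eta> by auto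
    then show False using h l4 s l0 by (auto simp: e_def)
  qed
  define q where "q = (real e - real \<eta>) * (real \<eta> - real s) / (real e - real s)"
  have mean: "mean s e \<eta> i = sqrt q * (- theta n p mu j i / \<sigma>)" if "i < p" for i
  proof -
    have "mean s e \<eta> i = sqrt q * (mu i \<eta> / \<sigma> - mu i (Suc \<eta>) / \<sigma>)"
      unfolding q_def
    proof (rule cusum_step[OF se(1,2)])
      have left: "{s<..<\<eta>} \<inter> CP = {}" and right: "{\<eta><..<e} \<inter> CP = {}" using far se by force+
      fix t
      show "mu i t / \<sigma> = mu i \<eta> / \<sigma>" if "t \<in> {s<..\<eta>}"
        using mean_constant[OF left _ \<open>i < p\<close>, of t] mean_constant[OF left _ \<open>i < p\<close>, of \<eta>] that se by simp
      show "mu i t / \<sigma> = mu i (Suc \<eta>) / \<sigma>" if "t \<in> {\<eta><..e}"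
        using mean_constant[OF right _ \<open>i < p\<close> that] se by simp
    qed
    also have "mu i \<eta> / \<sigma> - mu i (Suc \<eta>) / \<sigma> = - theta n p mu j i / \<sigma>"
      by (simp add: theta_def \<eta> diff_divide_distrib)
    finally show ?thesis .
  qed
  \<comment> \<open>The two distances are at least l / 2 and l, and the length is 2 l.\<close>
  have q: "real l / 4 \<le> q"
  proof -
    have "real l / 2 * real l \<le> (real e - real \<eta>) * (real \<eta> - real s)"
      using s by (intro mult_mono) (auto simp: e_def)
    then have "real l / 2 * real l / (real e - real s) \<le> q"
      unfolding q_def using l0 by (intro divide_right_mono) (auto simp: e_def)
    then show ?thesis using l0 by (simp add: e_def)
  qed
  have q0: "0 < q" using q l0 by linarith
  \<comment> \<open>As q > 0, the mean CUSUM at the change point vanishes exactly on the rows that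
    do not jump, so its sparsity is that of the jump.\<close>
  have k_eq: "k = card {i. i < p \<and> mean s e \<eta> i \<noteq> 0}"
  proof -
    have "{i. i < p \<and> mean s e \<eta> i \<noteq> 0} = {i. i < p \<and> theta n p mu j i \<noteq> 0}"
      using mean q0 \<sigma> by auto
    then show ?thesis by (simp add: k_def kspar_def)
  qed
  have "2000 * r = x / 4 * (f / \<sigma>\<^sup>2)" using ph(1) \<sigma>2 by (simp add: x_def)
  also have "\<dots> \<le> q * (f / \<sigma>\<^sup>2)" using q i(2) ph(1) \<sigma>2 by (intro mult_right_mono) (auto simp: l_def)
  also have "\<dots> = (\<Sum>i<p. (mean s e \<eta> i)\<^sup>2)"
  proof -
    have "(\<Sum>i<p. (mean s e \<eta> i)\<^sup>2) = (\<Sum>i<p. q / \<sigma>\<^sup>2 * (theta n p mu j i)\<^sup>2)"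
      using q0 by (intro sum.cong) (auto simp: mean power_mult_distrib power_divide)
    also have "\<dots> = q / \<sigma>\<^sup>2 * f" by (simp add: ph(2) sum_distrib_left)
    finally show ?thesis by simp
  qed
  finally obtain t where t: "t \<in> Tset n p" "measure M {W \<in> space M.
      (\<Sum>i<p. thresh (athr n p t) (mean s e \<eta> i + noise_cusum \<sigma> s e \<eta> i W)) \<le> 176 * rfun n p (real t)}
    \<le> exp (- 4 * ln (real n))"
    using detection_tail[OF n p \<sigma> se k_eq ph(3)] unfolding r_def by blast
  have err: "2 * real l - 2 \<le> 32000 * \<sigma>\<^sup>2 / f * r"
  proof -
    have "2 * real l - 2 \<le> 4 * x"
      using i(3) x0 by (auto simp: l_def)
    then show ?thesis by (simp add: x_def mult_ac)
  qed
  have "\<exists>t\<in>Tset n p. measure M {W \<in> space M. Sstat n p (obs W) gam s e \<eta> t \<le> 0} \<le> exp (- 4 * ln (real n))"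
    using t unfolding Sstat_obs[OF se(1,2)] by (intro bexI[of _ t]) simp_all
  then show ?thesis
    using s(1) se(1,2) l4 err unfolding e_def k_def r_def f_def by blast
qed

lemma esac_success_prob:
  "measure M {W \<in> space M. esac_success n p \<sigma> mu 176 lam \<alpha> K 32000 W} > 1 - 1 / real n"
proof -
  interpret N: prob_space M by (rule prob_space_gauss_noise[OF \<sigma>])
  define ix where "ix \<eta> = (SOME j. j \<in> {1..cpJ n p mu} \<and> cpeta n p mu j = \<eta>)" for \<eta>
  have ix: "ix \<eta> \<in> {1..cpJ n p mu}" "cpeta n p mu (ix \<eta>) = \<eta>" if "\<eta> \<in> CP" for \<eta>
    using someI_ex[of "\<lambda>j. j \<in> {1..cpJ n p mu} \<and> cpeta n p mu j = \<eta>"] cps_obtain_index[OF that]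
    unfolding ix_def by blast+
  \<comment> \<open>The certificate depends on the mean matrix and not on the noise
    \<open>W\<close>. So one fixed event per change point has to be excluded, at most n in
    all.\<close>
  define cert where "cert \<eta> s l t \<longleftrightarrow> (s, s + 2 * l) \<in> Ms \<and> s < \<eta> \<and> \<eta> < s + 2 * l \<and>
    4 * l \<le> Delta n p mu (ix \<eta>) + 3 \<and>
    2 * real l - 2 \<le> 32000 * \<sigma>\<^sup>2 / (phi n p mu (ix \<eta>))\<^sup>2 * rfun n p (real (kspar n p mu (ix \<eta>))) \<and>
    t \<in> Tset n p \<and> measure M {W \<in> space M. Sstat n p (obs W) gam s (s + 2 * l) \<eta> t \<le> 0} \<le> exp (- 4 * ln (real n))"
    for \<eta> s l t
  have "\<forall>\<eta>\<in>CP. \<exists>z. cert \<eta> (fst z) (fst (snd z)) (snd (snd z))"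
  proof
    fix \<eta> assume \<eta>: "\<eta> \<in> CP"
    obtain s l t where "cert \<eta> s l t"
      using exists_certificate[OF ix(1)[OF \<eta>] ix(2)[OF \<eta>, symmetric]] unfolding cert_def by blast
    then show "\<exists>z. cert \<eta> (fst z) (fst (snd z)) (snd (snd z))" by (intro exI[of _ "(s, l, t)"]) simp
  qed
  from bchoice[OF this] obtain z where z: "\<forall>\<eta>\<in>CP. cert \<eta> (fst (z \<eta>)) (fst (snd (z \<eta>))) (snd (snd (z \<eta>)))" ..
  define sd where "sd \<eta> = fst (z \<eta>)" for \<eta>
  define lh where "lh \<eta> = fst (snd (z \<eta>))" for \<eta>
  define th where "th \<eta> = snd (snd (z \<eta>))" for \<eta>
  have cert: "(sd \<eta>, sd \<eta> + 2 * lh \<eta>) \<in> Ms \<and> sd \<eta> < \<eta> \<and> \<eta> < sd \<eta> + 2 * lh \<eta> \<and>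
    4 * lh \<eta> \<le> Delta n p mu (ix \<eta>) + 3 \<and>
    2 * real (lh \<eta>) - 2 \<le> 32000 * \<sigma>\<^sup>2 / (phi n p mu (ix \<eta>))\<^sup>2 * rfun n p (real (kspar n p mu (ix \<eta>)))"
    and th: "th \<eta> \<in> Tset n p \<and>
      measure M {W \<in> space M. Sstat n p (obs W) gam (sd \<eta>) (sd \<eta> + 2 * lh \<eta>) \<eta> (th \<eta>) \<le> 0} \<le> exp (- 4 * ln (real n))"
    if "\<eta> \<in> CP" for \<eta>
    using z that unfolding cert_def sd_def lh_def th_def by blast+
  define ed where "ed \<eta> = sd \<eta> + 2 * lh \<eta>" for \<eta>
  define miss where "miss \<eta> = {W \<in> space M. Sstat n p (obs W) gam (sd \<eta>) (ed \<eta>) \<eta> (th \<eta>) \<le> 0}" for \<eta>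
  define fp where "fp = (\<Union>(s, e, v)\<in>splits n. \<Union>t\<in>Tset n p. false_positive n p \<sigma> s e v t)"
  have ed_le: "ed \<eta> \<le> n" if "\<eta> \<in> CP" for \<eta>
    using Mset_bounds(2)[OF n] cert[OF that] by (auto simp: ed_def)
  have miss_sets: "miss \<eta> \<in> sets M" if "\<eta> \<in> CP" for \<eta>
  proof -
    have *: "sd \<eta> < \<eta>" "\<eta> < ed \<eta>" "ed \<eta> \<le> n" using cert[OF that] ed_le[OF that] by (auto simp: ed_def)
    show ?thesis unfolding miss_def Sstat_obs[OF *(1,2)]
      by (intro borel_measurable_le borel_measurable_diff measurable_sum_thresh[OF n p \<sigma> *] borel_measurable_const)
  qed
  have fp_sets: "fp \<in> sets M"
    unfolding fp_def using finite_splits[of n] finite_Tset[of n p]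
    by (auto simp: splits_def intro!: sets.finite_UN false_positive_sets[OF n p \<sigma>])
  have miss_le: "measure M (\<Union>\<eta>\<in>CP. miss \<eta>) \<le> 1 / (4 * real n)"
  proof -
    have "measure M (\<Union>\<eta>\<in>CP. miss \<eta>) \<le> (\<Sum>\<eta>\<in>CP. measure M (miss \<eta>))"
      by (intro N.finite_measure_subadditive_finite finite_cps) (auto intro: miss_sets)
    also have "\<dots> \<le> (\<Sum>\<eta>\<in>CP. 1 / real n ^ 4)"
      using th exp_ln_mult[OF n, of 4] by (intro sum_mono) (auto simp: miss_def ed_def)
    also have "\<dots> = real (card CP) * (1 / real n ^ 4)" by simp
    also have "\<dots> \<le> real n * (1 / real n ^ 4)"
      using card_cps_le[of n p mu] by (intro mult_right_mono) auto
    also have "\<dots> = 1 / real n ^ 2 * (1 / real n)" using n by (simp add: field_simps eval_nat_numeral)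
    also have "\<dots> \<le> 1 / 4 * (1 / real n)"
    proof (rule mult_right_mono)
      have "(2::real) ^ 2 \<le> real n ^ 2" using n by (intro power_mono) auto
      then show "1 / real n ^ 2 \<le> 1 / 4" by (intro divide_left_mono) (use n in auto)
    qed simp
    finally show ?thesis by simp
  qed
  have sep: "\<eta> + 4 * lh \<eta> \<le> \<eta>' + 3 \<and> \<eta> + 4 * lh \<eta>' \<le> \<eta>' + 3" if "\<eta> \<in> CP" "\<eta>' \<in> CP" "\<eta> < \<eta>'" for \<eta> \<eta>'
  proof -
    have "ix \<eta> \<noteq> ix \<eta>'" using ix(2)[OF that(1)] ix(2)[OF that(2)] that(3) by auto
    then have "\<eta> + Delta n p mu (ix \<eta>) \<le> \<eta>'" "\<eta> + Delta n p mu (ix \<eta>') \<le> \<eta>'"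
      using Delta_separates[OF ix(1)[OF that(1)], of "ix \<eta>'"] Delta_separates[OF ix(1)[OF that(2)], of "ix \<eta>"]
        ix[OF that(1)] ix[OF that(2)] n1 that(3) by auto
    then show ?thesis using cert[OF that(1)] cert[OF that(2)] by linarith
  qed
  have good: "esac_success n p \<sigma> mu 176 lam \<alpha> K 32000 W"
    if W: "W \<in> space M" "W \<notin> fp" "W \<notin> (\<Union>\<eta>\<in>CP. miss \<eta>)" for W
  proof -
    have pos: "0 < SmaxV n p (obs W) gam (sd \<eta>) (ed \<eta>)" if "\<eta> \<in> CP" for \<eta>
      by (rule SmaxV_gt_0[of \<eta> _ _ "th \<eta>"]) (use that W cert[OF that] th[OF that] in \<open>auto simp: miss_def ed_def not_le\<close>)
    have null: "SmaxV n p (obs W) gam a b \<le> 0" if ab: "(a, b) \<in> Ms" "a + 1 < b" "{a<..<b} \<inter> CP = {}" for a b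
    proof (rule SmaxV_le_0[OF ab(2)])
      fix v t assume v: "v \<in> {a<..<b}" and t: "t \<in> Tset n p"
      then have avb: "a < v" "v < b" "b \<le> n" using Mset_bounds(2)[OF n ab(1)] by auto
      have zero: "mean a b v i = 0" if "i < p" for i
      proof -
        have const: "mu i t / \<sigma> = mu i (Suc a) / \<sigma>" if "t \<in> {a<..b}" for t
          using mean_constant[OF ab(3) avb(3) \<open>i < p\<close> that] by (rule arg_cong)
        have "mean a b v i = sqrt ((real b - real v) * (real v - real a) / (real b - real a))
            * (mu i (Suc a) / \<sigma> - mu i (Suc a) / \<sigma>)"
          by (rule cusum_step[OF avb(1,2)]; rule const) (use avb in auto)
        then show ?thesis by simp
      qed
      have "(a, b, v) \<in> splits n" using avb by (simp add: splits_def)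
      then have "W \<notin> false_positive n p \<sigma> a b v t" using W(2) t by (auto simp: fp_def)
      then show "Sstat n p (obs W) gam a b v t \<le> 0"
        using W(1) zero unfolding Sstat_obs[OF avb(1,2)] false_positive_def by simp
    qed
    have "card B = cpJ n p mu \<and> (\<forall>j\<in>{1..cpJ n p mu}.
        \<bar>real (sorted_list_of_set B ! (j - 1)) - real (cpeta n p mu j)\<bar>
          \<le> 32000 * \<sigma>\<^sup>2 / (phi n p mu j)\<^sup>2 * rfun n p (real (kspar n p mu j)))"
      if B: "esac n p (obs W) gam lam Ms 0 n B" for B
    proof -
      have CP_eq: "CP \<inter> {0<..<n} = CP" by (auto simp: cps_def)
      have "\<exists>f. strict_mono_on (CP \<inter> {0<..<n}) f \<and> B = f ` (CP \<inter> {0<..<n}) \<and>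
             (\<forall>\<eta> \<in> CP \<inter> {0<..<n}. 0 < f \<eta> \<and> f \<eta> < n \<and> \<bar>int (f \<eta>) - int \<eta>\<bar> \<le> 2 * int (lh \<eta>) - 2)"
        by (rule esac_matches_changepoints[OF B _ finite_Mset[OF n] _ sep pos null])
           (use cert ed_le in \<open>auto simp: ed_def\<close>)
      then obtain f where f: "strict_mono_on CP f" "B = f ` CP"
          "\<And>\<eta>. \<eta> \<in> CP \<Longrightarrow> \<bar>int (f \<eta>) - int \<eta>\<bar> \<le> 2 * int (lh \<eta>) - 2"
        unfolding CP_eq by blast
      have "card B = cpJ n p mu"
        unfolding f(2) cpJ_def by (rule card_image) (rule strict_mono_on_imp_inj_on[OF f(1)])
      moreover have "\<bar>real (sorted_list_of_set B ! (j - 1)) - real (cpeta n p mu j)\<bar>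
          \<le> 32000 * \<sigma>\<^sup>2 / (phi n p mu j)\<^sup>2 * rfun n p (real (kspar n p mu j))"
        if j: "j \<in> {1..cpJ n p mu}" for j
      proof -
        define \<eta> where "\<eta> = cpeta n p mu j"
        have \<eta>: "\<eta> \<in> CP" unfolding \<eta>_def by (rule cpeta_in_cps[OF j])
        have "sorted_list_of_set B ! (j - 1) = f \<eta>"
          unfolding f(2) sorted_list_of_set_image_strict_mono_on[OF finite_cps f(1)] \<eta>_def
          using j by (subst nth_map) (auto simp: cpeta_nth cpJ_def)
        moreover have "ix \<eta> = j"
        proof (rule ccontr)
          assume "ix \<eta> \<noteq> j"
          then show False
            using Delta_separates[OF j _ _ n1, of "ix \<eta>"] ix[OF \<eta>] Delta_pos[OF j n1] by (auto simp: \<eta>_def)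
        qed
        moreover have "\<bar>real (f \<eta>) - real \<eta>\<bar> \<le> 2 * real (lh \<eta>) - 2" using f(3)[OF \<eta>] by linarith
        ultimately show ?thesis using cert[OF \<eta>] by (simp add: \<eta>_def)
      qed
      ultimately show ?thesis by blast
    qed
    then show ?thesis
      unfolding esac_success_def Let_def using esac_total[OF finite_Mset[OF n]] by blast
  qed
  let ?S = "{W \<in> space M. esac_success n p \<sigma> mu 176 lam \<alpha> K 32000 W}"
  \<comment> \<open>The two bad events have total probability at most 1 / (2 n); this slack yields
    the strict inequality.\<close>
  have "1 - 1 / real n < 1 - (1 / (4 * real n) + 1 / (4 * real n))"
    using n by (simp add: field_simps)
  also have "\<dots> \<le> 1 - measure M (fp \<union> (\<Union>\<eta>\<in>CP. miss \<eta>))"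
  proof -
    have "measure M (fp \<union> (\<Union>\<eta>\<in>CP. miss \<eta>)) \<le> measure M fp + measure M (\<Union>\<eta>\<in>CP. miss \<eta>)"
      by (intro measure_Un_le fp_sets sets.finite_UN finite_cps miss_sets)
    then show ?thesis using miss_le false_positive_event_le[OF n p \<sigma>] unfolding fp_def by linarith
  qed
  also have "\<dots> = measure M (space M - (fp \<union> (\<Union>\<eta>\<in>CP. miss \<eta>)))"
    by (intro N.prob_compl[symmetric] sets.Un fp_sets sets.finite_UN finite_cps miss_sets)
  also have "\<dots> \<le> measure M ?S"
    by (intro N.finite_measure_mono esac_success_sets) (use good in auto)
  finally show ?thesis .
qed

end

theorem theorem2:
  shows "\<exists>\<gamma>0 > 0. \<exists>C0 > 0. \<exists>C1 > 0.
    \<forall>(n::nat) (p::nat) (\<sigma>::real) (mu::nat \<Rightarrow> nat \<Rightarrow> real) (lam::nat \<Rightarrow> real) (\<alpha>::real) (K::real).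
      2 \<le> n \<longrightarrow> 1 \<le> p \<longrightarrow> 0 < \<sigma> \<longrightarrow> 1 < \<alpha> \<longrightarrow> \<alpha> \<le> 2 \<longrightarrow> 2 \<le> K \<longrightarrow>
      (\<forall>j\<in>{1..cpJ n p mu}.
          (phi n p mu j)\<^sup>2 * real (Delta n p mu j) / \<sigma>\<^sup>2 \<ge> C0 * rfun n p (real (kspar n p mu j))) \<longrightarrow>
      measure (gauss_noise p n \<sigma>)
        {W \<in> space (gauss_noise p n \<sigma>). esac_success n p \<sigma> mu \<gamma>0 lam \<alpha> K C1 W}
      > 1 - 1 / real n"
proof (rule exI[of _ 176], intro conjI, simp, rule exI[of _ 64000], intro conjI, simp,
    rule exI[of _ 32000], intro conjI, simp, intro allI impI)
  fix n p :: nat and \<sigma> :: real and mu :: "nat \<Rightarrow> nat \<Rightarrow> real" and lam :: "nat \<Rightarrow> real" and \<alpha> K :: real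
  assume *: "2 \<le> n" "1 \<le> p" "0 < \<sigma>" "1 < \<alpha>" "\<alpha> \<le> 2" "2 \<le> K"
    "\<forall>j\<in>{1..cpJ n p mu}.
      (phi n p mu j)\<^sup>2 * real (Delta n p mu j) / \<sigma>\<^sup>2 \<ge> 64000 * rfun n p (real (kspar n p mu j))"
  interpret change_point_model n p \<sigma> mu lam \<alpha> K using * by unfold_locales auto
  show "measure (gauss_noise p n \<sigma>)
      {W \<in> space (gauss_noise p n \<sigma>). esac_success n p \<sigma> mu 176 lam \<alpha> K 32000 W} > 1 - 1 / real n"
    by (rule esac_success_prob)
qed

end
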